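(* Let $R=\mathbb Z_2[[x,y,z]]$ and $S=\mathbb Z_2[[t,y,z]]$, and let $\varphi:R\to S$ be the homomorphism of power series rings over $\mathbb Z_2$ defined by $\varphi(x)=t^4$, $\varphi(y)=y$, $\varphi(z)=z$. Let $P=(2,\ yz-x^3,\ z^2-xy^2,\ x^2z-y^3)\subset R$. Then: (1) $R$ and $S$ are complete regular local rings of characteristic zero; (2) $S$ is finite free of rank $4$ over $R$ (via $\varphi$); (3) $P$ is prime; (4) $S/\sqrt{PS}$ is regular, hence Gorenstein; (5) $R/P$ is not Gorenstein. Consequently, for finite free extensions $R\to S$ of regular local rings of characteristic zero and primes $P$ of $R$, Gorensteinness of $S/\sqrt{PS}$ does not imply Gorensteinness of $R/P$.
   Context: $\mathbb Z_2$ denotes the ring of $2$-adic integers. The map $\varphi$ is the unique continuous $\mathbb Z_2$-algebra homomorphism with the given values on the variables (substitution of power series). $PS$ is the ideal of $S$ generated by $\varphi(P)$ and $\sqrt{PS}$ is its radical. *)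

theory Defs
  imports
    "HOL-Algebra.Algebra"
    "HOL-Algebra.Algebraic_Closure_Type"
    "HOL-Computational_Algebra.Formal_Power_Series"
    "HOL-Library.Extended_Nat"
begin

section \<open>The ring of 2-adic integers\<close>

text \<open>The inverse limit of the rings \<open>\<int>/2\<^sup>n\<close>; the \<open>n\<close>-th component of an element
  is represented by its residue in \<open>{0..<2\<^sup>n}\<close>.\<close>

typedef z2 = "{a :: nat \<Rightarrow> int. \<forall>n. a n \<in> {0..<2 ^ n} \<and> a (Suc n) mod 2 ^ n = a n}"
  morphisms residue Abs_z2
  by (rule exI[of _ "\<lambda>_. 0"]) auto

setup_lifting type_definition_z2

lemma mod_mod_pow2: "(x::int) mod 2 ^ Suc n mod 2 ^ n = x mod 2 ^ n"
  by (simp add: mod_mod_cancel)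

lemma mod_pow2_range: "(x::int) mod 2 ^ n \<in> {0..<2 ^ n}"
  by simp

instantiation z2 :: comm_ring_1
begin

lift_definition zero_z2 :: z2 is "\<lambda>_. 0" by simp

lift_definition one_z2 :: z2 is "\<lambda>n. 1 mod 2 ^ n"
  using mod_mod_pow2 mod_pow2_range by blast

lift_definition plus_z2 :: "z2 \<Rightarrow> z2 \<Rightarrow> z2" is "\<lambda>a b n. (a n + b n) mod 2 ^ n"
  by (intro allI conjI mod_pow2_range) (metis mod_add_eq mod_mod_pow2)

lift_definition minus_z2 :: "z2 \<Rightarrow> z2 \<Rightarrow> z2" is "\<lambda>a b n. (a n - b n) mod 2 ^ n"
  by (intro allI conjI mod_pow2_range) (metis mod_diff_eq mod_mod_pow2)

lift_definition uminus_z2 :: "z2 \<Rightarrow> z2" is "\<lambda>a n. (- a n) mod 2 ^ n"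
  by (intro allI conjI mod_pow2_range) (metis mod_minus_eq mod_mod_pow2)

lift_definition times_z2 :: "z2 \<Rightarrow> z2 \<Rightarrow> z2" is "\<lambda>a b n. (a n * b n) mod 2 ^ n"
  by (intro allI conjI mod_pow2_range) (metis mod_mult_eq mod_mod_pow2)

instance
proof
  fix a b c :: z2
  show "a + b + c = a + (b + c)"
    by transfer (simp add: fun_eq_iff mod_simps add.assoc)
  show "a + b = b + a"
    by transfer (simp add: fun_eq_iff add.commute)
  show "0 + a = a"
    by (transfer, rule ext, unfold add_0, rule mod_pos_pos_trivial) auto
  show "- a + a = 0"
    by transfer (simp add: fun_eq_iff mod_simps)
  show "a - b = a + - b"
    by transfer (simp add: fun_eq_iff mod_simps)
  show "a * b * c = a * (b * c)"
    by transfer (simp add: fun_eq_iff mod_simps mult.assoc)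
  show "a * b = b * a"
    by transfer (simp add: fun_eq_iff mult.commute)
  show "1 * a = a"
    by (transfer, rule ext, unfold mod_mult_left_eq mult_1, rule mod_pos_pos_trivial) auto
  show "(a + b) * c = a * c + b * c"
    by transfer (simp add: fun_eq_iff mod_simps distrib_right)
  show "(0::z2) \<noteq> 1"
  proof
    assume "(0::z2) = 1"
    hence "residue 0 1 = residue 1 1" by simp
    thus False by (simp add: zero_z2.rep_eq one_z2.rep_eq)
  qed
qed

end


section \<open>The power series rings\<close>

text \<open>\<open>\<int>\<^sub>2[[x,y,z]]\<close> is \<open>((\<int>\<^sub>2[[x]])[[y]])[[z]]\<close>: in \<open>F :: z2_series3\<close> the coefficient of
  \<open>x\<^sup>i y\<^sup>j z\<^sup>k\<close> is \<open>F $ k $ j $ i\<close>. The rings \<open>\<int>\<^sub>2[[x,y,z]]\<close> and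
  \<open>\<int>\<^sub>2[[t,y,z]]\<close> differ only in the name of the first variable.\<close>

type_synonym z2_series3 = "z2 fps fps fps"

definition ring_xyz :: "z2_series3 ring" where
  "ring_xyz = ring_of_type_algebra"

definition ring_tyz :: "z2_series3 ring" where
  "ring_tyz = ring_of_type_algebra"

definition var_x :: z2_series3 where "var_x = fps_const (fps_const fps_X)"
definition var_t :: z2_series3 where "var_t = fps_const (fps_const fps_X)"
definition var_y :: z2_series3 where "var_y = fps_const fps_X"
definition var_z :: z2_series3 where "var_z = fps_X"

definition z2_const :: "z2 \<Rightarrow> z2_series3" where
  "z2_const a = fps_const (fps_const (fps_const a))"

text \<open>Substitution of \<open>t\<^sup>4\<close> for \<open>x\<close>, of \<open>y\<close> for \<open>y\<close> and of \<open>z\<close> for \<open>z\<close>.\<close>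

definition phi :: "z2_series3 \<Rightarrow> z2_series3" where
  "phi F = Abs_fps (\<lambda>k. Abs_fps (\<lambda>j. fps_compose (F $ k $ j) (fps_X ^ 4)))"

definition ideal_P :: "z2_series3 set" where
  "ideal_P = Idl\<^bsub>ring_xyz\<^esub> {2, var_y * var_z - var_x ^ 3,
      var_z ^ 2 - var_x * var_y ^ 2, var_x ^ 2 * var_z - var_y ^ 3}"

lemma compose_X4_nth:
  "fps_compose (f :: 'a :: comm_ring_1 fps) (fps_X ^ 4) $ n = (if 4 dvd n then f $ (n div 4) else 0)"
proof -
  have "fps_compose f (fps_X ^ 4) $ n = (\<Sum>i=0..n. if n = 4 * i then f $ i else 0)"
    unfolding fps_compose_nth power_mult[symmetric] fps_X_power_nth by (rule sum.cong) auto
  also have "\<dots> = (if 4 dvd n then f $ (n div 4) else 0)"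
  proof (cases "4 dvd n")
    case True
    then obtain m where m: "n = 4 * m" by blast
    show ?thesis by (simp add: m)
  next
    case False
    hence "n \<noteq> 4 * i" for i by auto
    thus ?thesis using False by simp
  qed
  finally show ?thesis .
qed

lemma phi_nth: "phi F $ k $ j $ i = (if 4 dvd i then F $ k $ j $ (i div 4) else 0)"
  by (simp add: phi_def compose_X4_nth)

lemma compose_X4_mult:
  "fps_compose (f * g :: 'a :: comm_ring_1 fps) (fps_X ^ 4) =
     fps_compose f (fps_X ^ 4) * fps_compose g (fps_X ^ 4)"
proof (rule fps_ext)
  fix n
  let ?h = "\<lambda>i. if 4 dvd i \<and> 4 dvd (n - i) then f $ (i div 4) * g $ ((n - i) div 4) else 0"
  have *: "(fps_compose f (fps_X ^ 4) * fps_compose g (fps_X ^ 4)) $ n = (\<Sum>i=0..n. ?h i)"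
    unfolding fps_mult_nth compose_X4_nth by (rule sum.cong) auto
  show "fps_compose (f * g) (fps_X ^ 4) $ n =
      (fps_compose f (fps_X ^ 4) * fps_compose g (fps_X ^ 4)) $ n"
  proof (cases "4 dvd n")
    case False
    have "?h i = 0" if "i \<in> {0..n}" for i
      using that False by (auto dest: dvd_diffD)
    hence "(\<Sum>i=0..n. ?h i) = 0" by (intro sum.neutral) blast
    thus ?thesis using False * by (simp only: compose_X4_nth if_False)
  next
    case True
    then obtain m where m: "n = 4 * m" by blast
    have "(\<Sum>i=0..n. ?h i) = (\<Sum>i\<in>(\<lambda>i. 4 * i) ` {0..m}. ?h i)"
    proof (rule sum.mono_neutral_right)
      show "\<forall>i\<in>{0..n} - (\<lambda>i. 4 * i) ` {0..m}. ?h i = 0"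
        by (auto simp: m elim!: dvdE)
    qed (auto simp: m)
    also have "\<dots> = (\<Sum>i=0..m. f $ i * g $ (m - i))"
      by (subst sum.reindex) (auto simp: inj_on_def m simp flip: diff_mult_distrib2 intro!: sum.cong)
    finally show ?thesis using True m * by (simp add: compose_X4_nth fps_mult_nth)
  qed
qed

lemma phi_mult: "phi (F * G) = phi F * phi G"
  by (intro fps_ext[where 'a = "z2 fps fps"] fps_ext[where 'a = "z2 fps"])
     (simp add: phi_def fps_mult_nth fps_compose_sum_distrib compose_X4_mult fps_sum_nth)

lemma phi_hom: "phi \<in> ring_hom ring_xyz ring_tyz"
proof (rule ring_hom_memI)
  show "phi \<one>\<^bsub>ring_xyz\<^esub> = \<one>\<^bsub>ring_tyz\<^esub>"
    by (auto simp: fps_eq_iff phi_nth ring_xyz_def ring_tyz_def ring_of_type_algebra_def fps_one_nth elim!: dvdE)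
  show "phi (F \<otimes>\<^bsub>ring_xyz\<^esub> G) = phi F \<otimes>\<^bsub>ring_tyz\<^esub> phi G" for F G
    by (simp add: phi_mult ring_xyz_def ring_tyz_def ring_of_type_algebra_def)
  show "phi (F \<oplus>\<^bsub>ring_xyz\<^esub> G) = phi F \<oplus>\<^bsub>ring_tyz\<^esub> phi G" for F G
    by (simp add: fps_eq_iff phi_nth ring_xyz_def ring_tyz_def ring_of_type_algebra_def)
qed (simp add: ring_tyz_def ring_of_type_algebra_def)

lemma phi_simps:
  "phi (z2_const a) = z2_const a" "phi var_x = var_t ^ 4" "phi var_y = var_y" "phi var_z = var_z"
proof -
  show "phi (z2_const a) = z2_const a"
    by (auto simp: fps_eq_iff phi_nth z2_const_def elim!: dvdE)
  have "var_t ^ 4 = fps_const (fps_const (fps_X ^ 4))"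
    by (simp add: var_t_def fps_const_power)
  thus "phi var_x = var_t ^ 4"
    by (auto simp: fps_eq_iff phi_nth var_x_def fps_X_power_iff elim!: dvdE)
  show "phi var_y = var_y"
    by (auto simp: fps_eq_iff phi_nth var_y_def fps_X_nth fps_one_nth elim!: dvdE)
  show "phi var_z = var_z"
    by (auto simp: fps_eq_iff phi_nth var_z_def fps_X_nth fps_one_nth elim!: dvdE)
qed


section \<open>Local rings\<close>

definition local_ring :: "('a, 'm) ring_scheme \<Rightarrow> bool" where
  "local_ring R \<longleftrightarrow> cring R \<and> (\<exists>!M. maximalideal M R)"

definition max_ideal :: "('a, 'm) ring_scheme \<Rightarrow> 'a set" where
  "max_ideal R = (THE M. maximalideal M R)"

text \<open>Supremum of the lengths of strict chains of prime ideals.\<close>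

definition krull_dim :: "('a, 'm) ring_scheme \<Rightarrow> enat" where
  "krull_dim R = Sup {enat n | n. \<exists>p. (\<forall>i\<le>n. primeideal (p i) R) \<and> (\<forall>i<n. p i \<subset> p (Suc i))}"

text \<open>The minimal number of generators of the maximal ideal.\<close>

definition embedding_dim :: "('a, 'm) ring_scheme \<Rightarrow> nat" where
  "embedding_dim R =
     (LEAST n. \<exists>B. B \<subseteq> carrier R \<and> finite B \<and> card B = n \<and> Idl\<^bsub>R\<^esub> B = max_ideal R)"

definition regular_local_ring :: "('a, 'm) ring_scheme \<Rightarrow> bool" where
  "regular_local_ring R \<longleftrightarrow>
     noetherian_ring R \<and> local_ring R \<and> krull_dim R = enat (embedding_dim R)"

text \<open>The map from \<open>R\<close> to the inverse limit of the \<open>R/m\<^sup>n\<close> is bijective; an element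
  of the limit is given by representatives \<open>a n\<close>.\<close>

definition complete_local_ring :: "('a, 'm) ring_scheme \<Rightarrow> bool" where
  "complete_local_ring R \<longleftrightarrow> local_ring R \<and>
     (\<forall>a. (\<forall>n. a n \<in> carrier R \<and>
               a (Suc n) \<ominus>\<^bsub>R\<^esub> a n \<in> max_ideal R [^]\<^bsub>ideals_set R\<^esub> (n::nat)) \<longrightarrow>
          (\<exists>!b. b \<in> carrier R \<and>
               (\<forall>n. b \<ominus>\<^bsub>R\<^esub> a n \<in> max_ideal R [^]\<^bsub>ideals_set R\<^esub> (n::nat))))"

definition characteristic_zero :: "('a, 'm) ring_scheme \<Rightarrow> bool" where
  "characteristic_zero R \<longleftrightarrow> (\<forall>n::nat. n > 0 \<longrightarrow> [n] \<cdot>\<^bsub>R\<^esub> \<one>\<^bsub>R\<^esub> \<noteq> \<zero>\<^bsub>R\<^esub>)"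

definition radical_ideal :: "('a, 'm) ring_scheme \<Rightarrow> 'a set \<Rightarrow> 'a set" where
  "radical_ideal R I = {a \<in> carrier R. \<exists>n::nat. a [^]\<^bsub>R\<^esub> n \<in> I}"

definition extended_ideal :: "('b, 'n) ring_scheme \<Rightarrow> ('a \<Rightarrow> 'b) \<Rightarrow> 'a set \<Rightarrow> 'b set" where
  "extended_ideal S \<phi> I = Idl\<^bsub>S\<^esub> (\<phi> ` I)"


section \<open>Free modules\<close>

definition module_via :: "('a \<Rightarrow> 'b) \<Rightarrow> ('b, 'n) ring_scheme \<Rightarrow> ('a, 'b) module" where
  "module_via \<phi> S = \<lparr>carrier = carrier S, monoid.mult = monoid.mult S, one = one S,
     ring.zero = ring.zero S, ring.add = ring.add S, module.smult = (\<lambda>a s. \<phi> a \<otimes>\<^bsub>S\<^esub> s)\<rparr>"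

definition free_of_rank :: "('a, 'r) ring_scheme \<Rightarrow> ('a, 'b) module \<Rightarrow> nat \<Rightarrow> bool" where
  "free_of_rank R M n \<longleftrightarrow> module R M \<and>
     (\<exists>b \<in> {..<n} \<rightarrow> carrier M. \<forall>s \<in> carrier M.
        \<exists>!c. c \<in> {..<n} \<rightarrow>\<^sub>E carrier R \<and> s = (\<Oplus>\<^bsub>M\<^esub>i\<in>{..<n}. c i \<odot>\<^bsub>M\<^esub> b i))"

definition finite_free :: "('a, 'r) ring_scheme \<Rightarrow> ('a, 'b) module \<Rightarrow> bool" where
  "finite_free R M \<longleftrightarrow> (\<exists>n. free_of_rank R M n)"


section \<open>Gorenstein rings\<close>

definition module_homs ::
  "('a, 'r) ring_scheme \<Rightarrow> ('a, 'b) module \<Rightarrow> ('a, 'c) module \<Rightarrow> ('b \<Rightarrow> 'c) set" where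
  "module_homs R M N = {f \<in> carrier M \<rightarrow> carrier N.
     (\<forall>x\<in>carrier M. \<forall>y\<in>carrier M. f (x \<oplus>\<^bsub>M\<^esub> y) = f x \<oplus>\<^bsub>N\<^esub> f y) \<and>
     (\<forall>a\<in>carrier R. \<forall>x\<in>carrier M. f (a \<odot>\<^bsub>M\<^esub> x) = a \<odot>\<^bsub>N\<^esub> f x)}"

text \<open>The usual lifting property. HOL cannot quantify over the types of the test modules
  \<open>M\<close>, \<open>N\<close> inside a definition; they are taken on the element type of \<open>R\<close>. This
  loses nothing: \<open>R\<close> and its ideals live on that type, so Baer's criterion gives the
  lifting property for test modules on every type.\<close>

definition injective_module :: "'a ring \<Rightarrow> ('a, 'e) module \<Rightarrow> bool" where
  "injective_module R E \<longleftrightarrow> module R E \<and>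
     (\<forall>(M :: ('a, 'a) module) (N :: ('a, 'a) module) f g.
        module R M \<and> module R N \<and> f \<in> module_homs R M N \<and> inj_on f (carrier M) \<and>
        g \<in> module_homs R M E \<longrightarrow>
        (\<exists>h \<in> module_homs R N E. \<forall>x\<in>carrier M. h (f x) = g x))"

definition module_kernel :: "('a, 'b) module \<Rightarrow> ('a, 'c) module \<Rightarrow> ('b \<Rightarrow> 'c) \<Rightarrow> 'b set" where
  "module_kernel M N f = {x \<in> carrier M. f x = \<zero>\<^bsub>N\<^esub>}"

text \<open>An exact sequence \<open>0 \<rightarrow> M \<rightarrow> E 0 \<rightarrow> E 1 \<rightarrow> \<dots>\<close> with all \<open>E i\<close> injective.\<close>

definition injective_resolution :: "'a ring \<Rightarrow> ('a, 'b) module \<Rightarrow> (nat \<Rightarrow> ('a, 'e) module) \<Rightarrow>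
    ('b \<Rightarrow> 'e) \<Rightarrow> (nat \<Rightarrow> 'e \<Rightarrow> 'e) \<Rightarrow> bool" where
  "injective_resolution R M E \<epsilon> d \<longleftrightarrow> module R M \<and>
     (\<forall>i. injective_module R (E i)) \<and>
     \<epsilon> \<in> module_homs R M (E 0) \<and> inj_on \<epsilon> (carrier M) \<and>
     (\<forall>i. d i \<in> module_homs R (E i) (E (Suc i))) \<and>
     \<epsilon> ` carrier M = module_kernel (E 0) (E 1) (d 0) \<and>
     (\<forall>i. d i ` carrier (E i) = module_kernel (E (Suc i)) (E (Suc (Suc i))) (d (Suc i)))"

text \<open>Finite injective dimension of \<open>R\<close> as a module over itself. The modules of the
  resolution live on \<open>nat \<Rightarrow> 'a\<close>, which is large enough: over an infinite Noetherian
  ring every term of a minimal injective resolution of \<open>R\<close> is a finite direct sum of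
  hulls \<open>E(R/p)\<close>, of cardinality at most that of \<open>R\<close>, and a finite local ring of finite
  injective dimension is itself injective.\<close>

definition finite_self_injective_dim :: "'a ring \<Rightarrow> bool" where
  "finite_self_injective_dim R \<longleftrightarrow>
     (\<exists>(E :: nat \<Rightarrow> ('a, nat \<Rightarrow> 'a) module) \<epsilon> d n.
        injective_resolution R (module_via (\<lambda>a. a) R) E \<epsilon> d \<and>
        (\<forall>i>n. carrier (E i) = {\<zero>\<^bsub>E i\<^esub>}))"

definition gorenstein_local_ring :: "'a ring \<Rightarrow> bool" where
  "gorenstein_local_ring R \<longleftrightarrow>
     noetherian_ring R \<and> local_ring R \<and> finite_self_injective_dim R"

end

(* Dimension: Krull's height theorem, proved by the length argument of Rees and Kaplansky, bounds
   the length of prime chains in a power series ring by the number of generators of its maximal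
   ideal, and chains of that length are written down.

   Put A = F_2[[u]]. The substitution 2 = 0, x = u^4, y = u^5, z = u^7 maps R to A with kernel P:
   modulo P every series is a(x) + b(x) y + c(x) y^2 + d(x) z, and the four summands go to exponents
   in different classes modulo 4. The ideal PS contains 2 and (z - t^2 y)^2, hence its
   radical contains z - t^2 y and then (y - t^5)^3, so this radical is the kernel of 2 = 0,
   y = t^5, z = t^7, and S modulo it is the discrete valuation ring A. It is Gorenstein by the
   injective resolution 0 -> A -> K -> K/A -> 0, K the field of fractions.

   B = R/P is not Gorenstein: z and y^2 are socle elements of B/(x) that are not proportional.
   If B had finite injective dimension, Ext vanishing would descend along a composition series of
   B/(x,z) down to Ext^2, where it forces the two elements to be proportional. *)

theory Submission
  imports Defs "HOL-Number_Theory.Cong" "HOL-Library.Z2" "HOL-Computational_Algebra.Formal_Laurent_Series"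
begin

subsection \<open>Ideals and prime ideals\<close>

text \<open>The exponents 4, 5, 7 generate a numerical semigroup with gaps 1, 2, 3, 6. It is not
  symmetric: both 3 and 6 become members on adding any nonzero member, and adding 4 to them gives 7
  and 10, the exponents of the socle elements z and y^2 modulo x. The defect disappears upstairs
  because 4 is a power of the residue characteristic: modulo 2 the equation x = t^4 is purely
  inseparable, so a single prime of S lies over P, and modulo it t becomes u itself, which generates
  A. Since the definition of injective dimension offers an arbitrary finite resolution, the
  comparison of injective dimension with depth is replaced by a diagram chase in its modules. The
  chase uses that nonunits of B lie in (x, y, z), that x is regular, three relations and two
  non-memberships. Ideal theory is done on types, in the classes \<open>noeth_ring\<close> and
  \<open>filtered_ring\<close>, because both pass from a ring to its power series ring;
  \<open>ring_of_type_algebra\<close> and explicit isomorphisms carry the results over to carriers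
  and cosets.\<close>

definition (in comm_ring_1) is_ideal :: "'a set \<Rightarrow> bool" where
  "is_ideal I \<longleftrightarrow> 0 \<in> I \<and> (\<forall>a\<in>I. \<forall>b\<in>I. a + b \<in> I) \<and> (\<forall>a\<in>I. \<forall>r. r * a \<in> I)"

definition (in comm_ring_1) is_prime :: "'a set \<Rightarrow> bool" where
  "is_prime I \<longleftrightarrow> is_ideal I \<and> 1 \<notin> I \<and> (\<forall>a b. a * b \<in> I \<longrightarrow> a \<in> I \<or> b \<in> I)"

text \<open>Finite generation is expressed by the universal property of the generated ideal, so no
  ideal span has to be formed inside the class.\<close>

class noeth_ring = comm_ring_1 +
  assumes finitely_generated:
    "is_ideal I \<Longrightarrow> \<exists>B. finite B \<and> B \<subseteq> I \<and> (\<forall>J. is_ideal J \<longrightarrow> B \<subseteq> J \<longrightarrow> I \<subseteq> J)"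

lemma ideal_zero: "is_ideal I \<Longrightarrow> 0 \<in> I"
  and ideal_add: "is_ideal I \<Longrightarrow> a \<in> I \<Longrightarrow> b \<in> I \<Longrightarrow> a + b \<in> I"
  and ideal_mult: "is_ideal I \<Longrightarrow> a \<in> I \<Longrightarrow> r * a \<in> I"
  for I :: "'a::comm_ring_1 set"
  by (auto simp: is_ideal_def)

lemma ideal_mult2: "is_ideal I \<Longrightarrow> a \<in> I \<Longrightarrow> a * r \<in> I" for I :: "'a::comm_ring_1 set"
  using ideal_mult[of I a r] by (simp add: mult.commute)

lemma ideal_uminus: "is_ideal I \<Longrightarrow> a \<in> I \<Longrightarrow> - a \<in> I" for I :: "'a::comm_ring_1 set"
  using ideal_mult[of I a "-1"] by simp

lemma ideal_diff: "is_ideal I \<Longrightarrow> a \<in> I \<Longrightarrow> b \<in> I \<Longrightarrow> a - b \<in> I" for I :: "'a::comm_ring_1 set"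
  using ideal_add[of I a "-b"] ideal_uminus[of I b] by simp

lemma ideal_diff_cancel: "is_ideal I \<Longrightarrow> a - b \<in> I \<Longrightarrow> a \<in> I \<longleftrightarrow> b \<in> I" for I :: "'a::comm_ring_1 set"
  using ideal_add[of I "a - b" b] ideal_diff[of I a "a - b"] by auto

lemma ideal_one: "is_ideal I \<Longrightarrow> 1 \<in> I \<Longrightarrow> I = UNIV" for I :: "'a::comm_ring_1 set"
  using ideal_mult[of I 1] by auto

lemma is_prime_ideal: "is_prime p \<Longrightarrow> is_ideal p" for p :: "'a::comm_ring_1 set"
  by (simp add: is_prime_def)

lemma prime_mult: "is_prime p \<Longrightarrow> a * b \<in> p \<longleftrightarrow> a \<in> p \<or> b \<in> p" for p :: "'a::comm_ring_1 set"
  using ideal_mult[of p b a] ideal_mult2[of p a b] by (auto simp: is_prime_def)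

lemma prime_power: "is_prime p \<Longrightarrow> a ^ n \<in> p \<Longrightarrow> a \<in> p" for p :: "'a::comm_ring_1 set"
proof (induction n)
  case 0
  then show ?case using ideal_mult[of p 1 a] by (simp add: is_prime_def)
next
  case (Suc n)
  then show ?case using prime_mult[of p a "a ^ n"] by auto
qed

text \<open>Zorn: the union of a chain of ideals is an ideal, and its finite generating set already
  lies in one member of the chain, which is therefore an upper bound. All Noetherian inductions
  below start from this.\<close>

lemma noetherian_maximal:
  fixes F :: "'a::noeth_ring set set"
  assumes "F \<noteq> {}" "\<And>I. I \<in> F \<Longrightarrow> is_ideal I"
  shows "\<exists>M\<in>F. \<forall>V\<in>F. M \<subseteq> V \<longrightarrow> V = M"
proof (rule subset_Zorn_nonempty[OF assms(1)])
  fix C assume C: "C \<noteq> {}" "subset.chain F C"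
  have CF: "C \<subseteq> F" and ch: "\<And>V Y. V \<in> C \<Longrightarrow> Y \<in> C \<Longrightarrow> V \<subseteq> Y \<or> Y \<subseteq> V"
    using C(2) by (auto simp: subset.chain_def)
  have id: "is_ideal V" if "V \<in> C" for V using that CF assms(2) by auto
  have "is_ideal (\<Union>C)"
    unfolding is_ideal_def
  proof (intro conjI ballI allI)
    show "0 \<in> \<Union>C" using C(1) id ideal_zero by blast
  next
    fix a b assume "a \<in> \<Union>C" "b \<in> \<Union>C"
    then obtain V Y where "V \<in> C" "Y \<in> C" "a \<in> V" "b \<in> Y" by auto
    then show "a + b \<in> \<Union>C" using ch[of V Y] ideal_add[OF id] by blast
  next
    fix a r assume "a \<in> \<Union>C"
    then show "r * a \<in> \<Union>C" using ideal_mult[OF id] by blast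
  qed
  from finitely_generated[OF this]
  obtain B where B: "finite B" "B \<subseteq> \<Union>C" "\<forall>J. is_ideal J \<longrightarrow> B \<subseteq> J \<longrightarrow> \<Union>C \<subseteq> J"
    by (elim exE conjE)
  obtain V where V: "V \<in> C" "B \<subseteq> V"
    using finite_subset_Union_chain[OF B(1,2) C] by blast
  then have "\<Union>C = V" using B(3) id by blast
  then show "\<Union>C \<in> F" using V CF by auto
qed

subsection \<open>Chains of saturated ideals\<close>

text \<open>Stands in for the length of a module: instead of composition series, only bounds on the
  number of strict inclusions between two members of a family of ideals are used.\<close>

inductive lchain :: "('a set \<Rightarrow> bool) \<Rightarrow> 'a set \<Rightarrow> 'a set \<Rightarrow> nat \<Rightarrow> bool" for L where
  base: "L I \<Longrightarrow> lchain L I I 0"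
| step: "lchain L I J n \<Longrightarrow> J \<subset> K \<Longrightarrow> L K \<Longrightarrow> lchain L I K (Suc n)"

lemma lchain_props: "lchain L I J n \<Longrightarrow> L I \<and> L J \<and> I \<subseteq> J"
  by (induction rule: lchain.induct) auto

lemma lchain_strict: "lchain L I J n \<Longrightarrow> n \<noteq> 0 \<Longrightarrow> I \<subset> J"
  by (erule lchain.cases) (auto dest: lchain_props)

lemma lchain_trans: "lchain L J K n \<Longrightarrow> lchain L I J m \<Longrightarrow> lchain L I K (m + n)"
  by (induction rule: lchain.induct) (auto intro: lchain.intros)

text \<open>If \<open>B\<close> is properly inside \<open>C\<close>, that inclusion is a further
  step, hence an inequality for \<open>k\<close>.\<close>

lemma lchain_join:
  assumes "lchain L A B m" "lchain L C D n" "B \<subseteq> C"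
  shows "\<exists>k\<ge>m + n. lchain L A D k"
proof (cases "B = C")
  case True
  then show ?thesis using lchain_trans[OF assms(2)] assms(1) by blast
next
  case False
  then have "lchain L A C (Suc m)"
    using assms lchain_props[OF assms(2)] by (auto intro: lchain.step)
  from lchain_trans[OF assms(2) this] show ?thesis by (intro exI[of _ "Suc m + n"]) auto
qed

text \<open>Strictness is asked only for members between \<open>I\<close> and \<open>U\<close>;
  multiplication by \<open>y\<close> and division by \<open>u\<close> in the height argument are
  shown to be strict only on such an interval.\<close>

lemma lchain_map:
  assumes "lchain L I J n" "J \<subseteq> U"
    and "\<And>V. L V \<Longrightarrow> L (T V)"
    and "\<And>V Y. L V \<Longrightarrow> L Y \<Longrightarrow> I \<subseteq> V \<Longrightarrow> V \<subset> Y \<Longrightarrow> Y \<subseteq> U \<Longrightarrow> T V \<subset> T Y"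
  shows "lchain L (T I) (T J) n"
  using assms
proof (induction rule: lchain.induct)
  case (step I J n K)
  have JK: "J \<subset> K" and JU: "J \<subseteq> U" using step.hyps(2) step.prems(1) by auto
  have "lchain L (T I) (T J) n" using step.IH[OF JU] step.prems by blast
  moreover have "T J \<subset> T K"
    using step.prems(3)[OF _ step.hyps(3) _ JK step.prems(1)] lchain_props[OF step.hyps(1)] by blast
  ultimately show ?case using step.prems(2)[OF step.hyps(3)] by (rule lchain.step)
qed (auto intro: lchain.base)

text \<open>The contraction of the extension of \<open>I\<close> to the localization at
  \<open>p\<close>. Computing with such ideals avoids constructing the local ring.\<close>

definition saturation :: "'a::comm_ring_1 set \<Rightarrow> 'a set \<Rightarrow> 'a set" where
  "saturation p I = {a. \<exists>w. w \<notin> p \<and> w * a \<in> I}"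

lemma saturation_ideal:
  fixes p :: "'a::comm_ring_1 set"
  assumes p: "is_prime p" and I: "is_ideal I"
  shows "is_ideal (saturation p I)"
  unfolding is_ideal_def
proof (intro conjI ballI allI)
  show "0 \<in> saturation p I"
    using p ideal_zero[OF I] by (auto simp: saturation_def is_prime_def intro!: exI[of _ 1])
next
  fix a b assume "a \<in> saturation p I" "b \<in> saturation p I"
  then obtain v w where vw: "v \<notin> p" "v * a \<in> I" "w \<notin> p" "w * b \<in> I" by (auto simp: saturation_def)
  have "v * w * (a + b) = w * (v * a) + v * (w * b)" by (simp add: algebra_simps)
  then have "v * w * (a + b) \<in> I" using vw by (simp add: ideal_add ideal_mult I)
  then show "a + b \<in> saturation p I" using vw prime_mult[OF p] by (auto simp: saturation_def)
next
  fix a r assume "a \<in> saturation p I"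
  then obtain v where v: "v \<notin> p" "v * a \<in> I" by (auto simp: saturation_def)
  have "v * (r * a) \<in> I" using ideal_mult[OF I v(2), of r] by (simp add: mult.left_commute)
  then show "r * a \<in> saturation p I" using v(1) by (auto simp: saturation_def)
qed

lemma saturation_subset: "is_prime p \<Longrightarrow> I \<subseteq> saturation p I" for p :: "'a::comm_ring_1 set"
  by (auto simp: saturation_def is_prime_def intro!: exI[of _ 1])

lemma saturation_saturated:
  fixes p :: "'a::comm_ring_1 set"
  shows "is_prime p \<Longrightarrow> w \<notin> p \<Longrightarrow> w * a \<in> saturation p I \<Longrightarrow> a \<in> saturation p I"
  unfolding saturation_def mem_Collect_eq mult.assoc[symmetric] using prime_mult by blast

text \<open>For \<open>p0\<close> inside the prime \<open>p\<close> these ideals correspond to the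
  ideals of the localization at \<open>p\<close> of the quotient by \<open>p0\<close>.\<close>

definition saturated_over :: "'a::comm_ring_1 set \<Rightarrow> 'a set \<Rightarrow> 'a set \<Rightarrow> bool" where
  "saturated_over p0 p I \<longleftrightarrow> is_ideal I \<and> p0 \<subseteq> I \<and> (\<forall>w a. w \<notin> p \<longrightarrow> w * a \<in> I \<longrightarrow> a \<in> I)"

lemma saturated_over_saturation:
  assumes "is_prime p" "is_ideal I" "p0 \<subseteq> I"
  shows "saturated_over p0 p (saturation p I)"
  using assms saturation_ideal saturation_subset saturation_saturated
  unfolding saturated_over_def by blast

definition ideal_sum :: "'a::comm_ring_1 set \<Rightarrow> 'a set \<Rightarrow> 'a set" where
  "ideal_sum I J = {a. \<exists>b\<in>J. a - b \<in> I}"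

lemma ideal_sum_ideal: 
  assumes I: "is_ideal I" and J: "is_ideal J" shows "is_ideal (ideal_sum I J)"
  unfolding is_ideal_def
proof (intro conjI ballI allI)
  show "0 \<in> ideal_sum I J" using ideal_zero[OF I] ideal_zero[OF J] by (force simp: ideal_sum_def)
next
  fix a b assume "a \<in> ideal_sum I J" "b \<in> ideal_sum I J"
  then obtain v w where vw: "v \<in> J" "w \<in> J" "a - v \<in> I" "b - w \<in> I" by (auto simp: ideal_sum_def)
  have "a + b - (v + w) = (a - v) + (b - w)" by simp
  then show "a + b \<in> ideal_sum I J" using vw I J by (metis (mono_tags, lifting) ideal_add ideal_sum_def mem_Collect_eq)
next
  fix a r assume "a \<in> ideal_sum I J"
  then obtain v where v: "v \<in> J" "a - v \<in> I" by (auto simp: ideal_sum_def)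
  have "r * a - r * v = r * (a - v)" by (simp add: algebra_simps)
  then show "r * a \<in> ideal_sum I J" using v I J by (metis (mono_tags, lifting) ideal_mult ideal_sum_def mem_Collect_eq)
qed

lemma ideal_sum_upper: 
  "is_ideal J \<Longrightarrow> I \<subseteq> ideal_sum I J" "is_ideal I \<Longrightarrow> J \<subseteq> ideal_sum I J"
  by (auto simp: ideal_sum_def intro: bexI[of _ 0] ideal_zero) (metis cancel_comm_monoid_add_class.diff_cancel ideal_zero)

lemma ideal_sum_least: "is_ideal K \<Longrightarrow> I \<subseteq> K \<Longrightarrow> J \<subseteq> K \<Longrightarrow> ideal_sum I J \<subseteq> K"
  unfolding ideal_sum_def using ideal_diff_cancel by blast

lemma saturation_least: "saturated_over p0 p K \<Longrightarrow> I \<subseteq> K \<Longrightarrow> saturation p I \<subseteq> K"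
  unfolding saturated_over_def saturation_def by blast

lemma saturated_over_join:
  assumes "is_prime p" "saturated_over p0 p I" "saturated_over p0 p J"
  shows "saturated_over p0 p (saturation p (ideal_sum I J))"
proof -
  have "is_ideal I" "is_ideal J" "p0 \<subseteq> I" using assms by (auto simp: saturated_over_def)
  then show ?thesis
    using assms(1) ideal_sum_upper(1)[of J I] by (intro saturated_over_saturation ideal_sum_ideal) auto
qed

text \<open>In each step the trace on \<open>K\<close> or the join with \<open>K\<close> grows, by the modular law.\<close>

lemma lchain_cut:
  assumes p: "is_prime p" and "lchain (saturated_over p0 p) I J n" and K: "saturated_over p0 p K"
  shows "\<exists>a b. lchain (saturated_over p0 p) (I \<inter> K) (J \<inter> K) a \<and>
    lchain (saturated_over p0 p) (saturation p (ideal_sum I K)) (saturation p (ideal_sum J K)) b \<and> n \<le> a + b"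
  using assms(2)
proof (induction rule: lchain.induct)
  let ?L = "saturated_over p0 p"
  have int: "saturated_over p0 p (V \<inter> K)" if "saturated_over p0 p V" for V
    using that K unfolding saturated_over_def is_ideal_def by blast
  { case (base I)
    then show ?case using int saturated_over_join[OF p base K] by (blast intro: lchain.base) }
  case (step I J n M)
  have J: "saturated_over p0 p J" using lchain_props step by blast
  obtain a b where ab: "lchain (saturated_over p0 p) (I \<inter> K) (J \<inter> K) a"
    "lchain (saturated_over p0 p) (saturation p (ideal_sum I K)) (saturation p (ideal_sum J K)) b" "n \<le> a + b"
    using step.IH by blast
  have iJ: "is_ideal J" and iK: "is_ideal K" and iM: "is_ideal M" using J K step by (auto simp: saturated_over_def)
  have mono: "saturation p (ideal_sum J K) \<subseteq> saturation p (ideal_sum M K)"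
    using step(2) by (auto simp: saturation_def ideal_sum_def)
  show ?case
  proof (cases "J \<inter> K = M \<inter> K \<and> saturation p (ideal_sum J K) = saturation p (ideal_sum M K)")
    case True
    \<comment> \<open>A member \<open>m\<close> of \<open>M\<close>, multiplied by some
      \<open>w\<close> outside \<open>p\<close>, is the sum of an element of \<open>J\<close> and
      some \<open>k\<close> in \<open>K\<close>. This \<open>k\<close> lies in \<open>M\<close> too,
      hence in \<open>J\<close> as the traces on \<open>K\<close> agree. So \<open>w * m\<close>,
      and by saturation \<open>m\<close>, lies in \<open>J\<close>, against the strict step.\<close>
    have "M \<subseteq> J"
    proof
      fix m assume m: "m \<in> M"
      then have "m \<in> saturation p (ideal_sum J K)"
        using True ideal_sum_upper(1)[OF iK, of M] saturation_subset[OF p] by blast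
      then obtain w k where w: "w \<notin> p" "k \<in> K" "w * m - k \<in> J" by (auto simp: saturation_def ideal_sum_def)
      have "k = w * m - (w * m - k)" by simp
      also have "\<dots> \<in> M" using ideal_diff[OF iM ideal_mult[OF iM m]] w(3) step(2) by blast
      finally have "k \<in> J" using w True by auto
      then have "w * m \<in> J" using w ideal_diff_cancel[OF iJ] by blast
      then show "m \<in> J" using w J by (auto simp: saturated_over_def)
    qed
    then show ?thesis using step by auto
  next
    case False
    then consider "J \<inter> K \<subset> M \<inter> K" | "saturation p (ideal_sum J K) \<subset> saturation p (ideal_sum M K)"
      using mono step(2) by blast
    then show ?thesis
    proof cases
      case 1
      then have c: "lchain (saturated_over p0 p) (I \<inter> K) (M \<inter> K) (Suc a)"
        using ab(1) int[OF step(3)] by (blast intro: lchain.step)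
      obtain b' where "b' \<ge> b" "lchain (saturated_over p0 p) (saturation p (ideal_sum I K)) (saturation p (ideal_sum M K)) b'"
        using lchain_join[OF ab(2) lchain.base[of ?L, OF saturated_over_join[OF p step(3) K]] mono] by auto
      then show ?thesis using c ab(3) by (intro exI[of _ "Suc a"] exI[of _ b']) auto
    next
      case 2
      then have c: "lchain (saturated_over p0 p) (saturation p (ideal_sum I K)) (saturation p (ideal_sum M K)) (Suc b)"
        using ab(2) saturated_over_join[OF p step(3) K] by (blast intro: lchain.step)
      obtain a' where "a' \<ge> a" "lchain (saturated_over p0 p) (I \<inter> K) (M \<inter> K) a'"
        using lchain_join[OF ab(1) lchain.base[of ?L, OF int[OF step(3)]]] step(2) by auto
      then show ?thesis using c ab(3) by (intro exI[of _ a'] exI[of _ "Suc b"]) auto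
    qed
  qed
qed

text \<open>Finite length, because \<open>p\<close> is the only prime between \<open>p0\<close> and
  \<open>p\<close> containing \<open>x\<close>. Noetherian induction: for a maximal \<open>M\<close>
  with unbounded chains some \<open>a\<close> has annihilator exactly \<open>p\<close> modulo
  \<open>M\<close>, so the saturation of \<open>M + (a)\<close> lies directly above
  \<open>M\<close>, and lengths grow by at most one.\<close>

lemma lchain_bounded:
  fixes p :: "'a::noeth_ring set"
  assumes p: "is_prime p" and x: "x \<in> p"
    and min: "\<And>p'. is_prime p' \<Longrightarrow> p0 \<subseteq> p' \<Longrightarrow> x \<in> p' \<Longrightarrow> p' \<subseteq> p \<Longrightarrow> p' = p"
    and I: "saturated_over p0 p I" "x ^ k \<in> I"
  shows "\<exists>N. \<forall>J n. lchain (saturated_over p0 p) I J n \<longrightarrow> n \<le> N"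
proof (rule ccontr)
  let ?L = "saturated_over p0 p"
  define F where "F = {I. ?L I \<and> x ^ k \<in> I \<and> (\<nexists>N. \<forall>J n. lchain ?L I J n \<longrightarrow> n \<le> N)}"
  assume "\<not> ?thesis"
  then have "I \<in> F" using I by (auto simp: F_def)
  then have "F \<noteq> {}" by auto
  moreover have "is_ideal I" if "I \<in> F" for I using that by (simp add: F_def saturated_over_def)
  ultimately obtain M where M: "M \<in> F" "\<And>V. V \<in> F \<Longrightarrow> M \<subseteq> V \<Longrightarrow> V = M"
    using noetherian_maximal[of F] by metis
  have LM: "?L M" and xM: "x ^ k \<in> M" and iM: "is_ideal M"
    using M(1) by (auto simp: F_def saturated_over_def)
  have "M \<noteq> UNIV"
  proof
    assume "M = UNIV"
    then have "n = 0" if "lchain ?L M J n" for J n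
      using lchain_strict[OF that] by blast
    then have "\<forall>J n. lchain ?L M J n \<longrightarrow> n \<le> 0" by blast
    then show False using M(1) unfolding F_def by blast
  qed
  then have one: "1 \<notin> M" using ideal_one[OF iM] by auto
  define col where "col a = {r. r * a \<in> M}" for a
  have icol: "is_ideal (col a)" for a
    using iM by (auto simp: col_def is_ideal_def algebra_simps)
  \<comment> \<open>A maximal one among the annihilators of nonzero classes modulo \<open>M\<close>
    is prime. As \<open>M\<close> is saturated it lies in \<open>p\<close>, and minimality of
    \<open>p\<close> makes it equal to \<open>p\<close>.\<close>
  obtain a where a: "a \<notin> M" and amax: "\<And>b. b \<notin> M \<Longrightarrow> col a \<subseteq> col b \<Longrightarrow> col b = col a"
  proof -
    have "col ` (- M) \<noteq> {}" using one by blast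
    moreover have "is_ideal I" if "I \<in> col ` (- M)" for I using that icol by blast
    ultimately obtain N where "N \<in> col ` (- M)" "\<forall>V\<in>col ` (- M). N \<subseteq> V \<longrightarrow> V = N"
      using noetherian_maximal[of "col ` (- M)"] by metis
    then show ?thesis using that by blast
  qed
  have "is_prime (col a)"
    unfolding is_prime_def
  proof (intro conjI allI impI)
    show "1 \<notin> col a" using a by (simp add: col_def)
    fix r s assume rs: "r * s \<in> col a"
    show "r \<in> col a \<or> s \<in> col a"
    proof (cases "s \<in> col a")
      case False
      then have s: "s * a \<notin> M" by (simp add: col_def)
      have "col a \<subseteq> col (s * a)"
      proof
        fix t assume "t \<in> col a"
        then have "s * (t * a) \<in> M" using ideal_mult[OF iM] unfolding col_def by blast
        also have "s * (t * a) = t * (s * a)" by (rule mult.left_commute)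
        finally show "t \<in> col (s * a)" unfolding col_def by blast
      qed
      then have "col (s * a) = col a" using amax s by blast
      moreover have "r \<in> col (s * a)" using rs by (simp add: col_def mult.assoc)
      ultimately show ?thesis by auto
    qed auto
  qed (rule icol)
  moreover have "p0 \<subseteq> col a" using LM ideal_mult2[OF iM] by (auto simp: col_def saturated_over_def)
  moreover have "x \<in> col a"
    using xM ideal_mult2[OF iM] prime_power[OF \<open>is_prime (col a)\<close>, of x k] by (auto simp: col_def)
  moreover have "col a \<subseteq> p" using LM a by (auto simp: col_def saturated_over_def)
  ultimately have col: "col a = p" by (rule min)
  define A where "A = {b. \<exists>r. b - r * a \<in> M}"
  have iA: "is_ideal A"
    unfolding is_ideal_def
  proof (intro conjI ballI allI)
    show "0 \<in> A" using ideal_zero[OF iM] by (auto simp: A_def intro!: exI[of _ 0])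
  next
    fix b c assume "b \<in> A" "c \<in> A"
    then obtain r s where "b - r * a \<in> M" "c - s * a \<in> M" by (auto simp: A_def)
    then have "(b - r * a) + (c - s * a) \<in> M" using ideal_add[OF iM] by blast
    then show "b + c \<in> A" by (auto simp: A_def algebra_simps intro!: exI[of _ "r + s"])
  next
    fix b s assume "b \<in> A"
    then obtain r where "b - r * a \<in> M" by (auto simp: A_def)
    then have "s * (b - r * a) \<in> M" using ideal_mult[OF iM] by blast
    then show "s * b \<in> A" by (auto simp: A_def algebra_simps intro!: exI[of _ "s * r"])
  qed
  have MA: "M \<subseteq> A" by (auto simp: A_def intro!: exI[of _ 0])
  have aA: "a \<in> A" using ideal_zero[OF iM] by (auto simp: A_def intro!: exI[of _ 1])
  define M' where "M' = saturation p A"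
  have LM': "?L M'" unfolding M'_def
    using LM MA by (intro saturated_over_saturation p iA) (auto simp: saturated_over_def)
  have MM': "M \<subset> M'" using MA saturation_subset[OF p, of A] aA a by (auto simp: M'_def)
  then obtain N where N: "\<And>J n. lchain ?L M' J n \<Longrightarrow> n \<le> N"
    using M(2)[of M'] LM' xM unfolding F_def by blast
  \<comment> \<open>If \<open>w * c - r * a\<close> is in \<open>M\<close> for \<open>c\<close>
    outside \<open>M\<close>, then \<open>r\<close> is outside \<open>p\<close>, the annihilator of
    \<open>a\<close>; so \<open>r\<close> can be cancelled and \<open>a\<close> itself lies in
    \<open>V\<close>.\<close>
  have between: "M' \<subseteq> V" if V: "?L V" "M \<subset> V" "V \<subseteq> M'" for V
  proof -
    obtain c where c: "c \<in> V" "c \<notin> M" using V by blast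
    then have "c \<in> M'" using V(3) by blast
    then obtain w where "w \<notin> p" "w * c \<in> A" unfolding M'_def saturation_def by blast
    then obtain r where w: "w \<notin> p" "w * c - r * a \<in> M" unfolding A_def by blast
    have "r \<notin> p"
    proof
      assume "r \<in> p"
      then have "r * a \<in> M" using col unfolding col_def by blast
      then have "w * c \<in> M" using w ideal_diff_cancel[OF iM] by blast
      then show False using w(1) c LM unfolding saturated_over_def by blast
    qed
    moreover have iX: "is_ideal V" using V by (auto simp: saturated_over_def)
    moreover have "r * a \<in> V" using w c V ideal_mult[OF iX, of c w] ideal_diff_cancel[OF iX, of "w * c"] by blast
    ultimately have "a \<in> V" using V by (auto simp: saturated_over_def)
    then have "A \<subseteq> V" using V iX ideal_diff_cancel[OF iX] ideal_mult[OF iX] unfolding A_def by blast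
    then show "M' \<subseteq> V" unfolding M'_def using saturation_least[OF V(1)] by blast
  qed
  have "n \<le> 1 + N" if ch: "lchain ?L M J n" for J n
  proof -
    \<comment> \<open>The chain is cut at \<open>M'\<close>: at most one step below it by
      \<open>between\<close>, at most \<open>N\<close> steps above it.\<close>
    obtain k l where kl: "lchain ?L (M \<inter> M') (J \<inter> M') k" 
      "lchain ?L (saturation p (ideal_sum M M')) (saturation p (ideal_sum J M')) l" "n \<le> k + l"
      using lchain_cut[OF p ch LM'] by blast
    have "saturation p (ideal_sum M M') \<subseteq> M'"
      using MM' LM' by (intro saturation_least[OF LM'] ideal_sum_least) (auto simp: saturated_over_def)
    moreover have "M' \<subseteq> saturation p (ideal_sum M M')"
      using ideal_sum_upper(2)[OF iM, of M'] saturation_subset[OF p] by blast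
    ultimately have "l \<le> N" using kl(2) N by (metis subset_antisym)
    have "M \<inter> M' = M" using MM' by auto
    then have kc: "lchain ?L M (J \<inter> M') k" using kl(1) by simp
    have "k \<le> 1"
    proof (rule ccontr)
      assume "\<not> k \<le> 1"
      then obtain m where "k = Suc (Suc m)" by (metis One_nat_def not_less_eq_eq old.nat.exhaust le0)
      then obtain V Y where "lchain ?L M V m" "V \<subset> Y" "Y \<subset> J \<inter> M'" "?L Y"
        using kc by (auto elim!: lchain.cases[of _ _ _ "Suc _"] dest: lchain_props)
      then show False using lchain_props[of ?L M V m] between[of Y] by blast
    qed
    then show ?thesis using kl \<open>l \<le> N\<close> by linarith
  qed
  then show False using M(1) unfolding F_def by blast
qed

section \<open>Colon ideals and ideals with adjoined generators\<close>

lemma ideal_colon: 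
  fixes I :: "'a::comm_ring_1 set"
  assumes I: "is_ideal I" shows "is_ideal {c. u * c \<in> I}"
  unfolding is_ideal_def
proof (intro conjI ballI allI CollectI)
  fix a b assume "a \<in> {c. u * c \<in> I}" "b \<in> {c. u * c \<in> I}"
  then show "u * (a + b) \<in> I" using ideal_add[OF I] by (simp add: distrib_left)
next
  fix a r assume "a \<in> {c. u * c \<in> I}"
  then have "r * (u * a) \<in> I" using ideal_mult[OF I] by simp
  then show "u * (r * a) \<in> I" by (simp only: mult.left_commute[of u r a])
qed (use ideal_zero[OF I] in simp)

lemma domain_mod_prime: "is_prime p \<Longrightarrow> u \<notin> p \<Longrightarrow> u * a \<in> p \<Longrightarrow> a \<in> p" for p :: "'a::comm_ring_1 set"
  by (simp add: prime_mult)

definition ideal_adjoin2 :: "'a::comm_ring_1 set \<Rightarrow> 'a \<Rightarrow> 'a \<Rightarrow> 'a set" where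
  "ideal_adjoin2 I a c = {b. \<exists>r s. b - r * a - s * c \<in> I}"

lemma ideal_adjoin2_ideal:
  assumes I: "is_ideal I" shows "is_ideal (ideal_adjoin2 I a c)"
  unfolding is_ideal_def
proof (intro conjI ballI allI)
  show "0 \<in> ideal_adjoin2 I a c"
    using ideal_zero[OF I] by (auto simp: ideal_adjoin2_def intro!: exI[of _ 0])
next
  fix b d assume "b \<in> ideal_adjoin2 I a c" "d \<in> ideal_adjoin2 I a c"
  then obtain r s r' s' where "b - r * a - s * c \<in> I" "d - r' * a - s' * c \<in> I"
    by (auto simp: ideal_adjoin2_def)
  then have "(b - r * a - s * c) + (d - r' * a - s' * c) \<in> I" using ideal_add[OF I] by blast
  moreover have "(b - r * a - s * c) + (d - r' * a - s' * c) = b + d - (r + r') * a - (s + s') * c"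
    by (simp add: algebra_simps)
  ultimately show "b + d \<in> ideal_adjoin2 I a c" unfolding ideal_adjoin2_def by auto
next
  fix b t assume "b \<in> ideal_adjoin2 I a c"
  then obtain r s where "b - r * a - s * c \<in> I" by (auto simp: ideal_adjoin2_def)
  then have "t * (b - r * a - s * c) \<in> I" using ideal_mult[OF I] by blast
  moreover have "t * (b - r * a - s * c) = t * b - (t * r) * a - (t * s) * c"
    by (simp add: algebra_simps)
  ultimately show "t * b \<in> ideal_adjoin2 I a c" unfolding ideal_adjoin2_def by auto
qed

lemma ideal_adjoin2_subset: "I \<subseteq> ideal_adjoin2 I a c"
  by (auto simp: ideal_adjoin2_def intro!: exI[of _ 0])

text \<open>The ideal \<open>u C + (v) + I\<close>. Both multiplications of chains in the height
  argument have this shape: by a power of \<open>x\<close> with \<open>v = 0\<close>, and by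
  \<open>y\<close> with \<open>v\<close> the square of that power.\<close>

definition ideal_scale :: "'a::comm_ring_1 set \<Rightarrow> 'a \<Rightarrow> 'a \<Rightarrow> 'a set \<Rightarrow> 'a set" where
  "ideal_scale I u v C = {b. \<exists>c\<in>C. \<exists>s. b - u * c - s * v \<in> I}"

lemma ideal_scale_ideal:
  assumes I: "is_ideal I" and C: "is_ideal C" shows "is_ideal (ideal_scale I u v C)"
  unfolding is_ideal_def
proof (intro conjI ballI allI)
  show "0 \<in> ideal_scale I u v C"
    using ideal_zero[OF I] ideal_zero[OF C] by (auto simp: ideal_scale_def intro!: bexI[of _ 0] exI[of _ 0])
next
  fix b d assume "b \<in> ideal_scale I u v C" "d \<in> ideal_scale I u v C"
  then obtain r s r' s' where rs: "r \<in> C" "r' \<in> C" "b - u * r - s * v \<in> I" "d - u * r' - s' * v \<in> I"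
    by (auto simp: ideal_scale_def)
  then have "(b - u * r - s * v) + (d - u * r' - s' * v) \<in> I" using ideal_add[OF I] by blast
  moreover have "(b - u * r - s * v) + (d - u * r' - s' * v) = b + d - u * (r + r') - (s + s') * v"
    by (simp add: algebra_simps)
  ultimately show "b + d \<in> ideal_scale I u v C" 
    using ideal_add[OF C rs(1,2)] unfolding ideal_scale_def by auto
next
  fix b t assume "b \<in> ideal_scale I u v C"
  then obtain r s where rs: "r \<in> C" "b - u * r - s * v \<in> I" by (auto simp: ideal_scale_def)
  then have "t * (b - u * r - s * v) \<in> I" using ideal_mult[OF I] by blast
  moreover have "t * (b - u * r - s * v) = t * b - u * (t * r) - (t * s) * v"
    by (simp add: algebra_simps)
  ultimately show "t * b \<in> ideal_scale I u v C" 
    using ideal_mult[OF C rs(1)] unfolding ideal_scale_def by auto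
qed

lemma ideal_scale_subset: "is_ideal C \<Longrightarrow> I \<subseteq> ideal_scale I u v C"
  by (auto simp: ideal_scale_def intro!: bexI[of _ 0] exI[of _ 0] ideal_zero)

lemma greatest_bounded:
  fixes P :: "nat \<Rightarrow> bool"
  assumes "P k" "\<And>n. P n \<Longrightarrow> n \<le> N"
  obtains m where "P m" "\<And>n. P n \<Longrightarrow> n \<le> m"
  using assms GreatestI_nat[of P k N] Greatest_le_nat[of P _ N] by metis

text \<open>The proof of Rees and Kaplansky: choose a power \<open>u\<close> of \<open>x\<close> with
  \<open>(y) : u\<^sup>2 = (y) : u\<close>. Multiplication by \<open>u\<close> and by \<open>y\<close> embeds chains above \<open>(u)\<close> and
  chains in \<open>[(u), (u, y)]\<close> one after the other into \<open>[(u\<^sup>2), (u, y)]\<close>, whose length is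
  too small for that. All ideals are taken modulo \<open>p0\<close> and after localization at \<open>p\<close>.\<close>

theorem principal_ideal_theorem:
  fixes p :: "'a::noeth_ring set"
  assumes p0: "is_prime p0" and q: "is_prime q" and p: "is_prime p"
    and p0q: "p0 \<subset> q" and qp: "q \<subset> p" and x: "x \<in> p"
  shows "\<exists>p'. is_prime p' \<and> p0 \<subset> p' \<and> p' \<subset> p \<and> x \<in> p'"
proof (rule ccontr)
  assume no: "\<not> ?thesis"
  \<comment> \<open>Otherwise \<open>q\<close> would be the prime whose existence is denied.\<close>
  have xq: "x \<notin> q" using no q p0q qp by blast
  then have x0: "x \<notin> p0" using p0q by blast
  have min: "p' = p" if "is_prime p'" "p0 \<subseteq> p'" "x \<in> p'" "p' \<subseteq> p" for p'
    using that no x0 by blast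
  obtain y where y: "y \<in> q" "y \<notin> p0" using p0q by blast
  let ?L = "saturated_over p0 p"
  note ip0 = is_prime_ideal[OF p0]
  have Ladj: "?L (saturation p (ideal_adjoin2 p0 a c))" for a c
    by (intro saturated_over_saturation p ideal_adjoin2_ideal ip0 ideal_adjoin2_subset)
  have Lscale: "?L (saturation p (ideal_scale p0 u v C))" if "?L C" for u v C
    using that by (intro saturated_over_saturation p ideal_scale_ideal ip0 ideal_scale_subset)
      (auto simp: saturated_over_def)
  have memL: "b \<in> C" if "?L C" "a - b \<in> p0" "a \<in> C" for a b C
    using that ideal_diff_cancel[of C a b] by (auto simp: saturated_over_def)
  define Yy where "Yy = saturation p (ideal_adjoin2 p0 0 y)"
  have LYy: "?L Yy" by (simp add: Yy_def Ladj)
  then have iYy: "is_ideal Yy" by (simp add: saturated_over_def)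
  define col where "col k = {a. x ^ k * a \<in> Yy}" for k :: nat
  have icol: "is_ideal (col k)" for k
    using iYy by (auto simp: col_def is_ideal_def algebra_simps)
  obtain k where k: "\<And>l. col k \<subseteq> col l \<Longrightarrow> col l = col k"
  proof -
    have "is_ideal I" if "I \<in> range col" for I using that icol by blast
    then obtain N where "N \<in> range col" "\<forall>V\<in>range col. N \<subseteq> V \<longrightarrow> V = N"
      using noetherian_maximal[of "range col"] by (metis UNIV_not_empty image_is_empty)
    moreover then obtain k where "N = col k" by auto
    ultimately show ?thesis by (intro that[of k]) auto
  qed
  have colk: "col l = col k" if kl: "k \<le> l" for l
  proof (rule k, rule subsetI)
    fix a assume a: "a \<in> col k"
    obtain d where "l = k + d" using le_Suc_ex[OF kl] by blast
    then have "x ^ l * a = x ^ d * (x ^ k * a)" by (simp add: power_add mult_ac)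
    moreover have "x ^ d * (x ^ k * a) \<in> Yy" using a ideal_mult[OF iYy] unfolding col_def by blast
    ultimately show "a \<in> col l" unfolding col_def by simp
  qed
  \<comment> \<open>The exponent is \<open>Suc k\<close> because \<open>k\<close> may be 0 and
    \<open>u\<close> has to lie in \<open>p\<close>.\<close>
  define u where "u = x ^ Suc k"
  have up: "u \<in> p" using ideal_mult2[OF is_prime_ideal[OF p] x] unfolding u_def power_Suc .
  have uq: "u \<notin> q" unfolding u_def using xq prime_power[OF q] by blast
  have u0: "u \<notin> p0" using uq p0q by blast
  have ustab: "u * a \<in> Yy" if "u * (u * a) \<in> Yy" for a
  proof -
    have "x ^ (2 * Suc k) * a = u * (u * a)" unfolding u_def mult_2 power_add by (rule mult.assoc)
    then have "a \<in> col (2 * Suc k)" using that unfolding col_def by simp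
    then have "a \<in> col (Suc k)" using colk[of "2 * Suc k"] colk[of "Suc k"] by simp
    then show ?thesis by (simp add: col_def u_def)
  qed
  define U where "U = saturation p (ideal_adjoin2 p0 0 u)"
  define UY where "UY = saturation p (ideal_adjoin2 p0 u y)"
  define U2Y where "U2Y = saturation p (ideal_adjoin2 p0 (u * u) y)"
  have LU: "?L U" and LUY: "?L UY" and LU2Y: "?L U2Y" by (auto simp: U_def UY_def U2Y_def Ladj)
  have iU: "is_ideal U" and iUY: "is_ideal UY" using LU LUY by (auto simp: saturated_over_def)
  have memU: "b \<in> U \<longleftrightarrow> (\<exists>w r. w \<notin> p \<and> w * b - r * u \<in> p0)" for b
    by (auto simp: U_def saturation_def ideal_adjoin2_def)
  have memUY: "b \<in> UY \<longleftrightarrow> (\<exists>w r s. w \<notin> p \<and> w * b - r * u - s * y \<in> p0)" for b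
    by (auto simp: UY_def saturation_def ideal_adjoin2_def)
  have memU2Y: "b \<in> U2Y \<longleftrightarrow> (\<exists>w r s. w \<notin> p \<and> w * b - r * (u * u) - s * y \<in> p0)" for b
    by (auto simp: U2Y_def saturation_def ideal_adjoin2_def)
  have memYy: "b \<in> Yy \<longleftrightarrow> (\<exists>w s. w \<notin> p \<and> w * b - s * y \<in> p0)" for b
    by (auto simp: Yy_def saturation_def ideal_adjoin2_def)
  have one: "1 \<notin> p" using p by (simp add: is_prime_def)
  have uU: "u \<in> U" unfolding memU using one ideal_zero[OF ip0] by (intro exI[of _ 1]) auto
  have UUY: "U \<subseteq> UY" unfolding memU memUY subset_iff by (metis diff_zero mult_zero_left)
  have U2YUY: "U2Y \<subset> UY"
  proof
    show "U2Y \<subseteq> UY" unfolding memU2Y memUY subset_iff by (metis mult.assoc)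
    \<comment> \<open>Here the intermediate prime enters. Modulo \<open>q\<close>, which contains
      \<open>y\<close> but not \<open>u\<close>, a relation \<open>w u = r u^2\<close> gives
      \<open>w = r u\<close>, so \<open>w\<close> would lie in \<open>p\<close>.\<close>
    show "U2Y \<noteq> UY"
    proof
      assume "U2Y = UY"
      then have "u \<in> U2Y" using uU UUY by blast
      then obtain w r s where w: "w \<notin> p" "w * u - r * (u * u) - s * y \<in> p0" unfolding memU2Y by blast
      have "u * (w - r * u) = (w * u - r * (u * u) - s * y) + s * y" by (simp add: algebra_simps)
      also have "\<dots> \<in> q" using w(2) p0q y(1) is_prime_ideal[OF q] by (intro ideal_add ideal_mult) auto
      finally have "w - r * u \<in> q" using domain_mod_prime[OF q uq] by blast
      then have "w - r * u \<in> p" using qp by blast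
      then show False using w(1) ideal_diff_cancel[OF is_prime_ideal[OF p]] ideal_mult[OF is_prime_ideal[OF p] up] by blast
    qed
  qed
  obtain N where N: "\<And>J n. lchain ?L U J n \<Longrightarrow> n \<le> N"
    using lchain_bounded[OF p x min LU, of "Suc k"] uU unfolding u_def by blast
  have Nge: "n \<le> N" if "lchain ?L I J n" "U \<subseteq> I" for I J n
    using lchain_join[OF lchain.base[of ?L U, OF LU] that] N by fastforce
  \<comment> \<open>\<open>a\<close> is the length of the interval from \<open>U\<close> to
    \<open>UY\<close>, \<open>b\<close> the length of everything above \<open>U\<close>. Both exist
    since \<open>U\<close> contains a power of \<open>x\<close>, so that \<open>N\<close> bounds all
    these chains.\<close>
  obtain a where a: "\<exists>I J. lchain ?L I J a \<and> U \<subseteq> I \<and> J \<subseteq> UY"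
      "\<And>I J n. lchain ?L I J n \<Longrightarrow> U \<subseteq> I \<Longrightarrow> J \<subseteq> UY \<Longrightarrow> n \<le> a"
    using greatest_bounded[of "\<lambda>a. \<exists>I J. lchain ?L I J a \<and> U \<subseteq> I \<and> J \<subseteq> UY" 0 N]
      Nge UUY lchain.base[of ?L U, OF LU] by (metis order_refl)
  obtain b where b: "\<exists>I J. lchain ?L I J b \<and> U \<subseteq> I" "\<And>I J n. lchain ?L I J n \<Longrightarrow> U \<subseteq> I \<Longrightarrow> n \<le> b"
    using greatest_bounded[of "\<lambda>a. \<exists>I J. lchain ?L I J a \<and> U \<subseteq> I" 0 N]
      Nge lchain.base[of ?L U, OF LU] by (metis order_refl)
  obtain I1 J1 where c1: "lchain ?L I1 J1 a" "U \<subseteq> I1" "J1 \<subseteq> UY" using a(1) by blast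
  obtain I2 J2 where c2: "lchain ?L I2 J2 b" "U \<subseteq> I2" using b(1) by blast

  \<comment> \<open>Multiplication by \<open>u\<close>, injective modulo the prime
    \<open>p0\<close>.\<close>
  define T1 where "T1 C = saturation p (ideal_scale p0 u 0 C)" for C
  have memT1: "b \<in> T1 C \<longleftrightarrow> (\<exists>w. w \<notin> p \<and> (\<exists>c\<in>C. w * b - u * c \<in> p0))" for b C
    by (auto simp: T1_def saturation_def ideal_scale_def)
  have d1: "lchain ?L (T1 I1) (T1 J1) a"
  proof (rule lchain_map[OF c1(1) order_refl])
    show "?L (T1 V)" if "?L V" for V using Lscale[OF that] by (simp add: T1_def)
    show "T1 V \<subset> T1 Y" if V: "?L V" and Y: "?L Y" and VY: "V \<subset> Y" for V Y
    proof
      show "T1 V \<subseteq> T1 Y" unfolding memT1 subset_iff using VY by blast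
      obtain c where c: "c \<in> Y" "c \<notin> V" using VY by blast
      have "u * c \<in> T1 Y" unfolding memT1 using one c ideal_zero[OF ip0] by (intro exI[of _ 1] conjI bexI[of _ c]) auto
      moreover have "u * c \<notin> T1 V"
      proof
        assume "u * c \<in> T1 V"
        then obtain w c' where w: "w \<notin> p" "c' \<in> V" "w * (u * c) - u * c' \<in> p0" unfolding memT1 by blast
        have "w * (u * c) - u * c' = u * (w * c - c')" by (simp add: algebra_simps)
        then have "w * c - c' \<in> p0" using w(3) domain_mod_prime[OF p0 u0] by simp
        then have "w * c \<in> V" using w(2) V ideal_diff_cancel[of V "w * c" c'] by (auto simp: saturated_over_def)
        then show False using c w V by (auto simp: saturated_over_def)
      qed
      ultimately show "T1 V \<noteq> T1 Y" by blast
    qed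
  qed

  \<comment> \<open>Multiplication by \<open>y\<close>, then adding \<open>(u^2)\<close>. It
    separates ideals above \<open>(u)\<close>: from \<open>y d = s u^2\<close> the stable colon
    gives \<open>u s = r y\<close>, and cancelling \<open>y\<close> leaves \<open>d = r u\<close>,
    all up to factors outside \<open>p\<close>.\<close>
  define T2 where "T2 C = saturation p (ideal_scale p0 y (u * u) C)" for C
  have memT2: "b \<in> T2 C \<longleftrightarrow> (\<exists>w. w \<notin> p \<and> (\<exists>c\<in>C. \<exists>s. w * b - y * c - s * (u * u) \<in> p0))" for b C
    by (auto simp: T2_def saturation_def ideal_scale_def)
  have d2: "lchain ?L (T2 I2) (T2 J2) b"
  proof (rule lchain_map[OF c2(1) order_refl])
    show "?L (T2 V)" if "?L V" for V using Lscale[OF that] by (simp add: T2_def)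
    show "T2 V \<subset> T2 Y" if V: "?L V" and Y: "?L Y" and IV: "I2 \<subseteq> V" and VY: "V \<subset> Y" for V Y
    proof
      have iV: "is_ideal V" using V by (simp add: saturated_over_def)
      show "T2 V \<subseteq> T2 Y" unfolding memT2 subset_iff using VY by blast
      obtain c where c: "c \<in> Y" "c \<notin> V" using VY by blast
      have "y * c \<in> T2 Y" unfolding memT2 using one c ideal_zero[OF ip0] 
        by (intro exI[of _ 1] conjI bexI[of _ c] exI[of _ 0]) auto
      moreover have "y * c \<notin> T2 V"
      proof
        assume "y * c \<in> T2 V"
        then obtain w c' s where w: "w \<notin> p" "c' \<in> V" "w * (y * c) - y * c' - s * (u * u) \<in> p0" unfolding memT2 by blast
        have "1 * (u * (u * s)) - (w * c - c') * y = - (w * (y * c) - y * c' - s * (u * u))"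
          by (simp add: algebra_simps)
        also have "\<dots> \<in> p0" using w(3) ideal_uminus[OF ip0] by blast
        finally have "u * (u * s) \<in> Yy" unfolding memYy using one by blast
        then have "u * s \<in> Yy" by (rule ustab)
        then obtain w' r where w': "w' \<notin> p" "w' * (u * s) - r * y \<in> p0" unfolding memYy by blast
        have "y * (w' * (w * c - c') - u * r) =
            w' * (w * (y * c) - y * c' - s * (u * u)) + u * (w' * (u * s) - r * y)"
          by (simp add: algebra_simps)
        also have "\<dots> \<in> p0" using w w' by (intro ideal_add ideal_mult ip0)
        finally have "w' * (w * c - c') - u * r \<in> p0" using domain_mod_prime[OF p0 y(2)] by blast
        then have *: "w' * (w * c - c') - u * r \<in> V" using V by (auto simp: saturated_over_def)
        have "u \<in> V" using uU c2(2) IV by blast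
        then have "w' * (w * c - c') \<in> V" using * ideal_diff_cancel[OF iV] ideal_mult2[OF iV] by blast
        then have "w * c - c' \<in> V" using w' V by (auto simp: saturated_over_def)
        then have "w * c \<in> V" using w ideal_diff_cancel[OF iV] by blast
        then show False using c w V by (auto simp: saturated_over_def)
      qed
      ultimately show "T2 V \<noteq> T2 Y" by blast
    qed
  qed

  \<comment> \<open>The two chains fit together since \<open>u (u, y)\<close> lies in
    \<open>y (u) + (u^2)\<close>.\<close>
  have "T1 J1 \<subseteq> T2 I2"
  proof
    fix b assume "b \<in> T1 J1"
    then obtain w c where w: "w \<notin> p" "c \<in> UY" "w * b - u * c \<in> p0" unfolding memT1 using c1(3) by blast
    then obtain w' r s where w': "w' \<notin> p" "w' * c - r * u - s * y \<in> p0" unfolding memUY by blast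
    have "w' * w * b - y * (s * u) - r * (u * u) =
       w' * (w * b - u * c) + u * (w' * c - r * u - s * y)" by (simp add: algebra_simps)
    also have "\<dots> \<in> p0" using w w' by (intro ideal_add ideal_mult ip0)
    finally have *: "w' * w * b - y * (s * u) - r * (u * u) \<in> p0" .
    have "s * u \<in> I2" using uU c2(2) ideal_mult[OF iU] by blast
    moreover have "w' * w \<notin> p" using w w' prime_mult[OF p] by blast
    ultimately show "b \<in> T2 I2" unfolding memT2 using * by blast
  qed
  from lchain_join[OF d1 d2 this]
  obtain n where n: "n \<ge> a + b" "lchain ?L (T1 I1) (T2 J2) n" by blast
  have "T2 J2 \<subseteq> U2Y"
  proof
    fix b assume "b \<in> T2 J2"
    then obtain w c s where w: "w \<notin> p" "w * b - y * c - s * (u * u) \<in> p0" unfolding memT2 by blast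
    moreover have "w * b - s * (u * u) - c * y = w * b - y * c - s * (u * u)" by (simp add: algebra_simps)
    ultimately show "b \<in> U2Y" unfolding memU2Y by metis
  qed
  \<comment> \<open>The chain ends inside \<open>(u^2, y)\<close>, strictly below
    \<open>(u, y)\<close>, so one more step is available and the length is at least
    \<open>a + b + 1\<close>.\<close>
  then have "lchain ?L (T1 I1) UY (Suc n)" using n(2) U2YUY LUY by (blast intro: lchain.step)
  \<comment> \<open>Cutting by \<open>U\<close> shows that this is too long. The joins lie between
    \<open>U\<close> and \<open>UY\<close>, at most \<open>a\<close> steps. The traces lie inside
    \<open>(u)\<close>, and dividing by \<open>u\<close> turns them into ideals above
    \<open>U\<close>, at most \<open>b\<close> steps.\<close>
  from lchain_cut[OF p this LU] obtain a' b' where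
    a': "lchain ?L (T1 I1 \<inter> U) (UY \<inter> U) a'" and
    b': "lchain ?L (saturation p (ideal_sum (T1 I1) U)) (saturation p (ideal_sum UY U)) b'" and
    ab': "Suc n \<le> a' + b'" by blast
  have iT1: "is_ideal (T1 I1)" using lchain_props[OF d1] by (simp add: saturated_over_def)
  have "b' \<le> a"
  proof (rule a(2)[OF b'])
    show "U \<subseteq> saturation p (ideal_sum (T1 I1) U)"
      using ideal_sum_upper(2)[OF iT1] saturation_subset[OF p] by blast
    show "saturation p (ideal_sum UY U) \<subseteq> UY"
      using saturation_least[OF LUY ideal_sum_least[OF iUY order_refl UUY]] .
  qed
  moreover have "a' \<le> b"
  proof -
    define T3 where "T3 C = {c. u * c \<in> C}" for C
    have "lchain ?L (T3 (T1 I1 \<inter> U)) (T3 (UY \<inter> U)) a'"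
    proof (rule lchain_map[OF a', of U])
      show "?L (T3 V)" if "?L V" for V
        unfolding saturated_over_def T3_def
      proof (intro conjI allI impI subsetI CollectI)
        have V: "is_ideal V" "p0 \<subseteq> V" "\<And>w a. w \<notin> p \<Longrightarrow> w * a \<in> V \<Longrightarrow> a \<in> V"
          using that by (auto simp: saturated_over_def)
        show "is_ideal {c. u * c \<in> V}" using V(1) by (rule ideal_colon)
        show "u * c \<in> V" if "c \<in> p0" for c using that V(2) ideal_mult[OF V(1)] by blast
        show "u * c \<in> V" if "w \<notin> p" "w * c \<in> {c. u * c \<in> V}" for w c
          using that V(3)[of w "u * c"] by (simp add: mult.left_commute)
      qed
      show "T3 V \<subset> T3 Y" if V: "?L V" and Y: "?L Y" and VY: "V \<subset> Y" and YU: "Y \<subseteq> U" for V Y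
      proof
        show "T3 V \<subseteq> T3 Y" using VY by (auto simp: T3_def)
        obtain d where d: "d \<in> Y" "d \<notin> V" using VY by blast
        then have "d \<in> U" using YU by blast
        then obtain w r where w: "w \<notin> p" "w * d - r * u \<in> p0" unfolding memU by blast
        have "w * d \<in> Y" using d Y ideal_mult[of Y d w] by (simp add: saturated_over_def)
        then have "r \<in> T3 Y" using memL[OF Y w(2)] by (simp add: T3_def mult.commute)
        moreover have "r \<notin> T3 V"
        proof
          assume "r \<in> T3 V"
          then have "r * u \<in> V" by (simp add: T3_def mult.commute)
          moreover have "w * d - r * u \<in> V" using w V by (auto simp: saturated_over_def)
          ultimately have "w * d \<in> V" using ideal_diff_cancel[of V] V by (auto simp: saturated_over_def)
          then show False using w d V by (auto simp: saturated_over_def)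
        qed
        ultimately show "T3 V \<noteq> T3 Y" by blast
      qed
    qed auto
    moreover have "U \<subseteq> T3 (T1 I1 \<inter> U)"
    proof
      fix c assume c: "c \<in> U"
      then have "c \<in> I1" using c1(2) by blast
      moreover have "1 * (u * c) - u * c \<in> p0" using ideal_zero[OF ip0] by simp
      ultimately have "u * c \<in> T1 I1" unfolding memT1 using one by blast
      then show "c \<in> T3 (T1 I1 \<inter> U)" using ideal_mult[OF iU c] by (auto simp: T3_def)
    qed
    ultimately show ?thesis by (rule b(2))
  qed
  ultimately show False using ab' n(1) by linarith
qed

subsection \<open>Krull's height theorem\<close>

text \<open>\<open>principal_ideal_theorem\<close> moves \<open>x\<close> down by one place: the
  prime below the top is exchanged for one containing \<open>x\<close>, and the shorter chain ending
  there is treated in the same way.\<close>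

lemma prime_chain_through:
  fixes P :: "nat \<Rightarrow> 'a::noeth_ring set"
  assumes "n > 0" "\<And>i. i \<le> n \<Longrightarrow> is_prime (P i)" "\<And>i. i < n \<Longrightarrow> P i \<subset> P (Suc i)" "x \<in> P n"
  shows "\<exists>Q. (\<forall>i\<le>n. is_prime (Q i)) \<and> (\<forall>i<n. Q i \<subset> Q (Suc i)) \<and> Q 0 = P 0 \<and> Q n = P n \<and> x \<in> Q 1"
  using assms
proof (induction n arbitrary: P rule: less_induct)
  case (less n)
  show ?case
  proof (cases "n = 1")
    case True
    then show ?thesis using less.prems by (intro exI[of _ P]) auto
  next
    case False
    then obtain m where n: "n = Suc (Suc m)"
      using less.prems(1) by (cases n; cases "n - 1") auto
    have "is_prime (P m)" "is_prime (P (Suc m))" "is_prime (P n)" "P m \<subset> P (Suc m)" "P (Suc m) \<subset> P n"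
      using less.prems(2,3) n by auto
    then obtain q where q: "is_prime q" "P m \<subset> q" "q \<subset> P n" "x \<in> q"
      using principal_ideal_theorem[of "P m" "P (Suc m)" "P n" x] less.prems(4) by metis
    define P' where "P' = P(Suc m := q)"
    have "\<exists>Q. (\<forall>i\<le>Suc m. is_prime (Q i)) \<and> (\<forall>i<Suc m. Q i \<subset> Q (Suc i)) \<and> Q 0 = P' 0 \<and> Q (Suc m) = P' (Suc m) \<and> x \<in> Q 1"
    proof (rule less.IH)
      show "is_prime (P' i)" if "i \<le> Suc m" for i using that q less.prems(2)[of i] n by (auto simp: P'_def)
      show "P' i \<subset> P' (Suc i)" if "i < Suc m" for i
        using that q less.prems(3)[of i] n by (cases "i = m") (auto simp: P'_def)
    qed (use n q in \<open>auto simp: P'_def\<close>)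
    then obtain Q where Q: "\<forall>i\<le>Suc m. is_prime (Q i)" "\<forall>i<Suc m. Q i \<subset> Q (Suc i)" "Q 0 = P 0"
      "Q (Suc m) = q" "x \<in> Q 1" by (auto simp: P'_def)
    show ?thesis
    proof (intro exI[of _ "Q(n := P n)"] conjI allI impI)
      show "is_prime ((Q(n := P n)) i)" if "i \<le> n" for i
        using that Q(1) less.prems(2)[of n] n by (cases "i = n") auto
      show "(Q(n := P n)) i \<subset> (Q(n := P n)) (Suc i)" if "i < n" for i
        using that Q(2,4) q(3) n by (cases "i = Suc m") auto
    qed (use Q n in auto)
  qed
qed

text \<open>Once \<open>x\<close> lies in the second prime, dropping the bottom prime removes one
  step and one generator. Minimality is meant relative to \<open>P 0\<close>, so that it survives
  the change of the bottom prime.\<close>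

theorem krull_height:
  fixes P :: "nat \<Rightarrow> 'a::noeth_ring set"
  assumes "finite B"
    and "\<And>i. i \<le> n \<Longrightarrow> is_prime (P i)" "\<And>i. i < n \<Longrightarrow> P i \<subset> P (Suc i)"
    and "B \<subseteq> P n" "\<And>q. is_prime q \<Longrightarrow> P 0 \<subseteq> q \<Longrightarrow> B \<subseteq> q \<Longrightarrow> q \<subseteq> P n \<Longrightarrow> q = P n"
  shows "n \<le> card B"
  using assms
proof (induction B arbitrary: n P rule: finite_induct)
  case empty
  have mono: "P 0 \<subseteq> P i" if "i \<le> n" for i
    using that
  proof (induction i)
    case (Suc i)
    then show ?case using empty.prems(2)[of i] by (meson Suc_le_lessD Suc_leD order.trans psubsetE)
  qed simp
  then have "P 0 = P n" using empty.prems(1,4) by auto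
  moreover have "P 0 \<noteq> P n" if "n \<noteq> 0"
    using that empty.prems(2)[of "n - 1"] mono[of "n - 1"] by auto
  ultimately show ?case by auto
next
  case (insert x B)
  show ?case
  proof (cases n)
    case (Suc m)
    have "n > 0" "x \<in> P n" using Suc insert.prems by auto
    from prime_chain_through[OF this(1) insert.prems(1,2) this(2)]
    obtain Q where Q: "\<forall>i\<le>n. is_prime (Q i)" "\<forall>i<n. Q i \<subset> Q (Suc i)" "Q 0 = P 0" "Q n = P n" "x \<in> Q 1"
      by metis
    have "m \<le> card B"
    proof (rule insert.IH[of m "\<lambda>i. Q (Suc i)"])
      fix q assume q: "is_prime q" "Q (Suc 0) \<subseteq> q" "B \<subseteq> q" "q \<subseteq> Q (Suc m)"
      have "Q 0 \<subset> Q (Suc 0)" using Q(2) Suc by blast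
      then have "q = P n"
        using Q q Suc by (intro insert.prems(4)) auto
      then show "q = Q (Suc m)" using Q Suc by simp
    qed (use Q Suc insert.prems in auto)
    then show ?thesis using insert Suc by simp
  qed auto
qed

subsection \<open>Noetherian power series rings\<close>

definition (in comm_ring_1) fin_gen_ideal :: "'a set \<Rightarrow> bool" where
  "fin_gen_ideal I \<longleftrightarrow> (\<exists>B. finite B \<and> B \<subseteq> I \<and> (\<forall>J. is_ideal J \<longrightarrow> B \<subseteq> J \<longrightarrow> I \<subseteq> J))"

lemma ideal_sum_closed: "is_ideal I \<Longrightarrow> (\<And>b. b \<in> B \<Longrightarrow> f b \<in> I) \<Longrightarrow> (\<Sum>b\<in>B. f b) \<in> I"
  for I :: "'a::comm_ring_1 set"
  by (induction B rule: infinite_finite_induct) (auto intro: ideal_zero ideal_add)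

text \<open>The linear combinations of \<open>B\<close> form an ideal containing \<open>B\<close>,
  so the universal property applies to them.\<close>

lemma ideal_combinations:
  fixes I :: "'a::comm_ring_1 set"
  assumes "finite B" "\<And>J. is_ideal J \<Longrightarrow> B \<subseteq> J \<Longrightarrow> I \<subseteq> J" "a \<in> I"
  shows "\<exists>k. a = (\<Sum>b\<in>B. k b * b)"
proof -
  let ?J = "{a. \<exists>k. a = (\<Sum>b\<in>B. k b * b)}"
  have "is_ideal ?J"
    unfolding is_ideal_def
  proof (intro conjI ballI allI)
    show "0 \<in> ?J" by (auto intro!: exI[of _ "\<lambda>_. 0"])
  next
    fix a b assume "a \<in> ?J" "b \<in> ?J"
    then obtain k l where "a = (\<Sum>b\<in>B. k b * b)" "b = (\<Sum>b\<in>B. l b * b)" by auto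
    then have "a + b = (\<Sum>b\<in>B. (k b + l b) * b)" by (simp add: sum.distrib distrib_right)
    then show "a + b \<in> ?J" by (auto intro!: exI[of _ "\<lambda>b. k b + l b"])
  next
    fix a r assume "a \<in> ?J"
    then obtain k where "a = (\<Sum>b\<in>B. k b * b)" by auto
    then have "r * a = (\<Sum>b\<in>B. (r * k b) * b)" by (simp add: sum_distrib_left mult.assoc)
    then show "r * a \<in> ?J" by (auto intro!: exI[of _ "\<lambda>b. r * k b"])
  qed
  moreover have "B \<subseteq> ?J"
  proof (clarify)
    fix b assume "b \<in> B"
    then have "b = (\<Sum>c\<in>B. (if c = b then 1 else 0) * c)"
      using assms(1) by (simp add: if_distrib[of "\<lambda>x. x * _"] sum.delta cong: if_cong)
    then show "\<exists>k. b = (\<Sum>b\<in>B. k b * b)" by (rule exI[of _ "\<lambda>c. if c = b then 1 else 0"])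
  qed
  ultimately show ?thesis using assms(2)[of ?J] assms(3) by blast
qed

lemma noeth_combinations:
  fixes I :: "'a::noeth_ring set"
  assumes "is_ideal I"
  obtains B where "finite B" "B \<subseteq> I" "\<And>a. a \<in> I \<Longrightarrow> \<exists>k. a = (\<Sum>b\<in>B. k b * b)"
  using finitely_generated[OF assms] ideal_combinations[of _ I] by metis

lemma fps_X_multiple: "f $ 0 = 0 \<Longrightarrow> \<exists>g. f = fps_X * g" for f :: "'a::comm_ring_1 fps"
  by (intro exI[of _ "fps_shift 1 f"] fps_ext) (auto simp: fps_X_mult_nth)

text \<open>Replaces convergence: an error divisible by every power of \<open>fps_X\<close> is 0.
  The induction on the coefficient index runs for all \<open>n\<close> at once.\<close>

lemma fps_X_divisible_eq_0:
  fixes d :: "nat \<Rightarrow> 'a::comm_ring_1 fps"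
  assumes "\<And>n. d n = fps_X * d (Suc n)"
  shows "d n = 0"
proof -
  have "\<forall>n. d n $ m = 0" for m
  proof (induction m)
    case 0 then show ?case using assms by (metis fps_X_mult_nth)
  next
    case (Suc m) then show ?case using assms fps_X_mult_nth[of "d (Suc _)" "Suc m"] by (metis Zero_neq_Suc diff_Suc_1)
  qed
  then show ?thesis by (simp add: fps_eq_iff)
qed

text \<open>Hilbert's basis theorem for power series. The constant terms of \<open>c n\<close>, the
  series that enter \<open>I\<close> after multiplication by \<open>fps_X ^ n\<close>, form an
  ascending chain of ideals, constant from some \<open>N\<close> on. Lifts of generators of
  \<open>z N\<close> generate \<open>c N\<close> by an infinite division; from there one descends to
  \<open>c 0\<close>, which is \<open>I\<close>.\<close>

lemma fps_fin_gen_ideal: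
  fixes I :: "'a::noeth_ring fps set"
  assumes I: "is_ideal I"
  shows "fin_gen_ideal I"
proof -
  define c where "c n = {f. fps_X ^ n * f \<in> I}" for n :: nat
  define z where "z n = (\<lambda>f. f $ 0) ` c n" for n
  have ic: "is_ideal (c n)" for n unfolding c_def using I by (rule ideal_colon)
  have iz: "is_ideal (z n)" for n
    unfolding is_ideal_def
  proof (intro conjI ballI allI)
    show "0 \<in> z n" unfolding z_def using ideal_zero[OF ic] by (metis fps_zero_nth image_eqI)
  next
    fix a b assume "a \<in> z n" "b \<in> z n"
    then obtain f g where "f \<in> c n" "g \<in> c n" "a = f $ 0" "b = g $ 0" by (auto simp: z_def)
    then have "f + g \<in> c n" "(f + g) $ 0 = a + b" using ideal_add[OF ic] by auto
    then show "a + b \<in> z n" unfolding z_def by (metis image_eqI)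
  next
    fix a r assume "a \<in> z n"
    then obtain f where f: "f \<in> c n" "a = f $ 0" by (auto simp: z_def)
    then have "fps_const r * f \<in> c n" "(fps_const r * f) $ 0 = r * a" using ideal_mult[OF ic] by auto
    then show "r * a \<in> z n" unfolding z_def by (metis image_eqI)
  qed
  have c_mono: "c m \<subseteq> c n" if mn: "m \<le> n" for m n
  proof
    fix f assume f: "f \<in> c m"
    obtain d where "n = m + d" using le_Suc_ex[OF mn] by blast
    then have "fps_X ^ n * f = fps_X ^ d * (fps_X ^ m * f)" by (simp add: power_add mult_ac)
    moreover have "fps_X ^ d * (fps_X ^ m * f) \<in> I" using f ideal_mult[OF I] unfolding c_def by blast
    ultimately show "f \<in> c n" unfolding c_def by simp
  qed
  have shift: "g \<in> c (Suc n)" if "f \<in> c n" "f = fps_X * g" for f g n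
    using that by (simp add: c_def mult_ac)
  obtain N where N: "\<And>n. N \<le> n \<Longrightarrow> z n = z N"
  proof -
    have "is_ideal V" if "V \<in> range z" for V using that iz by blast
    then obtain M where "M \<in> range z" "\<forall>V\<in>range z. M \<subseteq> V \<longrightarrow> V = M"
      using noetherian_maximal[of "range z"] by (metis UNIV_not_empty image_is_empty)
    moreover then obtain k where "M = z k" by auto
    ultimately have k: "z n = z k" if "z k \<subseteq> z n" for n using that by auto
    have zm: "z m \<subseteq> z n" if "m \<le> n" for m n unfolding z_def using c_mono[OF that] by (rule image_mono)
    show ?thesis by (rule that[of k], rule k, rule zm)
  qed
  have lifts: "\<exists>(B :: 'a set) F. finite B \<and> (\<forall>b\<in>B. F b \<in> c n) \<and>
     (\<forall>f. f $ 0 \<in> z n \<longrightarrow> (\<exists>k g. f - (\<Sum>b\<in>B. fps_const (k b) * F b) = fps_X * g))" for n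
  proof -
    obtain B where B: "finite B" "B \<subseteq> z n" "\<And>a. a \<in> z n \<Longrightarrow> \<exists>k. a = (\<Sum>b\<in>B. k b * b)"
      by (rule noeth_combinations[OF iz[of n]]) (rule that)
    have "\<forall>b\<in>B. \<exists>f. f \<in> c n \<and> f $ 0 = b" using B(2) by (auto simp: z_def)
    then obtain F where F: "\<And>b. b \<in> B \<Longrightarrow> F b \<in> c n \<and> F b $ 0 = b" by metis
    have kg: "\<exists>k g. f - (\<Sum>b\<in>B. fps_const (k b) * F b) = fps_X * g" if f: "f $ 0 \<in> z n" for f
    proof -
      obtain k where "f $ 0 = (\<Sum>b\<in>B. k b * b)" using B(3)[OF f] by blast
      then have "(f - (\<Sum>b\<in>B. fps_const (k b) * F b)) $ 0 = 0" using F by (simp add: fps_sum_nth)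
      then show ?thesis using fps_X_multiple by blast
    qed
    show ?thesis
    proof (intro exI[of _ B] exI[of _ F] conjI ballI allI impI)
      show "F b \<in> c n" if "b \<in> B" for b using F[OF that] by simp
      show "finite B" by (rule B(1))
      show "\<exists>k g. f - (\<Sum>b\<in>B. fps_const (k b) * F b) = fps_X * g" if "f $ 0 \<in> z n" for f
        using that by (rule kg)
    qed
  qed
  have "fin_gen_ideal (c N)"
  proof -
    from lifts[of N] obtain B :: "'a set" and F where B: "finite B" and FB: "\<forall>b\<in>B. F b \<in> c N"
      and BFB: "\<forall>f. f $ 0 \<in> z N \<longrightarrow> (\<exists>k g. f - (\<Sum>b\<in>B. fps_const (k b) * F b) = fps_X * g)"
      by (elim exE conjE) (rule that)
    note F = bspec[OF FB] and BF = mp[OF spec[OF BFB]]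
    have "c N \<subseteq> J" if J: "is_ideal J" "F ` B \<subseteq> J" for J
    proof
      fix f assume f: "f \<in> c N"
      \<comment> \<open>Subtract a combination of the lifts with the same constant term and divide
        by \<open>fps_X\<close>. This leads from \<open>c M\<close> to \<open>c (Suc M)\<close>; as
        \<open>M \<ge> N\<close>, the constant terms stay in \<open>z N\<close> and the same lifts
        serve at every step.\<close>
      have "\<exists>fs. \<forall>n. (\<exists>M\<ge>N. fs n \<in> c M) \<and> (n = 0 \<longrightarrow> fs n = f) \<and>
        (\<exists>k. fs n - (\<Sum>b\<in>B. fps_const (k b) * F b) = fps_X * fs (Suc n))"
      proof -
        have "\<exists>fs. \<forall>n. ((\<exists>M\<ge>N. fs n \<in> c M) \<and> (n = 0 \<longrightarrow> fs n = f)) \<and>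
          (\<exists>k. fs n - (\<Sum>b\<in>B. fps_const (k b) * F b) = fps_X * fs (Suc n))"
        proof (rule dependent_nat_choice)
          show "\<exists>x. (\<exists>M\<ge>N. x \<in> c M) \<and> ((0::nat) = 0 \<longrightarrow> x = f)" using f by blast
        next
          fix x and n :: nat assume "(\<exists>M\<ge>N. x \<in> c M) \<and> (n = 0 \<longrightarrow> x = f)"
          then obtain M where M: "M \<ge> N" "x \<in> c M" by blast
          then have "x $ 0 \<in> z N" using N[of M] by (auto simp: z_def)
          then obtain k g where kg: "x - (\<Sum>b\<in>B. fps_const (k b) * F b) = fps_X * g" using BF by blast
          have "(\<Sum>b\<in>B. fps_const (k b) * F b) \<in> c M"
            using F c_mono[OF M(1)] by (intro ideal_sum_closed ideal_mult ic) blast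
          then have "x - (\<Sum>b\<in>B. fps_const (k b) * F b) \<in> c M" using ideal_diff[OF ic M(2)] by blast
          then have "g \<in> c (Suc M)" using shift kg by blast
          then show "\<exists>y. ((\<exists>M\<ge>N. y \<in> c M) \<and> (Suc n = 0 \<longrightarrow> y = f)) \<and>
            (\<exists>k. x - (\<Sum>b\<in>B. fps_const (k b) * F b) = fps_X * y)"
            using M(1) kg by (intro exI[of _ g]) (auto intro!: exI[of _ "Suc M"])
        qed
        then show ?thesis by (simp only: conj_assoc)
      qed
      then obtain fs where fs0: "fs 0 = f" and fs: "\<And>n. \<exists>k. fs n - (\<Sum>b\<in>B. fps_const (k b) * F b) = fps_X * fs (Suc n)"
        by metis
      then obtain k where k: "\<And>n. fs n - (\<Sum>b\<in>B. fps_const (k n b) * F b) = fps_X * fs (Suc n)" by metis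
      \<comment> \<open>The constants chosen from step \<open>n\<close> on become the coefficients
        of \<open>h n b\<close>. These series obey the same recursion as the remainders, so the
        total error \<open>d\<close> is divisible by all powers of \<open>fps_X\<close>.\<close>
      define h where "h n b = Abs_fps (\<lambda>i. k (n + i) b)" for n b
      have h: "h n b = fps_const (k n b) + fps_X * h (Suc n) b" for n b
        by (rule fps_ext) (simp add: h_def fps_X_mult_nth)
      define d where "d n = fs n - (\<Sum>b\<in>B. h n b * F b)" for n
      have "d n = fps_X * d (Suc n)" for n
      proof -
        have "(\<Sum>b\<in>B. h n b * F b) = (\<Sum>b\<in>B. fps_const (k n b) * F b) + fps_X * (\<Sum>b\<in>B. h (Suc n) b * F b)"
          unfolding h[of n] by (simp add: distrib_right sum.distrib sum_distrib_left mult.assoc)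
        moreover have "fs n = fps_X * fs (Suc n) + (\<Sum>b\<in>B. fps_const (k n b) * F b)"
          using k[of n] by (simp add: algebra_simps)
        ultimately show ?thesis by (simp add: d_def algebra_simps)
      qed
      then have "d 0 = 0" by (rule fps_X_divisible_eq_0)
      then have "f = (\<Sum>b\<in>B. h 0 b * F b)" by (simp add: d_def fs0)
      also have "\<dots> \<in> J" using J(2) by (intro ideal_sum_closed ideal_mult J(1)) blast
      finally show "f \<in> J" .
    qed
    then show ?thesis unfolding fin_gen_ideal_def using B F by (intro exI[of _ "F ` B"]) auto
  qed
  \<comment> \<open>Descent: an element of \<open>c n\<close> minus a combination of finitely many
    lifts is \<open>fps_X\<close> times an element of \<open>c (Suc n)\<close>.\<close>
  moreover have "fin_gen_ideal (c n)" if fg: "fin_gen_ideal (c (Suc n))" for n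
  proof -
    from lifts[of n] obtain B :: "'a set" and F where B: "finite B" and FB: "\<forall>b\<in>B. F b \<in> c n"
      and BFB: "\<forall>f. f $ 0 \<in> z n \<longrightarrow> (\<exists>k g. f - (\<Sum>b\<in>B. fps_const (k b) * F b) = fps_X * g)"
      by (elim exE conjE) (rule that)
    note F = bspec[OF FB] and BF = mp[OF spec[OF BFB]]
    obtain G where G: "finite G" "G \<subseteq> c (Suc n)" "\<And>J. is_ideal J \<Longrightarrow> G \<subseteq> J \<Longrightarrow> c (Suc n) \<subseteq> J"
      using fg unfolding fin_gen_ideal_def by metis
    have "c n \<subseteq> J" if J: "is_ideal J" "F ` B \<union> (*) fps_X ` G \<subseteq> J" for J
    proof
      fix f assume f: "f \<in> c n"
      then have "f $ 0 \<in> z n" by (auto simp: z_def)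
      then obtain k g where kg: "f - (\<Sum>b\<in>B. fps_const (k b) * F b) = fps_X * g" using BF by blast
      have "(\<Sum>b\<in>B. fps_const (k b) * F b) \<in> c n" using F by (intro ideal_sum_closed ideal_mult ic) blast
      then have "g \<in> c (Suc n)" using ideal_diff[OF ic f] shift kg by blast
      moreover have "c (Suc n) \<subseteq> {h. fps_X * h \<in> J}" using J by (intro G(3) ideal_colon) auto
      ultimately have "fps_X * g \<in> J" by blast
      moreover have "(\<Sum>b\<in>B. fps_const (k b) * F b) \<in> J" using J by (intro ideal_sum_closed ideal_mult J(1)) blast
      ultimately have "fps_X * g + (\<Sum>b\<in>B. fps_const (k b) * F b) \<in> J" using ideal_add[OF J(1)] by blast
      then show "f \<in> J" using kg by (metis diff_add_cancel)
    qed
    moreover have "(*) fps_X ` G \<subseteq> c n" using G(2) by (auto simp: c_def mult_ac)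
    ultimately show ?thesis
      unfolding fin_gen_ideal_def using B F G(1) by (intro exI[of _ "F ` B \<union> (*) fps_X ` G"]) auto
  qed
  ultimately have "fin_gen_ideal (c (N - n))" for n
  proof (induction n)
    case (Suc n)
    then show ?case by (cases "n < N") (auto simp: Suc_diff_Suc)
  qed simp
  from this[of N] have "fin_gen_ideal (c 0)" by simp
  moreover have "c 0 = I" by (simp add: c_def)
  ultimately show ?thesis by simp
qed

instance fps :: (noeth_ring) noeth_ring
proof
  fix I :: "'a fps set" assume "is_ideal I"
  from fps_fin_gen_ideal[OF this]
  show "\<exists>B. finite B \<and> B \<subseteq> I \<and> (\<forall>J. is_ideal J \<longrightarrow> B \<subseteq> J \<longrightarrow> I \<subseteq> J)"
    unfolding fin_gen_ideal_def .
qed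

instance bit :: noeth_ring
proof
  fix I :: "bit set" assume "is_ideal I"
  have "I \<subseteq> {0, 1}"
  proof
    show "x \<in> {0, 1}" for x :: bit by (cases "x = 0") simp_all
  qed
  then have "finite I" by (rule finite_subset) simp
  then show "\<exists>B. finite B \<and> B \<subseteq> I \<and> (\<forall>J. is_ideal J \<longrightarrow> B \<subseteq> J \<longrightarrow> I \<subseteq> J)"
    by (intro exI[of _ I]) simp
qed

subsection \<open>The 2-adic integers\<close>

lemma z2_eqI: "(\<And>n. residue a n = residue b n) \<Longrightarrow> a = b"
  by (simp add: residue_inject[symmetric] fun_eq_iff)

lemma residue_range: "0 \<le> residue a n" "residue a n < 2 ^ n" "residue a n mod 2 ^ n = residue a n"
  and residue_mod_Suc: "residue a (Suc n) mod 2 ^ n = residue a n"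
  using residue[of a] by auto

lemma residue_mod: "m \<le> n \<Longrightarrow> residue a n mod 2 ^ m = residue a m"
proof (induction n rule: dec_induct)
  case base
  then show ?case by (rule residue_range(3))
next
  case (step n)
  have "residue a (Suc n) mod 2 ^ m = residue a (Suc n) mod 2 ^ n mod 2 ^ m"
    using step(1) by (simp add: mod_mod_cancel le_imp_power_dvd)
  then show ?case using step.IH by (simp add: residue_mod_Suc)
qed

lemma residue_simps:
  "residue 0 n = 0" "residue 1 n = 1 mod 2 ^ n" "residue (a + b) n = (residue a n + residue b n) mod 2 ^ n"
  "residue (a - b) n = (residue a n - residue b n) mod 2 ^ n"
  "residue (a * b) n = (residue a n * residue b n) mod 2 ^ n"
  by (simp_all add: zero_z2.rep_eq one_z2.rep_eq plus_z2.rep_eq minus_z2.rep_eq times_z2.rep_eq)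

lemma residue_two: "residue 2 n = 2 mod 2 ^ n"
  unfolding one_add_one[symmetric] residue_simps by (simp add: mod_simps)

lemma residue_Abs_z2:
  assumes "\<And>n. b (Suc n) mod 2 ^ n = b n mod 2 ^ n"
  shows "residue (Abs_z2 (\<lambda>n. b n mod 2 ^ n)) n = b n mod 2 ^ n"
proof -
  have "(\<lambda>n. b n mod 2 ^ n) \<in> {a. \<forall>n. a n \<in> {0..<2 ^ n} \<and> a (Suc n) mod 2 ^ n = a n}"
    using assms mod_mod_pow2 mod_pow2_range by auto
  then show ?thesis by (simp add: Abs_z2_inverse)
qed

lemma residue_1_cases: "residue a 1 = 0 \<or> residue a 1 = 1"
  using residue_range[of a 1] by auto

lemma z2_even:
  assumes "residue a 1 = 0"
  obtains b where "a = 2 * b"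
proof -
  \<comment> \<open>Halving costs one binary digit, so the half modulo \<open>2 ^ n\<close> is read
    off from the residue modulo \<open>2 ^ Suc n\<close>.\<close>
  define c where "c n = residue a (Suc n) div 2" for n
  have ev: "residue a (Suc n) mod 2 = 0" for n
    using residue_mod[of 1 "Suc n" a] assms by simp
  have a: "residue a (Suc n) = 2 * c n" for n
    using ev[of n] unfolding c_def by presburger
  have "c (Suc n) mod 2 ^ n = c n mod 2 ^ n" for n
  proof -
    have "2 * (c (Suc n) mod 2 ^ n) = residue a (Suc (Suc n)) mod 2 ^ Suc n"
      by (simp only: a mult_mod_right power_Suc)
    also have "\<dots> = residue a (Suc n)" by (rule residue_mod_Suc)
    also have "\<dots> = 2 * c n" by (rule a)
    finally have "c (Suc n) mod 2 ^ n = c n" by simp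
    moreover have "c n mod 2 ^ n = c n" 
      using residue_range(1,2)[of a "Suc n"] unfolding a by (intro mod_pos_pos_trivial) auto
    ultimately show ?thesis by simp
  qed
  note r = residue_Abs_z2[of c, OF this]
  have "residue a n = residue (2 * Abs_z2 (\<lambda>n. c n mod 2 ^ n)) n" for n
  proof -
    have "residue a n = residue a (Suc n) mod 2 ^ n" by (simp add: residue_mod_Suc)
    also have "\<dots> = residue (2 * Abs_z2 (\<lambda>n. c n mod 2 ^ n)) n"
      by (simp add: residue_simps residue_two r a mod_simps)
    finally show ?thesis .
  qed
  then show ?thesis using z2_eqI that by blast
qed

text \<open>An odd residue is invertible modulo every \<open>2 ^ n\<close>; inverses are unique
  there, so the chosen ones are compatible and define a 2-adic integer.\<close>

lemma z2_unit:
  assumes "residue a 1 = 1"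
  shows "a dvd 1"
proof -
  have odd: "odd (residue a n)" if "n > 0" for n
    using residue_mod[of 1 n a] that assms by (simp add: odd_iff_mod_2_eq_one)
  have cop: "coprime (residue a n) (2 ^ n)" for n
    using odd[of n] by (cases n) auto
  have "\<forall>n. \<exists>b. [residue a n * b = 1] (mod 2 ^ n)"
    using cong_solve_coprime_int[OF cop] by blast
  then obtain b where b: "\<And>n. [residue a n * b n = 1] (mod 2 ^ n)" by metis
  have "b (Suc n) mod 2 ^ n = b n mod 2 ^ n" for n
  proof -
    have "[residue a (Suc n) * b (Suc n) = 1] (mod 2 ^ n)"
      by (rule cong_dvd_modulus[OF b]) simp
    moreover have "[residue a (Suc n) = residue a n] (mod 2 ^ n)"
      by (simp add: cong_def residue_mod_Suc residue_range)
    ultimately have "[residue a n * b (Suc n) = 1] (mod 2 ^ n)"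
      by (metis cong_scalar_right cong_sym cong_trans)
    then have "[residue a n * b (Suc n) = residue a n * b n] (mod 2 ^ n)"
      using b[of n] by (metis cong_sym cong_trans)
    then show ?thesis using cop by (simp add: cong_mult_lcancel cong_def[symmetric])
  qed
  note r = residue_Abs_z2[of b, OF this]
  have "1 = a * Abs_z2 (\<lambda>n. b n mod 2 ^ n)"
    using b by (intro z2_eqI) (simp add: residue_simps r cong_def mod_simps)
  then show ?thesis by (rule dvdI)
qed

lemma residue_2_mult: "residue (2 * b) (Suc n) = 0 \<longleftrightarrow> residue b n = 0"
proof -
  have "residue (2 * b) (Suc n) = 2 * residue b (Suc n) mod 2 ^ Suc n"
    by (simp add: residue_simps residue_two mod_simps)
  also have "\<dots> = 2 * (residue b (Suc n) mod 2 ^ n)" by (simp only: mult_mod_right power_Suc)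
  finally show ?thesis by (simp add: residue_mod_Suc)
qed

lemma residue_two_power: "residue (2 ^ k * b) (k + n) = 0 \<longleftrightarrow> residue b n = 0"
  by (induction k) (simp_all add: mult.assoc residue_2_mult)

lemma z2_decomposition:
  assumes "residue a n \<noteq> 0"
  obtains k u where "a = 2 ^ k * u" "u dvd 1" "k < n"
  using assms
proof (induction n arbitrary: a thesis)
  case 0
  then show ?case using residue_range[of a 0] by simp
next
  case (Suc n)
  show ?case
  proof (cases "residue a 1 = 0")
    case True
    then obtain b where b: "a = 2 * b" by (rule z2_even)
    then have "residue b n \<noteq> 0" using Suc.prems(2) residue_2_mult by blast
    from Suc.IH[OF _ this] obtain k u where "b = 2 ^ k * u" "u dvd 1" "k < n" by blast
    then show ?thesis using b by (intro Suc.prems(1)[of "Suc k" u]) auto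
  next
    case False
    then have "a dvd 1" using residue_1_cases z2_unit by blast
    then show ?thesis by (intro Suc.prems(1)[of 0 a]) auto
  qed
qed

lemma z2_decomposition_nonzero:
  assumes "(a :: z2) \<noteq> 0"
  obtains k u where "a = 2 ^ k * u" "u dvd 1"
proof -
  obtain n where "residue a n \<noteq> 0" using assms z2_eqI[of a 0] by (auto simp: residue_simps)
  then show ?thesis by (rule z2_decomposition) (rule that)
qed

lemma z2_two_power_nonzero: "(2 :: z2) ^ k \<noteq> 0"
proof
  assume "(2 :: z2) ^ k = 0"
  then have "residue (2 ^ k * 1) (k + 1) = 0" by (simp only: mult_zero_left residue_simps(1))
  then have "residue 1 1 = 0" unfolding residue_two_power .
  then show False by (simp add: residue_simps(2))
qed

text \<open>Nonzero elements are powers of 2 times units, and no power of 2 is 0.\<close>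

instance z2 :: idom
proof
  fix a b :: z2 assume "a \<noteq> 0" "b \<noteq> 0"
  obtain k u where a: "a = 2 ^ k * u" "u dvd 1" using z2_decomposition_nonzero[OF \<open>a \<noteq> 0\<close>] .
  obtain l v where b: "b = 2 ^ l * v" "v dvd 1" using z2_decomposition_nonzero[OF \<open>b \<noteq> 0\<close>] .
  obtain u' where u': "1 = u * u'" using a(2) by (rule dvdE)
  obtain v' where v': "1 = v * v'" using b(2) by (rule dvdE)
  have "a * b * (u' * v') = 2 ^ k * 2 ^ l * ((u * u') * (v * v'))"
    unfolding a(1) b(1) by (simp only: mult_ac)
  also have "\<dots> = 2 ^ (k + l)" unfolding u'[symmetric] v'[symmetric] by (simp add: power_add)
  finally have "a * b * (u' * v') = 2 ^ (k + l)" .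
  then show "a * b \<noteq> 0" using z2_two_power_nonzero[of "k + l"] by auto
qed

instance z2 :: ring_char_0
proof
  have "of_nat n \<noteq> (0::z2)" if "n > 0" for n
  proof
    assume "of_nat n = (0::z2)"
    moreover have "residue (of_nat n) m = int n mod 2 ^ m" for m
      by (induction n) (simp_all add: residue_simps mod_simps)
    \<comment> \<open>The residue modulo \<open>2 ^ n\<close> suffices because
      \<open>n < 2 ^ n\<close>.\<close>
    ultimately have "int n mod 2 ^ n = 0" by (metis residue_simps(1))
    moreover have "int n < 2 ^ n" using of_nat_less_two_power by blast
    ultimately show False using that by simp
  qed
  then have "of_nat m \<noteq> (of_nat n :: z2)" if "m < n" for m n
    using that of_nat_diff[of m n, where 'a = z2] by (metis less_imp_le_nat right_minus_eq zero_less_diff)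
  then show "inj (of_nat :: nat \<Rightarrow> z2)"
    by (intro injI) (metis linorder_neqE_nat)
qed

instance z2 :: noeth_ring
proof
  fix I :: "z2 set" assume I: "is_ideal I"
  show "\<exists>B. finite B \<and> B \<subseteq> I \<and> (\<forall>J. is_ideal J \<longrightarrow> B \<subseteq> J \<longrightarrow> I \<subseteq> J)"
  proof (cases "I \<subseteq> {0}")
    case True
    then show ?thesis using ideal_zero by (intro exI[of _ "{}"]) blast
  next
    case False
    have pow: "2 ^ l \<in> I" if a: "a \<in> I" "a = 2 ^ l * u" "u dvd 1" for a l u
    proof -
      obtain u' where "1 = u * u'" using a(3) by (rule dvdE)
      then have "2 ^ l = u' * a" unfolding a(2) by (metis mult.commute mult.left_commute mult_1)
      then show ?thesis using ideal_mult[OF I a(1)] by simp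
    qed
    define k where "k = (LEAST k. (2::z2) ^ k \<in> I)"
    obtain a where "a \<in> I" "a \<noteq> 0" using False by blast
    from z2_decomposition_nonzero[OF this(2)] obtain m u where "a = 2 ^ m * u" "u dvd 1" .
    with \<open>a \<in> I\<close> have "\<exists>k. (2::z2) ^ k \<in> I" using pow by blast
    then have k: "2 ^ k \<in> I" unfolding k_def by (rule LeastI_ex)
    have "I \<subseteq> J" if J: "is_ideal J" "2 ^ k \<in> J" for J
    proof
      fix a assume a: "a \<in> I"
      show "a \<in> J"
      proof (cases "a = 0")
        case True then show ?thesis using ideal_zero[OF J(1)] by simp
      next
        case False
        then obtain l u where lu: "a = 2 ^ l * u" "u dvd 1" by (rule z2_decomposition_nonzero)
        then have "2 ^ l \<in> I" using pow a by blast
        then have "k \<le> l" unfolding k_def by (rule Least_le)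
        then have "a = (2 ^ (l - k) * u) * 2 ^ k"
          using lu(1) power_add[of "2::z2" "l - k" k] by (simp add: mult_ac)
        then show ?thesis using ideal_mult[OF J] by simp
      qed
    qed
    then show ?thesis using k by (intro exI[of _ "{2 ^ k}"]) simp
  qed
qed

subsection \<open>Filtered local rings\<close>

text \<open>A complete local ring with its adic filtration; \<open>filt_power\<close> will identify
  \<open>filt n\<close> with the power of \<open>filt 1\<close>. The filtration is a parameter
  because for \<open>fps\<close> it is read off from the coefficients, and in this form all axioms
  pass to power series: three times from \<open>z2\<close>, once from \<open>bit\<close>. The last
  axiom controls the degree of the cofactors, which yields the powers of \<open>filt 1\<close> and
  not only its generators.\<close>

class filtered_ring = comm_ring_1 +
  fixes filt :: "nat \<Rightarrow> 'a set" and filt_gens :: "'a set"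
  assumes filt_ideal: "is_ideal (filt n)"
    and filt_0: "filt 0 = UNIV"
    and filt_decr: "filt (Suc n) \<subseteq> filt n"
    and filt_mult: "a \<in> filt m \<Longrightarrow> b \<in> filt n \<Longrightarrow> a * b \<in> filt (m + n)"
    and filt_separated: "(\<And>n. a \<in> filt n) \<Longrightarrow> a = 0"
    and filt_complete: "(\<And>n. s (Suc n) - s n \<in> filt n) \<Longrightarrow> \<exists>b. \<forall>n. b - s n \<in> filt n"
    and filt_unit: "a \<notin> filt 1 \<Longrightarrow> a dvd 1"
    and one_notin_filt: "1 \<notin> filt 1"
    and finite_filt_gens: "finite filt_gens"
    and filt_gens_subset: "filt_gens \<subseteq> filt 1"
    and filt_gens: "a \<in> filt (Suc n) \<Longrightarrow> \<exists>c. (\<forall>g\<in>filt_gens. c g \<in> filt n) \<and> a = (\<Sum>g\<in>filt_gens. g * c g)"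

lemma filt_antimono: "m \<le> n \<Longrightarrow> filt n \<subseteq> (filt m :: 'a::filtered_ring set)"
  by (induction n rule: dec_induct) (use filt_decr in blast)+

lemma filt_antimonoD: "a \<in> filt n \<Longrightarrow> m \<le> n \<Longrightarrow> a \<in> filt m" for a :: "'a::filtered_ring"
  using filt_antimono by blast

instantiation fps :: (filtered_ring) filtered_ring
begin

text \<open>The variable gets weight 1. For \<open>k \<ge> n\<close> truncated subtraction gives
  \<open>filt 0\<close>, so these coefficients are free.\<close>

definition filt_fps :: "nat \<Rightarrow> 'a fps set" where
  "filt_fps n = {f. \<forall>k. f $ k \<in> filt (n - k)}"

definition filt_gens_fps :: "'a fps set" where
  "filt_gens_fps = insert fps_X (fps_const ` filt_gens)"

lemma filt_fps_mult:
  fixes f g :: "'a fps"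
  assumes "f \<in> filt m" "g \<in> filt n"
  shows "f * g \<in> filt (m + n)"
  unfolding filt_fps_def
proof (intro CollectI allI)
  fix k
  have "f $ i * g $ (k - i) \<in> filt (m + n - k)" if "i \<in> {0..k}" for i
  proof -
    have "f $ i * g $ (k - i) \<in> filt ((m - i) + (n - (k - i)))"
      using assms by (intro filt_mult) (auto simp: filt_fps_def)
    then show ?thesis by (rule filt_antimonoD) (use that in auto)
  qed
  then show "(f * g) $ k \<in> filt (m + n - k)"
    unfolding fps_mult_nth by (rule ideal_sum_closed[OF filt_ideal])
qed

instance
proof
  fix n m :: nat and f g :: "'a fps" and s :: "nat \<Rightarrow> 'a fps"
  show f0: "filt 0 = (UNIV :: 'a fps set)" by (simp add: filt_fps_def filt_0)
  show "is_ideal (filt n :: 'a fps set)"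
    unfolding is_ideal_def
  proof (intro conjI ballI allI)
    show "r * f \<in> filt n" if "f \<in> filt n" for f r :: "'a fps"
      using filt_fps_mult[of r 0 f n] that f0 by simp
  qed (auto simp: filt_fps_def ideal_zero[OF filt_ideal] ideal_add[OF filt_ideal])
  show "filt (Suc n) \<subseteq> (filt n :: 'a fps set)"
    unfolding filt_fps_def
  proof (intro Collect_mono allI impI)
    fix f :: "'a fps" and k assume "\<forall>k. f $ k \<in> filt (Suc n - k)"
    then show "f $ k \<in> filt (n - k)" by (intro filt_antimonoD[of "f $ k" "Suc n - k" "n - k"]) auto
  qed
  show "f * g \<in> filt (m + n)" if "f \<in> filt m" "g \<in> filt n"
    using that by (rule filt_fps_mult)
  show "f = 0" if f: "\<And>n. f \<in> filt n"
  proof (rule fps_ext)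
    fix k
    have "f $ k \<in> filt n" for n using f[of "n + k"] by (auto simp: filt_fps_def dest: spec[of _ k])
    then have "f $ k = 0" by (rule filt_separated)
    then show "f $ k = 0 $ k" by simp
  qed
  show "\<exists>b. \<forall>n. b - s n \<in> filt n" if s: "\<And>n. s (Suc n) - s n \<in> filt n"
  proof -
    \<comment> \<open>The coefficient of index \<open>k\<close> of a member of \<open>filt n\<close>
      is controlled only up to \<open>n - k\<close>; shifting the sequence by \<open>k\<close>
      compensates for this.\<close>
    have "\<exists>b. \<forall>n. b - s (n + k) $ k \<in> filt n" for k
    proof (rule filt_complete)
      show "s (Suc n + k) $ k - s (n + k) $ k \<in> filt n" for n
        using s[of "n + k"] by (auto simp: filt_fps_def dest: spec[of _ k])
    qed
    then obtain b where b: "\<And>k n. b k - s (n + k) $ k \<in> filt n" by metis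
    have "b k - s n $ k \<in> filt (n - k)" for n k
    proof (cases "k \<le> n")
      case True then show ?thesis using b[of k "n - k"] by simp
    next
      case False then show ?thesis by (simp add: filt_0)
    qed
    then have "\<forall>n. Abs_fps b - s n \<in> filt n" by (simp add: filt_fps_def)
    then show ?thesis by blast
  qed
  show "f dvd 1" if "f \<notin> filt 1"
  proof -
    have "f $ 0 \<notin> filt 1"
    proof
      assume "f $ 0 \<in> filt 1"
      then have "f $ k \<in> filt (1 - k)" for k by (cases k) (auto simp: filt_0)
      then show False using that by (simp add: filt_fps_def)
    qed
    from filt_unit[OF this] obtain y where "1 = f $ 0 * y" by (rule dvdE)
    then have "f * fps_right_inverse f y = 1" by (intro fps_right_inverse) simp
    then show ?thesis using dvd_triv_left[of f "fps_right_inverse f y"] by simp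
  qed
  show "1 \<notin> (filt 1 :: 'a fps set)"
    using one_notin_filt[where 'a = 'a] by (auto simp: filt_fps_def dest: spec[of _ 0])
  show "finite (filt_gens :: 'a fps set)" by (simp add: filt_gens_fps_def finite_filt_gens)
  show "filt_gens \<subseteq> (filt 1 :: 'a fps set)"
  proof
    fix h :: "'a fps" assume "h \<in> filt_gens"
    then have "h $ 0 \<in> filt 1"
      using filt_gens_subset[where 'a = 'a] ideal_zero[OF filt_ideal[where 'a = 'a]] by (auto simp: filt_gens_fps_def)
    then have "h $ k \<in> filt (1 - k)" for k by (cases k) (auto simp: filt_0)
    then show "h \<in> filt 1" by (simp add: filt_fps_def)
  qed
  show "\<exists>c. (\<forall>h\<in>filt_gens. c h \<in> filt n) \<and> f = (\<Sum>h\<in>filt_gens. h * c h)" if f: "f \<in> filt (Suc n)"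
  proof -
    have "f $ 0 \<in> filt (Suc n)" using f by (auto simp: filt_fps_def dest: spec[of _ 0])
    from filt_gens[OF this] obtain c where
      c: "\<And>h. h \<in> filt_gens \<Longrightarrow> c h \<in> filt n" "f $ 0 = (\<Sum>h\<in>filt_gens. h * c h)" by metis
    \<comment> \<open>The tail of \<open>f\<close> is the cofactor of \<open>fps_X\<close>. The
      constant term is expanded in the base ring, where \<open>h $ 0\<close> recovers the generator
      from its image. The case distinction is sound because no constant equals
      \<open>fps_X\<close>.\<close>
    define C where "C h = (if h = fps_X then fps_shift 1 f else fps_const (c (h $ 0)))" for h
    have "C h \<in> filt n" if h: "h \<in> filt_gens" for h
    proof (cases "h = fps_X")
      case True
      have "f $ Suc k \<in> filt (n - k)" for k using f by (auto simp: filt_fps_def dest: spec[of _ "Suc k"])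
      then show ?thesis using True by (simp add: C_def filt_fps_def)
    next
      case False
      then obtain g where "h = fps_const g" "g \<in> filt_gens" using h by (auto simp: filt_gens_fps_def)
      then show ?thesis using c(1) False ideal_zero[OF filt_ideal[where 'a = 'a]] by (auto simp: C_def filt_fps_def)
    qed
    moreover have "f = (\<Sum>h\<in>filt_gens. h * C h)"
    proof -
      have nX: "fps_const g \<noteq> fps_X" for g :: 'a
      proof
        assume "fps_const g = fps_X"
        then have "fps_const g $ 1 = fps_X $ 1" by simp
        then show False by simp
      qed
      then have "fps_X \<notin> fps_const ` (filt_gens :: 'a set)" by (metis imageE)
      then have "(\<Sum>h\<in>filt_gens. h * C h) = fps_X * C fps_X + (\<Sum>h\<in>fps_const ` filt_gens. h * C h)"
        unfolding filt_gens_fps_def using finite_filt_gens by (intro sum.insert) auto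
      also have "(\<Sum>h\<in>fps_const ` filt_gens. h * C h) = (\<Sum>g\<in>filt_gens. fps_const g * C (fps_const g))"
        by (rule sum.reindex_cong[of fps_const]) (auto simp: inj_on_def)
      also have "\<dots> = fps_const (f $ 0)"
        unfolding c(2) by (rule fps_ext) (simp add: C_def nX fps_sum_nth)
      finally have *: "(\<Sum>h\<in>filt_gens. h * C h) = fps_X * fps_shift 1 f + fps_const (f $ 0)" by (simp add: C_def)
      show ?thesis unfolding * by (rule fps_ext) (auto simp: fps_X_mult_nth)
    qed
    ultimately show ?thesis by blast
  qed
qed

end

instantiation z2 :: filtered_ring
begin

definition filt_z2 :: "nat \<Rightarrow> z2 set" where "filt_z2 n = {a. residue a n = 0}"
definition filt_gens_z2 :: "z2 set" where "filt_gens_z2 = {2}"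

lemma filt_z2_two_power: "a \<in> filt n \<longleftrightarrow> (\<exists>b. a = (2 :: z2) ^ n * b)"
proof
  show "\<exists>b. a = 2 ^ n * b" if "a \<in> filt n"
    using that unfolding filt_z2_def mem_Collect_eq
  proof (induction n arbitrary: a)
    case (Suc n)
    have "residue a 1 = residue a (Suc n) mod 2 ^ 1" using residue_mod[of 1 "Suc n" a] by simp
    then have "residue a 1 = 0" using Suc.prems by simp
    then obtain b where b: "a = 2 * b" by (rule z2_even)
    then have "residue b n = 0" using Suc.prems residue_2_mult by blast
    from Suc.IH[OF this] show ?case using b by (auto simp: mult.assoc)
  qed simp
  show "a \<in> filt n" if "\<exists>b. a = 2 ^ n * b"
    using that residue_two_power[of n _ 0] residue_range[of _ 0] by (auto simp: filt_z2_def)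
qed

instance
proof
  fix n m :: nat and a b :: z2 and s :: "nat \<Rightarrow> z2"
  show "filt 0 = (UNIV :: z2 set)" using residue_range[of _ 0] by (auto simp: filt_z2_def)
  show "is_ideal (filt n :: z2 set)"
    unfolding is_ideal_def filt_z2_def by (simp add: residue_simps)
  show "filt (Suc n) \<subseteq> (filt n :: z2 set)"
    using residue_mod_Suc by (auto simp: filt_z2_def) (metis mod_0)
  show "a * b \<in> filt (m + n)" if ab: "a \<in> filt m" "b \<in> filt n"
  proof -
    obtain c d where "a = 2 ^ m * c" "b = 2 ^ n * d" using ab unfolding filt_z2_two_power by blast
    then have "a * b = 2 ^ (m + n) * (c * d)" by (simp only: power_add mult_ac)
    then show ?thesis unfolding filt_z2_two_power by blast
  qed
  show "a = 0" if "\<And>n. a \<in> filt n"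
    using that by (intro z2_eqI) (simp add: filt_z2_def residue_simps)
  show "\<exists>b. \<forall>n. b - s n \<in> filt n" if s: "\<And>n. s (Suc n) - s n \<in> filt n"
  proof -
    define t where "t n = residue (s n) n" for n
    have t: "residue (s (Suc n)) n = residue (s n) n" for n
    proof -
      have "(residue (s (Suc n)) n - residue (s n) n) mod 2 ^ n = 0"
        using s[of n] by (simp add: filt_z2_def residue_simps)
      then have "residue (s (Suc n)) n mod 2 ^ n = residue (s n) n mod 2 ^ n"
        by (simp add: mod_eq_dvd_iff dvd_eq_mod_eq_0)
      then show ?thesis by (simp only: residue_range)
    qed
    have "t (Suc n) mod 2 ^ n = t n mod 2 ^ n" for n
      unfolding t_def residue_mod_Suc t residue_range ..
    note r = residue_Abs_z2[of t, OF this]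
    have "Abs_z2 (\<lambda>n. t n mod 2 ^ n) - s n \<in> filt n" for n
      by (simp add: filt_z2_def residue_simps r mod_simps) (simp add: t_def)
    then show ?thesis by blast
  qed
  show "a dvd 1" if "a \<notin> filt 1"
    using that residue_1_cases z2_unit by (auto simp: filt_z2_def)
  show "(1::z2) \<notin> filt 1" by (simp add: filt_z2_def residue_simps)
  show "finite (filt_gens :: z2 set)" by (simp add: filt_gens_z2_def)
  show "filt_gens \<subseteq> (filt 1 :: z2 set)" by (simp add: filt_gens_z2_def filt_z2_def residue_two)
  show "\<exists>c. (\<forall>g\<in>filt_gens. c g \<in> filt n) \<and> a = (\<Sum>g\<in>filt_gens. g * c g)" if a: "a \<in> filt (Suc n)"
  proof -
    obtain b where "a = 2 ^ Suc n * b" using a unfolding filt_z2_two_power by blast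
    then have "a = 2 * (2 ^ n * b)" by (simp add: mult.assoc)
    moreover have "2 ^ n * b \<in> filt n" unfolding filt_z2_two_power by blast
    ultimately show ?thesis by (intro exI[of _ "\<lambda>_. 2 ^ n * b"]) (simp add: filt_gens_z2_def)
  qed
qed

end

instantiation bit :: filtered_ring
begin

definition filt_bit :: "nat \<Rightarrow> bit set" where "filt_bit n = (if n = 0 then UNIV else {0})"
definition filt_gens_bit :: "bit set" where "filt_gens_bit = {}"

instance
proof
  fix n m :: nat and a b :: bit and s :: "nat \<Rightarrow> bit"
  show "\<exists>b. \<forall>n. b - s n \<in> filt n" if s: "\<And>n. s (Suc n) - s n \<in> filt n"
  proof -
    \<comment> \<open>Only the step from \<open>s 0\<close> to \<open>s 1\<close> is unrestricted,
      since \<open>filt 0\<close> is everything.\<close>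
    have eq: "s (Suc n) = s 1" for n
    proof (induction n)
      case (Suc n)
      have "s (Suc (Suc n)) - s (Suc n) = 0" using s[of "Suc n"] by (simp only: filt_bit_def if_False nat.simps singleton_iff)
      then show ?case using Suc by (simp only: right_minus_eq)
    qed simp
    have "s 1 - s n \<in> filt n" for n
    proof (cases n)
      case (Suc k)
      then have "s n = s 1" using eq by simp
      then show ?thesis using Suc by (simp only: diff_self filt_bit_def nat.simps if_False singleton_iff)
    qed (simp add: filt_bit_def)
    then show ?thesis by blast
  qed
  show "a = 0" if "\<And>n. a \<in> filt n" using that[of 1] by (simp add: filt_bit_def)
qed (auto simp: filt_bit_def filt_gens_bit_def is_ideal_def split: if_splits)

end

lemma filt_1_unit_iff: "a \<in> filt 1 \<longleftrightarrow> \<not> a dvd 1" for a :: "'a::filtered_ring"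
proof
  assume "a \<in> filt 1"
  show "\<not> a dvd 1"
  proof
    assume "a dvd 1"
    then obtain b where "1 = a * b" by (rule dvdE)
    then show False
      using ideal_mult2[OF filt_ideal \<open>a \<in> filt 1\<close>, of b] one_notin_filt[where 'a = 'a] by metis
  qed
qed (use filt_unit in blast)

lemma ideal_subset_filt_1: "is_ideal I \<Longrightarrow> 1 \<notin> I \<Longrightarrow> I \<subseteq> filt 1" for I :: "'a::filtered_ring set"
  unfolding filt_1_unit_iff subset_iff using ideal_mult2 by (metis dvdE)

lemma is_prime_filt_1: "is_prime (filt 1 :: 'a::filtered_ring set)"
  unfolding is_prime_def
proof (intro conjI allI impI)
  show "a \<in> filt 1 \<or> b \<in> filt 1" if "a * b \<in> filt 1" for a b :: 'a
    using that unfolding filt_1_unit_iff using mult_dvd_mono[of a 1 b 1] by auto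
qed (use filt_ideal one_notin_filt in auto)

lemma filt_1_generated: 
  fixes J :: "'a::filtered_ring set"
  assumes J: "is_ideal J" "filt_gens \<subseteq> J"
  shows "filt 1 \<subseteq> J"
proof
  fix a :: 'a assume "a \<in> filt 1"
  then obtain c where "a = (\<Sum>g\<in>filt_gens. g * c g)" using filt_gens[of a 0] by auto
  also have "\<dots> \<in> J" using J by (intro ideal_sum_closed ideal_mult2) auto
  finally show "a \<in> J" .
qed

section \<open>Chains of primes and the dimension\<close>

definition prime_chain :: "nat \<Rightarrow> (nat \<Rightarrow> 'a::comm_ring_1 set) \<Rightarrow> bool" where
  "prime_chain n P \<longleftrightarrow> (\<forall>i\<le>n. is_prime (P i)) \<and> (\<forall>i<n. P i \<subset> P (Suc i))"

text \<open>The new chain is {0} followed by the preimages of the old primes under the constant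
  term; \<open>fps_X\<close> makes the first inclusion strict.\<close>

lemma prime_chain_fps:
  fixes P :: "nat \<Rightarrow> 'a::idom set"
  assumes P: "prime_chain n P"
  shows "\<exists>Q :: nat \<Rightarrow> 'a fps set. prime_chain (Suc n) Q"
proof -
  define Q where "Q i = (case i of 0 \<Rightarrow> {0} | Suc j \<Rightarrow> {f :: 'a fps. f $ 0 \<in> P j})" for i
  have "is_prime (Q i)" if "i \<le> Suc n" for i
  proof (cases i)
    case 0
    then show ?thesis by (auto simp: Q_def is_prime_def is_ideal_def)
  next
    case (Suc j)
    then have "is_prime (P j)" using P that by (auto simp: prime_chain_def)
    then show ?thesis using Suc unfolding Q_def is_prime_def is_ideal_def by simp
  qed
  moreover have "Q i \<subset> Q (Suc i)" if "i < Suc n" for i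
  proof (cases i)
    case 0
    have 0: "0 \<in> P 0" using P by (auto simp: prime_chain_def is_prime_def is_ideal_def)
    then have "fps_X \<in> Q 1 - Q 0" by (auto simp: Q_def)
    moreover have "Q 0 \<subseteq> Q 1" using 0 by (auto simp: Q_def)
    ultimately show ?thesis using 0 \<open>i = 0\<close> by auto
  next
    case (Suc j)
    then have *: "P j \<subset> P (Suc j)" using P that by (auto simp: prime_chain_def)
    then obtain a where "a \<in> P (Suc j)" "a \<notin> P j" by blast
    then have "fps_const a \<in> Q (Suc i) - Q i" using Suc by (auto simp: Q_def)
    moreover have "Q i \<subseteq> Q (Suc i)" using * Suc by (auto simp: Q_def)
    ultimately show ?thesis by blast
  qed
  ultimately show ?thesis unfolding prime_chain_def by blast
qed

lemma prime_chain_z2: "\<exists>P :: nat \<Rightarrow> z2 set. prime_chain 1 P"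
proof -
  have "is_prime {0 :: z2}" by (auto simp: is_prime_def is_ideal_def)
  moreover have "2 \<in> (filt 1 :: z2 set)" using filt_gens_subset by (auto simp: filt_gens_z2_def)
  moreover have "(2 :: z2) \<noteq> 0" using z2_two_power_nonzero[of 1] by simp
  moreover have "0 \<in> (filt 1 :: z2 set)" by (rule ideal_zero[OF filt_ideal])
  ultimately have "is_prime {0 :: z2}" "{0 :: z2} \<subset> filt 1" by blast+
  then have "prime_chain 1 (\<lambda>i. if i = 0 then {0 :: z2} else filt 1)"
    unfolding prime_chain_def using is_prime_filt_1[where 'a = z2] by simp
  then show ?thesis by blast
qed

lemma prime_chain_bit: "\<exists>P :: nat \<Rightarrow> bit set. prime_chain 0 P"
  using is_prime_filt_1[where 'a = bit] by (intro exI[of _ "\<lambda>_. filt 1"]) (simp add: prime_chain_def)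

text \<open>The top prime may be replaced by \<open>filt 1\<close>, which contains every proper
  ideal. A prime inside it that contains \<open>B\<close> equals it, so the height theorem
  applies.\<close>

lemma prime_chain_length:
  fixes P :: "nat \<Rightarrow> 'a::{noeth_ring, filtered_ring} set"
  assumes P: "prime_chain n P" and B: "finite B" "B \<subseteq> (filt 1 :: 'a set)" "\<And>J. is_ideal J \<Longrightarrow> B \<subseteq> J \<Longrightarrow> filt 1 \<subseteq> J"
  shows "n \<le> card B"
proof -
  define Q where "Q = P(n := filt 1)"
  have sub: "P i \<subseteq> filt 1" if "i \<le> n" for i
    using P that unfolding prime_chain_def is_prime_def by (intro ideal_subset_filt_1) auto
  show ?thesis
  proof (rule krull_height[OF B(1), of n Q])
    show "is_prime (Q i)" if "i \<le> n" for i
      using P that is_prime_filt_1[where 'a = 'a] by (auto simp: prime_chain_def Q_def)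
    show "Q i \<subset> Q (Suc i)" if "i < n" for i
    proof -
      have "P i \<subset> P (Suc i)" using P that by (auto simp: prime_chain_def)
      then show ?thesis using that sub[of "Suc i"] by (auto simp: Q_def)
    qed
    show "B \<subseteq> Q n" using B by (simp add: Q_def)
    show "q = Q n" if "is_prime q" "B \<subseteq> q" "q \<subseteq> Q n" for q
      using that B(3)[of q] is_prime_ideal[of q] by (auto simp: Q_def)
  qed
qed

lemma card_filt_gens_fps: "card (filt_gens :: 'a::filtered_ring fps set) \<le> Suc (card (filt_gens :: 'a set))"
proof -
  have "card (filt_gens :: 'a fps set) \<le> Suc (card (fps_const ` (filt_gens :: 'a set)))"
    unfolding filt_gens_fps_def by (simp add: card_insert_if finite_filt_gens)
  also have "\<dots> \<le> Suc (card (filt_gens :: 'a set))"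
    using card_image_le[OF finite_filt_gens] by simp
  finally show ?thesis .
qed

subsection \<open>Rings on types\<close>

abbreviation rta :: "'a::comm_ring_1 ring" where "rta \<equiv> ring_of_type_algebra"

lemma rta_simps [simp]: 
  "carrier rta = UNIV" "x \<otimes>\<^bsub>rta\<^esub> y = x * y" "x \<oplus>\<^bsub>rta\<^esub> y = x + y" "\<one>\<^bsub>rta\<^esub> = 1" "\<zero>\<^bsub>rta\<^esub> = 0"
  for x y :: "'a::comm_ring_1"
  by (simp_all add: ring_of_type_algebra_def)

lemma rta_uminus [simp]: "\<ominus>\<^bsub>rta\<^esub> y = - y" for y :: "'a::comm_ring_1"
proof -
  interpret cring "rta :: 'a ring" by (rule cring_from_type_algebra)
  show ?thesis by (rule minus_equality) auto
qed

lemma rta_minus [simp]: "x \<ominus>\<^bsub>rta\<^esub> y = x - y" for x y :: "'a::comm_ring_1"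
  by (simp add: a_minus_def)

lemma rta_pow [simp]: "x [^]\<^bsub>rta\<^esub> (n::nat) = x ^ n" for x :: "'a::comm_ring_1"
  by (induction n) (simp_all add: mult.commute)

lemma ideal_rta [simp]: "ideal I rta \<longleftrightarrow> is_ideal I" for I :: "'a::comm_ring_1 set"
proof
  assume "ideal I rta"
  then interpret ideal I rta .
  show "is_ideal I"
    unfolding is_ideal_def
    using additive_subgroup.zero_closed[OF is_additive_subgroup]
      additive_subgroup.a_closed[OF is_additive_subgroup] I_l_closed by auto
next
  assume I: "is_ideal I"
  show "ideal I rta"
  proof (rule idealI[OF ring_from_type_algebra])
    show "subgroup I (add_monoid rta)"
    proof
      show "inv\<^bsub>add_monoid rta\<^esub> x \<in> I" if "x \<in> I" for x
        using ideal_uminus[OF I that] rta_uminus[of x] by (simp add: a_inv_def)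
    qed (auto simp: ideal_add[OF I] ideal_zero[OF I])
  qed (auto simp: ideal_mult[OF I] ideal_mult2[OF I])
qed

lemma primeideal_rta [simp]: "primeideal I rta \<longleftrightarrow> is_prime I" for I :: "'a::comm_ring_1 set"
proof
  assume "primeideal I rta"
  then interpret primeideal I rta .
  have I: "is_ideal I" using is_ideal by simp
  moreover have "1 \<notin> I" using ideal_one[OF I] I_notcarr by auto
  ultimately show "is_prime I" unfolding is_prime_def using I_prime by auto
next
  assume "is_prime I"
  then show "primeideal I rta"
    by (intro primeidealI cring_from_type_algebra) (auto simp: is_prime_def)
qed

lemma genideal_rta_subset: "B \<subseteq> Idl\<^bsub>rta\<^esub> B" for B :: "'a::comm_ring_1 set"
  by (auto simp: genideal_def)

lemma genideal_rta_least: "is_ideal J \<Longrightarrow> B \<subseteq> J \<Longrightarrow> Idl\<^bsub>rta\<^esub> B \<subseteq> J" for J :: "'a::comm_ring_1 set"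
  by (auto simp: genideal_def)

lemma is_ideal_genideal_rta: "is_ideal (Idl\<^bsub>rta\<^esub> B)" for B :: "'a::comm_ring_1 set"
  unfolding genideal_def is_ideal_def by (auto simp: is_ideal_def)

lemma noetherian_rta: "noetherian_ring (rta :: 'a::noeth_ring ring)"
proof (intro noetherian_ring.intro noetherian_ring_axioms.intro ring_from_type_algebra)
  fix I :: "'a set" assume "ideal I rta"
  then have "is_ideal I" by simp
  from finitely_generated[OF this] obtain B where
    B: "finite B" "B \<subseteq> I" "\<And>J. is_ideal J \<Longrightarrow> B \<subseteq> J \<Longrightarrow> I \<subseteq> J" by metis
  have "I = Idl\<^bsub>rta\<^esub> B"
    using genideal_rta_least[OF \<open>is_ideal I\<close> B(2)] B(3)[OF is_ideal_genideal_rta genideal_rta_subset] by blast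
  then show "\<exists>A\<subseteq>carrier rta. finite A \<and> I = Idl\<^bsub>rta\<^esub> A" using B(1) by auto
qed

lemma maximalideal_rta: "maximalideal M rta \<longleftrightarrow> M = filt 1" for M :: "'a::filtered_ring set"
proof
  assume "maximalideal M rta"
  then interpret maximalideal M rta .
  have M: "is_ideal M" using is_ideal by simp
  have "1 \<notin> M" using ideal_one[OF M] I_notcarr by auto
  then have "M \<subseteq> filt 1" using M ideal_subset_filt_1 by blast
  then show "M = filt 1" using I_maximal[of "filt 1"] filt_ideal one_notin_filt by fastforce
next
  assume M: "M = filt 1"
  show "maximalideal M rta"
  proof (rule maximalidealI)
    fix J assume J: "ideal J rta" "M \<subseteq> J"
    show "J = M \<or> J = carrier rta"
    proof (cases "1 \<in> J")
      case True then show ?thesis using ideal_one[of J] J by simp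
    next
      case False then show ?thesis using ideal_subset_filt_1[of J] J M by auto
    qed
  qed (use M filt_ideal one_notin_filt in \<open>auto simp del: One_nat_def\<close>)
qed

lemma local_ring_rta: "local_ring (rta :: 'a::filtered_ring ring)"
  by (simp add: local_ring_def maximalideal_rta cring_from_type_algebra)

lemma max_ideal_rta: "max_ideal (rta :: 'a::filtered_ring ring) = filt 1"
  by (simp add: max_ideal_def maximalideal_rta)

text \<open>Every finite generating set of the maximal ideal has at least as many elements as a
  chain of primes has steps. A chain with at least \<open>card filt_gens\<close> steps thus forces
  both the dimension and the embedding dimension to be \<open>n\<close>.\<close>

lemma regular_rta:
  fixes P :: "nat \<Rightarrow> 'a::{noeth_ring, filtered_ring} set"
  assumes P: "prime_chain n P" and n: "card (filt_gens :: 'a set) \<le> n"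
  shows "regular_local_ring (rta :: 'a ring)"
proof -
  let ?R = "rta :: 'a ring"
  have len: "m \<le> card B" if "prime_chain m Q" "finite B" "Idl\<^bsub>?R\<^esub> B = filt 1" for m B and Q :: "nat \<Rightarrow> 'a set"
  proof (rule prime_chain_length[OF that(1,2)])
    show "B \<subseteq> filt 1" using genideal_rta_subset[of B] that(3) by simp
    show "filt 1 \<subseteq> J" if "is_ideal J" "B \<subseteq> J" for J
      using genideal_rta_least[OF that] \<open>Idl\<^bsub>?R\<^esub> B = filt 1\<close> by simp
  qed
  have gens: "Idl\<^bsub>?R\<^esub> filt_gens = filt 1"
    using genideal_rta_least[OF filt_ideal filt_gens_subset] 
      filt_1_generated[OF is_ideal_genideal_rta genideal_rta_subset] by blast
  have cn: "card (filt_gens :: 'a set) = n" using n len[OF P finite_filt_gens gens] by simp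
  have "krull_dim ?R = enat n"
    unfolding krull_dim_def
  proof (rule antisym)
    show "Sup {enat n |n. \<exists>p. (\<forall>i\<le>n. primeideal (p i) ?R) \<and> (\<forall>i<n. p i \<subset> p (Suc i))} \<le> enat n"
      using len[OF _ finite_filt_gens gens] cn by (intro Sup_least) (auto simp: prime_chain_def)
    show "enat n \<le> Sup {enat n |n. \<exists>p. (\<forall>i\<le>n. primeideal (p i) ?R) \<and> (\<forall>i<n. p i \<subset> p (Suc i))}"
      using P by (intro Sup_upper) (auto simp: prime_chain_def)
  qed
  moreover have "embedding_dim ?R = n"
    unfolding embedding_dim_def max_ideal_rta
  proof (rule Least_equality)
    show "\<exists>B. B \<subseteq> carrier ?R \<and> finite B \<and> card B = n \<and> Idl\<^bsub>?R\<^esub> B = filt 1"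
      using gens cn finite_filt_gens by (intro exI[of _ filt_gens]) auto
    show "n \<le> m" if "\<exists>B. B \<subseteq> carrier ?R \<and> finite B \<and> card B = m \<and> Idl\<^bsub>?R\<^esub> B = filt 1" for m
      using that len[OF P] by blast
  qed
  ultimately show ?thesis
    unfolding regular_local_ring_def using noetherian_rta local_ring_rta by auto
qed

text \<open>One inclusion of the induction step is \<open>filt_mult\<close>, the other is the last
  axiom of \<open>filtered_ring\<close>.\<close>

lemma filt_power: "filt 1 [^]\<^bsub>ideals_set rta\<^esub> n = (filt n :: 'a::filtered_ring set)"
proof (induction n)
  case 0
  show ?case by (simp add: nat_pow_def ideals_set_def filt_0)
next
  case (Suc n)
  let ?P = "ideal_prod rta (filt n) (filt 1 :: 'a set)"
  have "filt 1 [^]\<^bsub>ideals_set rta\<^esub> Suc n = ?P"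
    using Suc by (simp add: nat_pow_def ideals_set_def)
  also have "\<dots> = filt (Suc n)"
  proof
    show "?P \<subseteq> filt (Suc n)"
    proof
      fix a assume "a \<in> ?P"
      then show "a \<in> filt (Suc n)"
      proof (induction a rule: ideal_prod.induct)
        case (prod i j)
        then show ?case using filt_mult[of i n j 1] by simp
      next
        case (sum a b)
        then show ?case using ideal_add[OF filt_ideal] by auto
      qed
    qed
    show "filt (Suc n) \<subseteq> ?P"
    proof
      fix a :: 'a assume "a \<in> filt (Suc n)"
      then obtain c where c: "\<forall>g\<in>filt_gens. c g \<in> filt n" "a = (\<Sum>g\<in>filt_gens. g * c g)"
        using filt_gens by metis
      have prod: "x * y \<in> ?P" if "x \<in> filt n" "y \<in> filt 1" for x y
        using ideal_prod.prod[of x "filt n" y "filt 1" rta] that by simp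
      have add: "x + y \<in> ?P" if "x \<in> ?P" "y \<in> ?P" for x y
        using ideal_prod.sum[OF that] by simp
      have zero: "0 \<in> ?P" using prod[OF ideal_zero[OF filt_ideal] ideal_zero[OF filt_ideal]] by simp
      have "(\<Sum>g\<in>G. c g * g) \<in> ?P" if "G \<subseteq> filt_gens" for G
        using that
      proof (induction G rule: infinite_finite_induct)
        case (insert g G)
        then show ?case using c(1) filt_gens_subset[where 'a = 'a] by (auto intro!: add prod simp del: One_nat_def)
      qed (use zero in \<open>simp_all del: One_nat_def\<close>)
      then show "a \<in> ?P" using c(2) by (simp add: mult.commute)
    qed
  qed
  finally show ?case .
qed

lemma complete_rta: "complete_local_ring (rta :: 'a::filtered_ring ring)"
  unfolding complete_local_ring_def max_ideal_rta filt_power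
proof (intro conjI local_ring_rta allI impI)
  fix s :: "nat \<Rightarrow> 'a"
  assume "\<forall>n. s n \<in> carrier rta \<and> s (Suc n) \<ominus>\<^bsub>rta\<^esub> s n \<in> filt n"
  then have "s (Suc n) - s n \<in> filt n" for n by simp
  from filt_complete[of s, OF this] obtain b where b: "\<And>n. b - s n \<in> filt n" by blast
  show "\<exists>!b. b \<in> carrier rta \<and> (\<forall>n. b \<ominus>\<^bsub>rta\<^esub> s n \<in> filt n)"
  proof (rule ex1I[of _ b])
    fix c assume "c \<in> carrier rta \<and> (\<forall>n. c \<ominus>\<^bsub>rta\<^esub> s n \<in> filt n)"
    then have c: "c - s n \<in> filt n" for n by simp
    have "c - b \<in> filt n" for n using ideal_diff[OF filt_ideal c b, of n] by simp
    then have "c - b = 0" by (rule filt_separated)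
    then show "c = b" by simp
  qed (use b in simp)
qed

lemma characteristic_zero_rta: "characteristic_zero (rta :: 'a::{comm_ring_1, ring_char_0} ring)"
proof -
  have "[n] \<cdot>\<^bsub>rta\<^esub> 1 = (of_nat n :: 'a)" for n :: nat
    by (induction n) (simp_all add: add_pow_def nat_pow_def add.commute)
  then show ?thesis by (simp add: characteristic_zero_def)
qed

subsection \<open>Division with remainder and evaluation of power series\<close>

text \<open>Substitution of \<open>a\<close> for the outer variable when \<open>a $ 0 = 0\<close>.
  Then \<open>a ^ q\<close> starts at index \<open>q\<close> or later, so the terms up to
  \<open>q = m\<close> give the whole coefficient.\<close>

definition fps_eval :: "'a::comm_ring_1 fps \<Rightarrow> 'a fps fps \<Rightarrow> 'a fps" where
  "fps_eval a f = Abs_fps (\<lambda>m. \<Sum>q\<le>m. (f $ q * a ^ q) $ m)"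

lemma fps_power_nth_eq_0: "a $ 0 = 0 \<Longrightarrow> m < q \<Longrightarrow> (f * a ^ q) $ m = 0" for a f :: "'a::comm_ring_1 fps"
proof (induction q arbitrary: m f)
  case (Suc q)
  have *: "(f * a * a ^ q) $ m = (\<Sum>i=0..m. (f * a ^ q) $ i * a $ (m - i))"
    unfolding fps_mult_nth[symmetric] by (simp only: mult_ac)
  have "(f * a ^ q) $ i * a $ (m - i) = 0" if "i \<in> {0..m}" for i
  proof (cases "i = m")
    case False
    then show ?thesis using Suc.IH[of i f] that Suc.prems by simp
  qed (simp add: Suc.prems)
  then show ?case using * by (simp add: mult.assoc[symmetric])
qed simp

lemma fps_eval_nth:
  assumes "a $ 0 = 0" "m \<le> N"
  shows "fps_eval a f $ m = (\<Sum>q\<le>N. (f $ q * a ^ q) $ m)"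
  unfolding fps_eval_def fps_nth_Abs_fps
  using assms by (intro sum.mono_neutral_left) (auto intro!: fps_power_nth_eq_0)

lemma fps_eval_unfold:
  assumes a: "a $ 0 = 0"
  shows "fps_eval a f = f $ 0 + a * fps_eval a (fps_shift 1 f)"
proof (rule fps_ext)
  fix m
  have "(a * fps_eval a (fps_shift 1 f)) $ m = (\<Sum>i=0..m. a $ i * (\<Sum>q\<le>m. (f $ Suc q * a ^ q) $ (m - i)))"
    unfolding fps_mult_nth[of a] by (intro sum.cong refl) (simp add: fps_eval_nth[OF a, of _ m])
  also have "\<dots> = (\<Sum>q\<le>m. \<Sum>i=0..m. a $ i * (f $ Suc q * a ^ q) $ (m - i))"
    unfolding sum_distrib_left by (rule sum.swap)
  also have "\<dots> = (\<Sum>q\<le>m. (f $ Suc q * a ^ Suc q) $ m)"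
    by (simp add: fps_mult_nth[of a, symmetric] mult_ac)
  finally have "(f $ 0 + a * fps_eval a (fps_shift 1 f)) $ m = (\<Sum>q\<le>Suc m. (f $ q * a ^ q) $ m)"
    by (subst sum.atMost_Suc_shift) simp
  then show "fps_eval a f $ m = (f $ 0 + a * fps_eval a (fps_shift 1 f)) $ m"
    using fps_eval_nth[OF a, of m "Suc m" f] by simp
qed

text \<open>Weierstrass division by \<open>X^n - a\<close>. Reading \<open>X^n\<close> as
  \<open>a\<close> gives the remainder: \<open>e k\<close> is the sum of all
  \<open>f $ (n * i + k) * a ^ i\<close>. Horner's rule \<open>e k = f $ k + a * e (n + k)\<close>
  then shows that the \<open>e (n + k)\<close> are the coefficients of the quotient.\<close>

lemma fps_division:
  fixes a :: "'a::comm_ring_1 fps"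
  assumes a: "a $ 0 = 0" and n: "n > 0"
  shows "\<exists>q. f = q * (fps_X ^ n - fps_const a) +
    (\<Sum>k<n. fps_const (fps_eval a (Abs_fps (\<lambda>i. f $ (n * i + k)))) * fps_X ^ k)"
proof -
  define e where "e k = fps_eval a (Abs_fps (\<lambda>i. f $ (n * i + k)))" for k
  have e: "e k = f $ k + a * e (n + k)" for k
  proof -
    have *: "fps_shift 1 (Abs_fps (\<lambda>i. f $ (n * i + k))) = Abs_fps (\<lambda>i. f $ (n * i + (n + k)))"
      by (rule fps_ext) (simp add: algebra_simps)
    show ?thesis unfolding e_def by (subst fps_eval_unfold[OF a], subst *) simp
  qed
  define q where "q = Abs_fps (\<lambda>k. e (n + k))"
  have "f = q * (fps_X ^ n - fps_const a) + (\<Sum>k<n. fps_const (e k) * fps_X ^ k)"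
  proof (rule fps_ext)
    fix k
    have 1: "(q * fps_X ^ n) $ k = (if k < n then 0 else e k)"
      by (simp add: fps_X_power_mult_right_nth q_def)
    have 2: "(q * fps_const a) $ k = a * e (n + k)"
      by (simp add: q_def mult.commute)
    have "(\<Sum>j<n. fps_const (e j) * fps_X ^ j) $ k = (\<Sum>j<n. if k = j then e j else 0)"
      by (simp add: fps_sum_nth fps_X_power_nth if_distrib cong: if_cong)
    also have "\<dots> = (if k < n then e k else 0)" by simp
    finally show "f $ k = (q * (fps_X ^ n - fps_const a) + (\<Sum>k<n. fps_const (e k) * fps_X ^ k)) $ k"
      using 1 2 e[of k] by (simp add: right_diff_distrib)
  qed
  then show ?thesis unfolding e_def by blast
qed

lemma fps_eval_division:
  fixes a :: "'a::comm_ring_1 fps"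
  assumes "a $ 0 = 0"
  shows "\<exists>q. f = q * (fps_X - fps_const a) + fps_const (fps_eval a f)"
proof -
  have "Abs_fps (\<lambda>i. f $ i) = f" by (rule fps_ext) simp
  then show ?thesis using fps_division[OF assms, of 1 f] by simp
qed

text \<open>Uniqueness of the remainder. Comparing coefficients, \<open>r = - (a * q $ 0)\<close>
  and \<open>q $ k = a * q $ Suc k\<close>, so \<open>r\<close> is divisible by every power of
  \<open>a\<close>, which has positive order.\<close>

lemma fps_const_dvd_eq_0:
  fixes a :: "'a::comm_ring_1 fps"
  assumes a: "a $ 0 = 0" and r: "fps_const r = q * (fps_X - fps_const a)"
  shows "r = 0"
proof (rule fps_ext)
  fix m
  have c: "(q * (fps_X - fps_const a)) $ k = (if k = 0 then 0 else q $ (k - 1)) - a * q $ k" for k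
    by (simp add: right_diff_distrib mult.commute)
  have 0: "r = - (a * q $ 0)" using arg_cong[OF r, of "\<lambda>f. f $ 0"] c[of 0] by simp
  have S: "q $ k = a * q $ Suc k" for k
    using arg_cong[OF r, of "\<lambda>f. f $ Suc k"] c[of "Suc k"] by simp
  have "q $ 0 = q $ k * a ^ k" for k
  proof (induction k)
    case (Suc k)
    also have "q $ k * a ^ k = q $ Suc k * a ^ Suc k" by (subst S) (simp add: mult_ac)
    finally show ?case .
  qed simp
  then have "q $ 0 = q $ m * a ^ m" .
  then have "r = - (q $ m * a ^ Suc m)" using 0 by (simp add: mult_ac)
  then show "r $ m = 0 $ m" using fps_power_nth_eq_0[OF a, of m "Suc m" "q $ m"] by simp
qed

lemma fps_eval_eqI:
  fixes a :: "'a::comm_ring_1 fps"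
  assumes a: "a $ 0 = 0" and f: "f = q * (fps_X - fps_const a) + fps_const r"
  shows "fps_eval a f = r"
proof -
  define D where "D = fps_X - fps_const a"
  obtain p where p: "f = p * D + fps_const (fps_eval a f)"
    using fps_eval_division[OF a] unfolding D_def by blast
  have "fps_const (fps_eval a f) = f - p * D" using p by (metis add_diff_cancel_left')
  moreover have "fps_const r = f - q * D" using f unfolding D_def by (metis add_diff_cancel_left')
  ultimately have "fps_const (fps_eval a f - r) = (f - p * D) - (f - q * D)"
    by (simp only: fps_const_sub[symmetric])
  also have "\<dots> = (q - p) * (fps_X - fps_const a)" by (simp add: D_def algebra_simps)
  finally have "fps_const (fps_eval a f - r) = (q - p) * (fps_X - fps_const a)" .
  from fps_const_dvd_eq_0[OF a this] show ?thesis by simp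
qed

text \<open>Evaluation is the remainder modulo \<open>fps_X - fps_const a\<close>; by uniqueness of
  remainders, adding and multiplying two divisions gives the homomorphism laws.\<close>

lemma fps_eval_hom:
  fixes a :: "'a::comm_ring_1 fps"
  assumes a: "a $ 0 = 0"
  shows "fps_eval a (f + g) = fps_eval a f + fps_eval a g"
    and "fps_eval a (f * g) = fps_eval a f * fps_eval a g"
    and "fps_eval a (fps_const r) = r"
    and "fps_eval a fps_X = a"
proof -
  obtain p where p: "f = p * (fps_X - fps_const a) + fps_const (fps_eval a f)"
    using fps_eval_division[OF a] by blast
  obtain q where q: "g = q * (fps_X - fps_const a) + fps_const (fps_eval a g)"
    using fps_eval_division[OF a] by blast
  show "fps_eval a (f + g) = fps_eval a f + fps_eval a g"
    by (rule fps_eval_eqI[OF a, of _ "p + q"], subst p, subst q)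
       (simp add: algebra_simps flip: fps_const_add)
  show "fps_eval a (f * g) = fps_eval a f * fps_eval a g"
    by (rule fps_eval_eqI[OF a, of _ "p * g + fps_const (fps_eval a f) * q"], subst p, subst (1 2) q)
       (simp add: algebra_simps flip: fps_const_mult)
  show "fps_eval a (fps_const r) = r" by (rule fps_eval_eqI[OF a, of _ 0]) simp
  show "fps_eval a fps_X = a" by (rule fps_eval_eqI[OF a, of _ 1]) simp
qed

section \<open>Ring homomorphisms and coefficientwise maps\<close>

definition is_ring_hom :: "('a::comm_ring_1 \<Rightarrow> 'b::comm_ring_1) \<Rightarrow> bool" where
  "is_ring_hom h \<longleftrightarrow> (\<forall>a b. h (a + b) = h a + h b) \<and> (\<forall>a b. h (a * b) = h a * h b) \<and> h 1 = 1"

definition fps_map :: "('a \<Rightarrow> 'b) \<Rightarrow> 'a fps \<Rightarrow> 'b fps" where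
  "fps_map h f = Abs_fps (\<lambda>n. h (f $ n))"

lemma fps_map_nth [simp]: "fps_map h f $ n = h (f $ n)"
  by (simp add: fps_map_def)

lemma is_ring_hom_add: "is_ring_hom h \<Longrightarrow> h (a + b) = h a + h b"
  and is_ring_hom_mult: "is_ring_hom h \<Longrightarrow> h (a * b) = h a * h b"
  and is_ring_hom_1: "is_ring_hom h \<Longrightarrow> h 1 = 1"
  by (simp_all add: is_ring_hom_def)

lemma is_ring_hom_0: "is_ring_hom h \<Longrightarrow> h 0 = 0"
  using is_ring_hom_add[of h 0 0] by simp

lemma is_ring_hom_diff: "is_ring_hom h \<Longrightarrow> h (a - b) = h a - h b"
  using is_ring_hom_add[of h "a - b" b] by (simp add: algebra_simps)

lemma is_ring_hom_power: "is_ring_hom h \<Longrightarrow> h (a ^ n) = h a ^ n"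
  by (induction n) (simp_all add: is_ring_hom_mult is_ring_hom_1)

lemma is_ring_hom_sum: "is_ring_hom h \<Longrightarrow> h (\<Sum>i\<in>I. f i) = (\<Sum>i\<in>I. h (f i))"
  by (induction I rule: infinite_finite_induct) (simp_all add: is_ring_hom_add is_ring_hom_0)

lemma is_ring_hom_comp: "is_ring_hom h \<Longrightarrow> is_ring_hom g \<Longrightarrow> is_ring_hom (\<lambda>a. g (h a))"
  by (simp add: is_ring_hom_def)

lemma is_ring_hom_fps_map: "is_ring_hom h \<Longrightarrow> is_ring_hom (fps_map h)"
  unfolding is_ring_hom_def[of "fps_map h"]
  by (auto simp: fps_eq_iff is_ring_hom_add is_ring_hom_1 is_ring_hom_0 is_ring_hom_mult is_ring_hom_sum
      fps_mult_nth fps_one_nth)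

lemma is_ring_hom_fps_nth_0: "is_ring_hom (\<lambda>f. f $ 0)"
  by (simp add: is_ring_hom_def)

lemma is_ring_hom_fps_eval: "a $ 0 = 0 \<Longrightarrow> is_ring_hom (fps_eval a)"
  unfolding is_ring_hom_def using fps_eval_hom[of a] fps_eval_hom(3)[of a 1] by simp

lemma fps_map_const: "is_ring_hom h \<Longrightarrow> fps_map h (fps_const a) = fps_const (h a)"
  and fps_map_X: "is_ring_hom h \<Longrightarrow> fps_map h fps_X = fps_X"
  by (auto simp: fps_eq_iff is_ring_hom_0 is_ring_hom_1)

lemma is_ideal_vimage: 
  assumes "is_ring_hom h" "is_ideal J" shows "is_ideal {a. h a \<in> J}"
  using assms(2) unfolding is_ideal_def
  by (auto simp: is_ring_hom_add[OF assms(1)] is_ring_hom_mult[OF assms(1)] is_ring_hom_0[OF assms(1)])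

lemma is_prime_kernel:
  fixes h :: "'a::comm_ring_1 \<Rightarrow> 'b::idom"
  assumes h: "is_ring_hom h" shows "is_prime {a. h a = 0}"
  using is_ideal_vimage[OF h, of "{0}"] unfolding is_prime_def
  by (auto simp: is_ring_hom_mult[OF h] is_ring_hom_1[OF h] is_ideal_def)

section \<open>Reduction of the 2-adic integers modulo 2\<close>

definition parity :: "z2 \<Rightarrow> bit" where "parity a = (if residue a 1 = 0 then 0 else 1)"

lemma is_ring_hom_parity: "is_ring_hom parity"
proof -
  have a: "residue a 1 = 0 \<or> residue a 1 = 1" for a by (rule residue_1_cases)
  have "parity (a + b) = parity a + parity b" for a b
    using a[of a] a[of b] by (auto simp: parity_def residue_simps)
  moreover have "parity (a * b) = parity a * parity b" for a b
    using a[of a] a[of b] by (auto simp: parity_def residue_simps)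
  moreover have "parity 1 = 1" by (simp add: parity_def residue_simps)
  ultimately show ?thesis by (simp add: is_ring_hom_def)
qed

lemma parity_eq_0: "parity a = 0 \<Longrightarrow> \<exists>b. a = 2 * b"
  using z2_even[of a] by (auto simp: parity_def split: if_splits)

lemma fps_map_parity_eq_0: 
  fixes f :: "z2 fps" assumes "fps_map parity f = 0" obtains g where "f = 2 * g"
proof -
  have "\<exists>b. f $ n = 2 * b" for n
    using parity_eq_0 arg_cong[OF assms, of "\<lambda>f. f $ n"] by simp
  then obtain b where b: "\<And>n. f $ n = 2 * b n" by metis
  have "f $ n = (2 * Abs_fps b) $ n" for n
    unfolding mult_2 fps_add_nth fps_nth_Abs_fps b ..
  then have "f = 2 * Abs_fps b" by (rule fps_ext)
  then show ?thesis by (rule that)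
qed

subsection \<open>A criterion for infinite self-injective dimension\<close>

lemma injective_moduleD:
  fixes M N :: "('a, 'a) module"
  assumes "injective_module R E" "module R M" "module R N" "f \<in> module_homs R M N"
    "inj_on f (carrier M)" "g \<in> module_homs R M E"
  shows "\<exists>h\<in>module_homs R N E. \<forall>x\<in>carrier M. h (f x) = g x"
proof -
  have *: "\<forall>(M :: ('a, 'a) module) (N :: ('a, 'a) module) f g.
        module R M \<and> module R N \<and> f \<in> module_homs R M N \<and> inj_on f (carrier M) \<and>
        g \<in> module_homs R M E \<longrightarrow> (\<exists>h \<in> module_homs R N E. \<forall>x\<in>carrier M. h (f x) = g x)"
    using assms(1) unfolding injective_module_def by (rule conjunct2)
  show ?thesis by (rule *[rule_format]) (intro conjI assms(2-))
qed

lemma module_homsD: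
  assumes "f \<in> module_homs R M N"
  shows "x \<in> carrier M \<Longrightarrow> f x \<in> carrier N"
    and "x \<in> carrier M \<Longrightarrow> y \<in> carrier M \<Longrightarrow> f (x \<oplus>\<^bsub>M\<^esub> y) = f x \<oplus>\<^bsub>N\<^esub> f y"
    and "a \<in> carrier R \<Longrightarrow> x \<in> carrier M \<Longrightarrow> f (a \<odot>\<^bsub>M\<^esub> x) = a \<odot>\<^bsub>N\<^esub> f x"
  using assms by (auto simp: module_homs_def)

lemma module_via_simps [simp]:
  "carrier (module_via h S) = carrier S" "x \<oplus>\<^bsub>module_via h S\<^esub> y = x \<oplus>\<^bsub>S\<^esub> y"
  "\<zero>\<^bsub>module_via h S\<^esub> = \<zero>\<^bsub>S\<^esub>" "a \<odot>\<^bsub>module_via h S\<^esub> x = h a \<otimes>\<^bsub>S\<^esub> x"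
  by (simp_all add: module_via_def)

lemma module_module_via:
  assumes "cring R" "cring S" "h \<in> ring_hom R S"
  shows "module R (module_via h S)"
proof -
  interpret R: cring R by fact
  interpret S: cring S by fact
  note h = ring_hom_closed[OF assms(3)] ring_hom_add[OF assms(3)] ring_hom_mult[OF assms(3)] ring_hom_one[OF assms(3)]
  have "abelian_group (module_via h S)"
  proof (rule abelian_groupI)
    show "\<exists>y\<in>carrier (module_via h S). y \<oplus>\<^bsub>module_via h S\<^esub> x = \<zero>\<^bsub>module_via h S\<^esub>"
      if "x \<in> carrier (module_via h S)" for x
      using that S.l_neg[of x] S.a_inv_closed[of x] by (intro bexI[of _ "\<ominus>\<^bsub>S\<^esub> x"]) simp_all
  qed (simp_all add: S.a_ac)
  then show ?thesis
    by (intro moduleI assms(1)) (simp_all add: h S.l_distr S.r_distr S.m_assoc)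
qed

lemma (in cring) module_self: "module R (module_via (\<lambda>a. a) R)"
  using module_module_via[OF is_cring is_cring, of "\<lambda>a. a"] by (simp add: ring_hom_def)

context module
begin

lemma smult_minus: "a \<in> carrier R \<Longrightarrow> x \<in> carrier M \<Longrightarrow> y \<in> carrier M \<Longrightarrow>
    a \<odot>\<^bsub>M\<^esub> (x \<ominus>\<^bsub>M\<^esub> y) = a \<odot>\<^bsub>M\<^esub> x \<ominus>\<^bsub>M\<^esub> a \<odot>\<^bsub>M\<^esub> y"
  by (simp add: a_minus_def smult_r_distr smult_r_minus)

lemma smult_commute: "a \<in> carrier R \<Longrightarrow> b \<in> carrier R \<Longrightarrow> x \<in> carrier M \<Longrightarrow>
    a \<odot>\<^bsub>M\<^esub> (b \<odot>\<^bsub>M\<^esub> x) = b \<odot>\<^bsub>M\<^esub> (a \<odot>\<^bsub>M\<^esub> x)"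
  by (simp add: smult_assoc1[symmetric] R.m_comm)

end

lemma module_hom_zero:
  fixes R (structure)
  assumes "module R M" "module R N" "f \<in> module_homs R M N" shows "f \<zero>\<^bsub>M\<^esub> = \<zero>\<^bsub>N\<^esub>"
proof -
  interpret module R M by fact
  interpret N: module R N by fact
  have "f (\<zero> \<odot>\<^bsub>M\<^esub> \<zero>\<^bsub>M\<^esub>) = \<zero> \<odot>\<^bsub>N\<^esub> f \<zero>\<^bsub>M\<^esub>"
    by (rule module_homsD(3)[OF assms(3)]) auto
  then show ?thesis using module_homsD(1)[OF assms(3), of "\<zero>\<^bsub>M\<^esub>"] by simp
qed

lemma module_hom_minus:
  fixes R (structure)
  assumes "module R M" "module R N" and f: "f \<in> module_homs R M N" and xy: "x \<in> carrier M" "y \<in> carrier M"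
  shows "f (x \<ominus>\<^bsub>M\<^esub> y) = f x \<ominus>\<^bsub>N\<^esub> f y"
proof -
  interpret module R M by fact
  interpret N: module R N by fact
  have "\<ominus>\<^bsub>M\<^esub> y = (\<ominus> \<one>) \<odot>\<^bsub>M\<^esub> y" using xy(2) smult_l_minus[of \<one> y] by simp
  then have "f (\<ominus>\<^bsub>M\<^esub> y) = (\<ominus> \<one>) \<odot>\<^bsub>N\<^esub> f y"
    using module_homsD(3)[OF f, of "\<ominus> \<one>" y] xy(2) by simp
  also have "\<dots> = \<ominus>\<^bsub>N\<^esub> f y"
    using N.smult_l_minus[of \<one> "f y"] module_homsD(1)[OF f xy(2)] by simp
  finally show ?thesis
    using module_homsD(2)[OF f xy(1), of "\<ominus>\<^bsub>M\<^esub> y"] xy(2) by (simp add: a_minus_def)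
qed

lemma (in abelian_group) minus_eq_zero: "x \<in> carrier G \<Longrightarrow> y \<in> carrier G \<Longrightarrow> x \<ominus> y = \<zero> \<longleftrightarrow> x = y"
  by (metis a_minus_def add.inv_closed add.inv_solve_right' l_zero r_neg zero_closed)

lemma (in abelian_group) minus_zero_right: "x \<in> carrier G \<Longrightarrow> x \<ominus> \<zero> = x"
  by (simp add: a_minus_def)

text \<open>Extend the map \<open>i + b w \<mapsto> b e\<close> from the ideal \<open>I + (w)\<close> to the whole ring.\<close>

lemma injective_divide:
  fixes B :: "'a ring"
  assumes B: "cring B" and E: "injective_module B E" and I: "ideal I B"
    and w: "w \<in> carrier B" and e: "e \<in> carrier E"
    and kill: "\<And>b. b \<in> carrier B \<Longrightarrow> w \<otimes>\<^bsub>B\<^esub> b \<in> I \<Longrightarrow> b \<odot>\<^bsub>E\<^esub> e = \<zero>\<^bsub>E\<^esub>"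
  shows "\<exists>f\<in>carrier E. w \<odot>\<^bsub>E\<^esub> f = e \<and> (\<forall>i\<in>I. i \<odot>\<^bsub>E\<^esub> f = \<zero>\<^bsub>E\<^esub>)"
proof -
  interpret B: cring B by fact
  interpret E: module B E using E by (simp add: injective_module_def)
  interpret I: ideal I B by fact
  let ?N = "module_via (\<lambda>a. a) B"
  interpret N: module B ?N by (rule B.module_self)
  define H where "H = {i \<oplus>\<^bsub>B\<^esub> w \<otimes>\<^bsub>B\<^esub> b | i b. i \<in> I \<and> b \<in> carrier B}"
  have HI: "i \<oplus>\<^bsub>B\<^esub> w \<otimes>\<^bsub>B\<^esub> b \<in> H" if "i \<in> I" "b \<in> carrier B" for i b
    using that by (auto simp: H_def)
  have Hcarr: "H \<subseteq> carrier B" using w by (auto simp: H_def)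
  have "submodule H B ?N"
  proof (rule N.submoduleI)
    show "\<zero>\<^bsub>?N\<^esub> \<in> H" using HI[OF I.zero_closed B.zero_closed] w by simp
    show "x \<oplus>\<^bsub>?N\<^esub> y \<in> H" if "x \<in> H" "y \<in> H" for x y
    proof -
      obtain i b j c where ij: "i \<in> I" "j \<in> I" "b \<in> carrier B" "c \<in> carrier B"
        and xy: "x = i \<oplus>\<^bsub>B\<^esub> w \<otimes>\<^bsub>B\<^esub> b" "y = j \<oplus>\<^bsub>B\<^esub> w \<otimes>\<^bsub>B\<^esub> c" using \<open>x \<in> H\<close> \<open>y \<in> H\<close> by (auto simp: H_def)
      have "x \<oplus>\<^bsub>?N\<^esub> y = (i \<oplus>\<^bsub>B\<^esub> j) \<oplus>\<^bsub>B\<^esub> w \<otimes>\<^bsub>B\<^esub> (b \<oplus>\<^bsub>B\<^esub> c)"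
        using ij w unfolding xy by (simp add: B.r_distr B.a_ac)
      then show ?thesis using HI[of "i \<oplus>\<^bsub>B\<^esub> j" "b \<oplus>\<^bsub>B\<^esub> c"] ij by simp
    qed
    show sm: "a \<odot>\<^bsub>?N\<^esub> x \<in> H" if "a \<in> carrier B" "x \<in> H" for a x
    proof -
      obtain i b where ij: "i \<in> I" "b \<in> carrier B"
        and xy: "x = i \<oplus>\<^bsub>B\<^esub> w \<otimes>\<^bsub>B\<^esub> b" using \<open>x \<in> H\<close> by (auto simp: H_def)
      have "a \<odot>\<^bsub>?N\<^esub> x = (a \<otimes>\<^bsub>B\<^esub> i) \<oplus>\<^bsub>B\<^esub> w \<otimes>\<^bsub>B\<^esub> (a \<otimes>\<^bsub>B\<^esub> b)"
        using ij w \<open>a \<in> carrier B\<close> unfolding xy by (simp add: B.r_distr B.m_ac)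
      then show ?thesis using HI[of "a \<otimes>\<^bsub>B\<^esub> i" "a \<otimes>\<^bsub>B\<^esub> b"] ij \<open>a \<in> carrier B\<close> I.I_l_closed by simp
    qed
    show "\<ominus>\<^bsub>?N\<^esub> x \<in> H" if "x \<in> H" for x
    proof -
      have "x \<in> carrier ?N" using that Hcarr by auto
      then have "\<ominus>\<^bsub>?N\<^esub> x = (\<ominus>\<^bsub>B\<^esub> \<one>\<^bsub>B\<^esub>) \<odot>\<^bsub>?N\<^esub> x"
        using N.smult_l_minus[of "\<one>\<^bsub>B\<^esub>" x] N.smult_one[of x] by simp
      then show ?thesis using sm[OF _ that] by simp
    qed
  qed (use Hcarr in simp)
  then have M: "module B (?N\<lparr>carrier := H\<rparr>)"
    by (rule submodule.submodule_is_module) (rule B.module_self)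
  \<comment> \<open>\<open>b\<close> is not determined by the sum \<open>i + w b\<close>. Two
    representations differ by \<open>w (b - c)\<close> in \<open>I\<close>, and \<open>kill\<close>
    makes the value independent of the choice.\<close>
  define g where "g h = (SOME v. \<exists>i b. i \<in> I \<and> b \<in> carrier B \<and> h = i \<oplus>\<^bsub>B\<^esub> w \<otimes>\<^bsub>B\<^esub> b \<and> v = b \<odot>\<^bsub>E\<^esub> e)" for h
  have g: "g (i \<oplus>\<^bsub>B\<^esub> w \<otimes>\<^bsub>B\<^esub> b) = b \<odot>\<^bsub>E\<^esub> e" if "i \<in> I" "b \<in> carrier B" for i b
  proof -
    have "\<exists>j c. j \<in> I \<and> c \<in> carrier B \<and> i \<oplus>\<^bsub>B\<^esub> w \<otimes>\<^bsub>B\<^esub> b = j \<oplus>\<^bsub>B\<^esub> w \<otimes>\<^bsub>B\<^esub> c \<and> g (i \<oplus>\<^bsub>B\<^esub> w \<otimes>\<^bsub>B\<^esub> b) = c \<odot>\<^bsub>E\<^esub> e"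
      unfolding g_def by (rule someI_ex) (use that in blast)
    then obtain j c where jc: "j \<in> I" "c \<in> carrier B" "i \<oplus>\<^bsub>B\<^esub> w \<otimes>\<^bsub>B\<^esub> b = j \<oplus>\<^bsub>B\<^esub> w \<otimes>\<^bsub>B\<^esub> c"
      and gc: "g (i \<oplus>\<^bsub>B\<^esub> w \<otimes>\<^bsub>B\<^esub> b) = c \<odot>\<^bsub>E\<^esub> e" by blast
    have carr: "i \<in> carrier B" "j \<in> carrier B" using that jc I.a_subset by auto
    have "w \<otimes>\<^bsub>B\<^esub> (b \<ominus>\<^bsub>B\<^esub> c) = j \<ominus>\<^bsub>B\<^esub> i"
    proof -
      have "w \<otimes>\<^bsub>B\<^esub> b = \<ominus>\<^bsub>B\<^esub> i \<oplus>\<^bsub>B\<^esub> (i \<oplus>\<^bsub>B\<^esub> w \<otimes>\<^bsub>B\<^esub> b)" using carr w that by (simp add: B.r_neg1)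
      also have "\<dots> = \<ominus>\<^bsub>B\<^esub> i \<oplus>\<^bsub>B\<^esub> (j \<oplus>\<^bsub>B\<^esub> w \<otimes>\<^bsub>B\<^esub> c)" by (simp only: jc)
      finally have "w \<otimes>\<^bsub>B\<^esub> b = \<ominus>\<^bsub>B\<^esub> i \<oplus>\<^bsub>B\<^esub> (j \<oplus>\<^bsub>B\<^esub> w \<otimes>\<^bsub>B\<^esub> c)" .
      then show ?thesis using carr w that jc(2)
        by (simp add: a_minus_def B.r_distr B.r_minus B.a_ac B.r_neg B.r_neg1 B.r_neg2)
    qed
    also have "\<dots> \<in> I" using that jc by (simp add: a_minus_def)
    finally have "(b \<ominus>\<^bsub>B\<^esub> c) \<odot>\<^bsub>E\<^esub> e = \<zero>\<^bsub>E\<^esub>" using that jc by (intro kill) auto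
    then have "b \<odot>\<^bsub>E\<^esub> e \<ominus>\<^bsub>E\<^esub> c \<odot>\<^bsub>E\<^esub> e = \<zero>\<^bsub>E\<^esub>"
      using that jc e by (simp add: a_minus_def E.smult_l_distr E.smult_l_minus)
    then have "b \<odot>\<^bsub>E\<^esub> e = c \<odot>\<^bsub>E\<^esub> e"
      using E.minus_eq_zero[of "b \<odot>\<^bsub>E\<^esub> e" "c \<odot>\<^bsub>E\<^esub> e"] that jc e by simp
    then show ?thesis using gc by simp
  qed
  have gh: "g \<in> module_homs B (?N\<lparr>carrier := H\<rparr>) E"
    unfolding module_homs_def mem_Collect_eq
  proof (intro conjI ballI Pi_I)
    show "g x \<in> carrier E" if "x \<in> carrier (?N\<lparr>carrier := H\<rparr>)" for x
      using that e by (auto simp: H_def g)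
    show "g (x \<oplus>\<^bsub>?N\<lparr>carrier := H\<rparr>\<^esub> y) = g x \<oplus>\<^bsub>E\<^esub> g y"
      if H: "x \<in> carrier (?N\<lparr>carrier := H\<rparr>)" "y \<in> carrier (?N\<lparr>carrier := H\<rparr>)" for x y
    proof -
      obtain i b j c where ij: "i \<in> I" "j \<in> I" "b \<in> carrier B" "c \<in> carrier B"
        and xy: "x = i \<oplus>\<^bsub>B\<^esub> w \<otimes>\<^bsub>B\<^esub> b" "y = j \<oplus>\<^bsub>B\<^esub> w \<otimes>\<^bsub>B\<^esub> c" using H by (auto simp: H_def)
      have "x \<oplus>\<^bsub>B\<^esub> y = (i \<oplus>\<^bsub>B\<^esub> j) \<oplus>\<^bsub>B\<^esub> w \<otimes>\<^bsub>B\<^esub> (b \<oplus>\<^bsub>B\<^esub> c)"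
        using ij w unfolding xy by (simp add: B.r_distr B.a_ac)
      then have "g (x \<oplus>\<^bsub>B\<^esub> y) = (b \<oplus>\<^bsub>B\<^esub> c) \<odot>\<^bsub>E\<^esub> e" using g[of "i \<oplus>\<^bsub>B\<^esub> j" "b \<oplus>\<^bsub>B\<^esub> c"] ij by simp
      then show ?thesis using ij e by (simp add: xy g E.smult_l_distr)
    qed
    show "g (a \<odot>\<^bsub>?N\<lparr>carrier := H\<rparr>\<^esub> x) = a \<odot>\<^bsub>E\<^esub> g x"
      if a: "a \<in> carrier B" and H: "x \<in> carrier (?N\<lparr>carrier := H\<rparr>)" for a x
    proof -
      obtain i b where ij: "i \<in> I" "b \<in> carrier B"
        and xy: "x = i \<oplus>\<^bsub>B\<^esub> w \<otimes>\<^bsub>B\<^esub> b" using H by (auto simp: H_def)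
      have "a \<otimes>\<^bsub>B\<^esub> x = (a \<otimes>\<^bsub>B\<^esub> i) \<oplus>\<^bsub>B\<^esub> w \<otimes>\<^bsub>B\<^esub> (a \<otimes>\<^bsub>B\<^esub> b)"
        using ij w a unfolding xy by (simp add: B.r_distr B.m_ac)
      then have "g (a \<otimes>\<^bsub>B\<^esub> x) = (a \<otimes>\<^bsub>B\<^esub> b) \<odot>\<^bsub>E\<^esub> e"
        using g[of "a \<otimes>\<^bsub>B\<^esub> i" "a \<otimes>\<^bsub>B\<^esub> b"] ij a I.I_l_closed by simp
      then show ?thesis using ij e a by (simp add: xy g E.smult_assoc1)
    qed
  qed
  have "(\<lambda>x. x) \<in> module_homs B (?N\<lparr>carrier := H\<rparr>) ?N"
    using Hcarr by (auto simp: module_homs_def)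
  from injective_moduleD[OF E M B.module_self this _ gh]
  obtain h where h: "h \<in> module_homs B ?N E" "\<And>x. x \<in> H \<Longrightarrow> h x = g x" by auto
  define f where "f = h \<one>\<^bsub>B\<^esub>"
  have f: "f \<in> carrier E" using module_homsD(1)[OF h(1), of "\<one>\<^bsub>B\<^esub>"] by (simp add: f_def)
  have hf: "h a = a \<odot>\<^bsub>E\<^esub> f" if "a \<in> carrier B" for a
    using module_homsD(3)[OF h(1) that, of "\<one>\<^bsub>B\<^esub>"] that by (simp add: f_def)
  have wH: "\<zero>\<^bsub>B\<^esub> \<oplus>\<^bsub>B\<^esub> w \<otimes>\<^bsub>B\<^esub> \<one>\<^bsub>B\<^esub> = w" using w by simp
  have "w \<odot>\<^bsub>E\<^esub> f = e"
    using hf[OF w] h(2)[of w] HI[of "\<zero>\<^bsub>B\<^esub>" "\<one>\<^bsub>B\<^esub>"] g[of "\<zero>\<^bsub>B\<^esub>" "\<one>\<^bsub>B\<^esub>"] e unfolding wH by simp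
  moreover have "i \<odot>\<^bsub>E\<^esub> f = \<zero>\<^bsub>E\<^esub>" if i: "i \<in> I" for i
  proof -
    have ic: "i \<in> carrier B" using i I.a_subset by auto
    have iH: "i \<oplus>\<^bsub>B\<^esub> w \<otimes>\<^bsub>B\<^esub> \<zero>\<^bsub>B\<^esub> = i" using ic w by simp
    show ?thesis using hf[OF ic] h(2)[of i] HI[of i "\<zero>\<^bsub>B\<^esub>"] g[of i "\<zero>\<^bsub>B\<^esub>"] i e unfolding iH by simp
  qed
  ultimately show ?thesis using f by blast
qed

lemma (in cring) ideal_adjoin_element:
  assumes I: "ideal I R" and w: "w \<in> carrier R"
  shows "ideal {i \<oplus> w \<otimes> b | i b. i \<in> I \<and> b \<in> carrier R} R"
proof -
  interpret I: ideal I R by fact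
  let ?H = "{i \<oplus> w \<otimes> b | i b. i \<in> I \<and> b \<in> carrier R}"
  have H: "i \<oplus> w \<otimes> b \<in> ?H" if "i \<in> I" "b \<in> carrier R" for i b using that by blast
  show ?thesis
  proof (rule idealI)
    show "ring R" ..
    have l: "a \<otimes> x \<in> ?H" if "x \<in> ?H" and a: "a \<in> carrier R" for a x
    proof -
      obtain i b where ib: "i \<in> I" "b \<in> carrier R" "x = i \<oplus> w \<otimes> b" using \<open>x \<in> ?H\<close> by blast
      have "a \<otimes> x = (a \<otimes> i) \<oplus> w \<otimes> (a \<otimes> b)" using ib w a by (simp add: r_distr m_ac)
      then show ?thesis using H[of "a \<otimes> i" "a \<otimes> b"] ib a I.I_l_closed by simp
    qed
    have carr: "?H \<subseteq> carrier R" using w by auto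
    show "subgroup ?H (add_monoid R)"
    proof
      show "?H \<subseteq> carrier (add_monoid R)" using carr by simp
      show "\<one>\<^bsub>add_monoid R\<^esub> \<in> ?H" using H[OF I.zero_closed zero_closed] w by simp
      show "x \<otimes>\<^bsub>add_monoid R\<^esub> y \<in> ?H" if xy: "x \<in> ?H" "y \<in> ?H" for x y
      proof -
        obtain i b where ib: "i \<in> I" "b \<in> carrier R" "x = i \<oplus> w \<otimes> b" using xy(1) by blast
        obtain j c where jc: "j \<in> I" "c \<in> carrier R" "y = j \<oplus> w \<otimes> c" using xy(2) by blast
        have "x \<oplus> y = (i \<oplus> j) \<oplus> w \<otimes> (b \<oplus> c)" using ib jc w by (simp add: r_distr a_ac)
        then show ?thesis using H[of "i \<oplus> j" "b \<oplus> c"] ib jc by simp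
      qed
      show "inv\<^bsub>add_monoid R\<^esub> x \<in> ?H" if x: "x \<in> ?H" for x
      proof -
        have "(\<ominus> \<one>) \<otimes> x \<in> ?H" using l[OF x] by simp
        moreover have "(\<ominus> \<one>) \<otimes> x = \<ominus> x" using x carr l_minus[of \<one> x] by auto
        ultimately show ?thesis by (simp add: a_inv_def)
      qed
    qed
    fix a x assume a: "a \<in> ?H" and x: "x \<in> carrier R"
    show "x \<otimes> a \<in> ?H" by (rule l[OF a x])
    have "a \<otimes> x = x \<otimes> a" using subsetD[OF carr a] x by (rule m_comm)
    then show "a \<otimes> x \<in> ?H" using l[OF a x] by (simp only:)
  qed
qed

text \<open>In terms of \<open>Ext\<close>: for an injective resolution \<open>E\<close> of \<open>B\<close> and \<open>i > 0\<close> the predicate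
  \<open>ext_vanishes i I\<close> below says that \<open>Ext\<^sup>i(B/I, B) = 0\<close>. It holds for \<open>I = (x)\<close> and \<open>i \<ge> 2\<close>.
  If \<open>Ext\<^sup>i\<^sup>+\<^sup>1(B/(x,z), B) = 0\<close>, then the embedding of the residue field into \<open>B/(x)\<close>
  given by \<open>z\<close> yields \<open>Ext\<^sup>i(B/m, B) = 0\<close>, and \<open>Ext\<^sup>i(B/(x,z), B) = 0\<close> follows along a
  composition series. So \<open>Ext\<^sup>2(B/(x,z), B) = 0\<close>, and then the socle elements \<open>z\<close> and \<open>y\<^sup>2\<close>
  of \<open>B/(x)\<close> would be proportional.\<close>

theorem infinite_self_injective_dim:
  fixes B :: "'a ring" (structure)
  assumes B: "cring B"
    and xyz: "x \<in> carrier B" "y \<in> carrier B" "z \<in> carrier B"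
    and reg: "\<And>a. a \<in> carrier B \<Longrightarrow> x \<otimes> a = \<zero> \<Longrightarrow> a = \<zero>"
    and rel: "\<alpha> \<in> carrier B" "\<beta> \<in> carrier B" "\<gamma> \<in> carrier B"
      "z \<otimes> y = x \<otimes> \<alpha>" "z \<otimes> z = x \<otimes> \<beta>" "y \<otimes> (y \<otimes> y) = x \<otimes> \<gamma>"
    and loc: "\<And>b. b \<in> carrier B \<Longrightarrow> b \<in> Units B \<or>
      (\<exists>p\<in>carrier B. \<exists>q\<in>carrier B. \<exists>r\<in>carrier B. b = x \<otimes> p \<oplus> z \<otimes> q \<oplus> y \<otimes> r)"
    and z: "\<And>p. p \<in> carrier B \<Longrightarrow> z \<noteq> x \<otimes> p"
    and yy: "\<And>p q. p \<in> carrier B \<Longrightarrow> q \<in> carrier B \<Longrightarrow> y \<otimes> y \<noteq> x \<otimes> p \<oplus> z \<otimes> q"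
  shows "\<not> finite_self_injective_dim B"
proof
  interpret B: cring B by fact
  let ?N = "module_via (\<lambda>a. a) B"
  interpret N: module B ?N by (rule B.module_self)
  assume "finite_self_injective_dim B"
  then obtain E :: "nat \<Rightarrow> ('a, nat \<Rightarrow> 'a) module" and \<epsilon> d n where
    res: "injective_resolution B ?N E \<epsilon> d" and fin: "\<And>i. i > n \<Longrightarrow> carrier (E i) = {\<zero>\<^bsub>E i\<^esub>}"
    unfolding finite_self_injective_dim_def by blast
  have inj: "injective_module B (E i)" for i using res by (simp add: injective_resolution_def)
  interpret E: module B "E i" for i using inj[of i] by (simp add: injective_module_def)
  have \<epsilon>: "\<epsilon> \<in> module_homs B ?N (E 0)" "inj_on \<epsilon> (carrier ?N)"
    "\<epsilon> ` carrier ?N = module_kernel (E 0) (E 1) (d 0)" and d: "d i \<in> module_homs B (E i) (E (Suc i))"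
    and ex: "d i ` carrier (E i) = module_kernel (E (Suc i)) (E (Suc (Suc i))) (d (Suc i))" for i
    using res unfolding injective_resolution_def by blast+
  note dc = module_homsD(1)[OF d] and dadd = module_homsD(2)[OF d] and dsm = module_homsD(3)[OF d]
    and dzero = module_hom_zero[OF E.module_axioms E.module_axioms d]
    and dminus = module_hom_minus[OF E.module_axioms E.module_axioms d]
  have dd: "d (Suc i) (d i e) = \<zero>\<^bsub>E (Suc (Suc i))\<^esub>" if "e \<in> carrier (E i)" for i e
    using ex[of i] that by (auto simp: module_kernel_def)
  have ex': "\<exists>f\<in>carrier (E i). d i f = e" if "e \<in> carrier (E (Suc i))" "d (Suc i) e = \<zero>\<^bsub>E (Suc (Suc i))\<^esub>" for i e
  proof -
    have "e \<in> d i ` carrier (E i)" unfolding ex using that by (simp add: module_kernel_def)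
    then show ?thesis by auto
  qed

  \<comment> \<open>The ideals \<open>(x)\<close>, \<open>(x, z)\<close>, \<open>(x, z, y^2)\<close>
    and \<open>(x, z, y)\<close>. The successive quotients of \<open>I1\<close>, \<open>I2\<close>,
    \<open>m\<close> and \<open>B\<close> are copies of the residue field, spanned by
    \<open>y^2\<close>, \<open>y\<close> and 1. The zero in \<open>Ix\<close> gives it the shape of
    \<open>ideal_adjoin_element\<close>.\<close>
  define Ix where "Ix = {\<zero> \<oplus> x \<otimes> b | b. b \<in> carrier B}"
  define I1 where "I1 = {i \<oplus> z \<otimes> b | i b. i \<in> Ix \<and> b \<in> carrier B}"
  define I2 where "I2 = {i \<oplus> (y \<otimes> y) \<otimes> b | i b. i \<in> I1 \<and> b \<in> carrier B}"
  define m where "m = {i \<oplus> y \<otimes> b | i b. i \<in> I2 \<and> b \<in> carrier B}"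
  have iIx: "ideal Ix B" using B.ideal_adjoin_element[OF B.zeroideal xyz(1)] by (simp add: Ix_def)
  have iI1: "ideal I1 B" unfolding I1_def by (rule B.ideal_adjoin_element[OF iIx xyz(3)])
  have iI2: "ideal I2 B" unfolding I2_def using xyz by (intro B.ideal_adjoin_element[OF iI1]) simp
  have im: "ideal m B" unfolding m_def by (rule B.ideal_adjoin_element[OF iI2 xyz(2)])
  have carr: "a \<in> carrier B" if "a \<in> I" "ideal I B" for a I using that ideal.Icarr by metis
  have lcl: "b \<otimes> a \<in> I" if "a \<in> I" "ideal I B" "b \<in> carrier B" for a b I
    using that ideal.I_l_closed by metis
  have rcl: "a \<otimes> b \<in> I" if "a \<in> I" "ideal I B" "b \<in> carrier B" for a b I
    using that ideal.I_r_closed by metis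
  have acl: "a \<oplus> b \<in> I" if "a \<in> I" "b \<in> I" "ideal I B" for a b I
    using that additive_subgroup.a_closed[OF ideal.axioms(1)] by metis
  have zcl: "\<zero> \<in> I" if "ideal I B" for I
    using additive_subgroup.zero_closed[OF ideal.axioms(1)[OF that]] .
  have Ixm: "x \<otimes> b \<in> Ix" if "b \<in> carrier B" for b using that xyz by (auto simp: Ix_def intro!: exI[of _ b])
  have memIx: "\<exists>b\<in>carrier B. a = x \<otimes> b" if "a \<in> Ix" for a using that xyz by (auto simp: Ix_def)
  have adj: "i \<in> {i \<oplus> w \<otimes> b | i b. i \<in> I \<and> b \<in> carrier B}" if "i \<in> I" "ideal I B" "w \<in> carrier B" for i w I
  proof -
    have "i = i \<oplus> w \<otimes> \<zero>" using that carr[of i I] by simp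
    then show ?thesis using that(1) by blast
  qed
  have adj': "w \<in> {i \<oplus> w \<otimes> b | i b. i \<in> I \<and> b \<in> carrier B}" if "ideal I B" "w \<in> carrier B" for w I
  proof -
    have "w = \<zero> \<oplus> w \<otimes> \<one>" using that by simp
    then show ?thesis using zcl[OF that(1)] by blast
  qed
  have sub1: "Ix \<subseteq> I1" unfolding I1_def using adj[OF _ iIx xyz(3)] by blast
  have sub2: "I1 \<subseteq> I2" unfolding I2_def using adj[OF _ iI1 B.m_closed[OF xyz(2,2)]] by blast
  have subm: "I2 \<subseteq> m" unfolding m_def using adj[OF _ iI2 xyz(2)] by blast
  have z1: "z \<in> I1" unfolding I1_def by (rule adj'[OF iIx xyz(3)])
  have yy2: "y \<otimes> y \<in> I2" unfolding I2_def using xyz by (intro adj'[OF iI1]) simp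
  have ym: "y \<in> m" unfolding m_def by (rule adj'[OF iI2 xyz(2)])
  have xm: "x \<in> m" using Ixm[of \<one>] xyz sub1 sub2 subm by auto
  have zm: "z \<in> m" using z1 sub2 subm by auto
  have loc': "b \<in> Units B \<or> b \<in> m" if "b \<in> carrier B" for b
    using loc[OF that] xm zm ym im by (auto intro!: acl rcl)
  have gens: "w \<otimes> b \<in> I" if b: "b \<in> m" and w: "w \<in> carrier B" and I: "ideal I B"
      and "w \<otimes> x \<in> I" "w \<otimes> z \<in> I" "w \<otimes> y \<in> I" for w b I
  proof -
    obtain i1 b1 b2 b3 where b1: "i1 \<in> Ix" "b1 \<in> carrier B" "b2 \<in> carrier B" "b3 \<in> carrier B"
      and b: "b = ((i1 \<oplus> z \<otimes> b1) \<oplus> (y \<otimes> y) \<otimes> b2) \<oplus> y \<otimes> b3"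
      using b unfolding m_def I2_def I1_def by blast
    obtain b0 where b0: "b0 \<in> carrier B" "i1 = x \<otimes> b0" using memIx[OF b1(1)] by blast
    have "w \<otimes> b = (((w \<otimes> x) \<otimes> b0 \<oplus> (w \<otimes> z) \<otimes> b1) \<oplus> (w \<otimes> y) \<otimes> (y \<otimes> b2)) \<oplus> (w \<otimes> y) \<otimes> b3"
      using b1 b0 w xyz unfolding b by (simp add: B.r_distr B.m_assoc)
    also have "\<dots> \<in> I"
    proof -
      have "(w \<otimes> x) \<otimes> b0 \<in> I" "(w \<otimes> z) \<otimes> b1 \<in> I" "(w \<otimes> y) \<otimes> (y \<otimes> b2) \<in> I" "(w \<otimes> y) \<otimes> b3 \<in> I"
        using rcl[OF that(4) I b0(1)] rcl[OF that(5) I b1(2)] rcl[OF that(6) I, of "y \<otimes> b2"]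
          rcl[OF that(6) I b1(4)] b1(3) xyz(2) by simp_all
      then show ?thesis using acl[OF acl[OF acl[OF _ _ I] _ I] _ I] by simp
    qed
    finally show ?thesis .
  qed
  \<comment> \<open>With the converses \<open>zcol'\<close>, \<open>yycol'\<close> and
    \<open>ycol'\<close> below, the colon ideals \<open>Ix : z\<close>, \<open>I1 : y^2\<close> and
    \<open>I2 : y\<close> all equal \<open>m\<close>; so each of these elements spans a copy of the
    residue field in its quotient.\<close>
  have zcol: "z \<otimes> b \<in> Ix" if "b \<in> m" for b
  proof (rule gens[OF that xyz(3) iIx])
    show "z \<otimes> x \<in> Ix" using Ixm[OF xyz(3)] xyz B.m_comm[of z x] by simp
  qed (use Ixm rel in simp_all)
  have yycol: "(y \<otimes> y) \<otimes> b \<in> I1" if "b \<in> m" for b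
  proof (rule gens[OF that _ iI1])
    have eq: "(y \<otimes> y) \<otimes> x = x \<otimes> (y \<otimes> y)" "(y \<otimes> y) \<otimes> z = x \<otimes> (y \<otimes> \<alpha>)" "(y \<otimes> y) \<otimes> y = x \<otimes> \<gamma>"
    proof -
      show "(y \<otimes> y) \<otimes> x = x \<otimes> (y \<otimes> y)" using xyz by (simp add: B.m_comm)
      have "(y \<otimes> y) \<otimes> z = y \<otimes> (z \<otimes> y)" using xyz by (simp add: B.m_ac)
      then show "(y \<otimes> y) \<otimes> z = x \<otimes> (y \<otimes> \<alpha>)" using xyz rel B.m_lcomm by simp
      show "(y \<otimes> y) \<otimes> y = x \<otimes> \<gamma>" using xyz rel by (simp add: B.m_assoc)
    qed
    show "(y \<otimes> y) \<otimes> x \<in> I1" unfolding eq(1) by (intro subsetD[OF sub1] Ixm) (use xyz in simp)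
    show "(y \<otimes> y) \<otimes> z \<in> I1" unfolding eq(2) by (intro subsetD[OF sub1] Ixm) (use xyz rel in simp)
    show "(y \<otimes> y) \<otimes> y \<in> I1" unfolding eq(3) by (intro subsetD[OF sub1] Ixm rel)
  qed (use xyz in simp)
  have ycol: "y \<otimes> b \<in> I2" if "b \<in> m" for b
  proof (rule gens[OF that xyz(2) iI2])
    show "y \<otimes> x \<in> I2" using Ixm[OF xyz(2)] sub1 sub2 B.m_comm[of x y] xyz by auto
    show "y \<otimes> z \<in> I2" using rcl[OF z1 iI1 xyz(2)] sub2 B.m_comm[of y z] xyz by auto
  qed (rule yy2)
  have yynot: "y \<otimes> y \<notin> I1"
  proof
    assume "y \<otimes> y \<in> I1"
    then obtain i b where "i \<in> Ix" "b \<in> carrier B" "y \<otimes> y = i \<oplus> z \<otimes> b" unfolding I1_def by blast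
    then show False using memIx[of i] yy by metis
  qed
  have unit_elim: "w \<in> I" if "w \<otimes> b \<in> I" "b \<in> Units B" "w \<in> carrier B" "ideal I B" for w b I
  proof -
    have "(w \<otimes> b) \<otimes> inv b \<in> I" by (rule rcl[OF that(1,4) B.Units_inv_closed[OF that(2)]])
    moreover have "(w \<otimes> b) \<otimes> inv b = w" using that B.Units_closed by (simp add: B.m_assoc)
    ultimately show ?thesis by simp
  qed
  have zcol': "b \<in> m" if "z \<otimes> b \<in> Ix" "b \<in> carrier B" for b
  proof (rule ccontr)
    assume "b \<notin> m"
    then have "z \<in> Ix" using loc'[OF that(2)] unit_elim[OF that(1)] xyz iIx by blast
    then show False using memIx z by blast
  qed
  have yycol': "b \<in> m" if "(y \<otimes> y) \<otimes> b \<in> I1" "b \<in> carrier B" for b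
    using loc'[OF that(2)] unit_elim[OF that(1) _ _ iI1] yynot xyz by auto
  have ycol': "b \<in> m" if "y \<otimes> b \<in> I2" "b \<in> carrier B" for b
  proof (rule ccontr)
    assume "b \<notin> m"
    then have "y \<in> I2" using loc'[OF that(2)] unit_elim[OF that(1)] xyz iI2 by blast
    then obtain i c where ic: "i \<in> I1" "c \<in> carrier B" "y = i \<oplus> (y \<otimes> y) \<otimes> c" unfolding I2_def by blast
    \<comment> \<open>Multiplication by \<open>y\<close> brings in \<open>y^3\<close>, a multiple of
      \<open>x\<close>, and so would put \<open>y^2\<close> into \<open>I1\<close>.\<close>
    have "y \<otimes> y = y \<otimes> (i \<oplus> (y \<otimes> y) \<otimes> c)" using ic(3) by simp
    also have "\<dots> = y \<otimes> i \<oplus> (y \<otimes> (y \<otimes> y)) \<otimes> c"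
      using ic(2) xyz carr[OF ic(1) iI1] by (simp add: B.r_distr B.m_assoc)
    also have "\<dots> \<in> I1"
    proof -
      have "y \<otimes> (y \<otimes> y) \<in> I1" unfolding rel(6) by (rule subsetD[OF sub1 Ixm[OF rel(3)]])
      from acl[OF lcl[OF ic(1) iI1 xyz(2)] rcl[OF this iI1 ic(2)] iI1] show ?thesis .
    qed
    finally show False using yynot by simp
  qed

  define kills where "kills i I e \<longleftrightarrow> (\<forall>a\<in>I. a \<odot>\<^bsub>E i\<^esub> e = \<zero>\<^bsub>E i\<^esub>)" for i I e
  \<comment> \<open>A homomorphism from \<open>B/I\<close> to \<open>E i\<close> is an element
    killed by \<open>I\<close>. The condition is exactness at \<open>E (Suc i)\<close>, so
    \<open>ext_vanishes i I\<close> is the vanishing of Ext in degree \<open>Suc i\<close>: the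
    argument is one below the degree.\<close>
  define ext_vanishes where "ext_vanishes i I \<longleftrightarrow> (\<forall>e\<in>carrier (E (Suc i)). d (Suc i) e = \<zero>\<^bsub>E (Suc (Suc i))\<^esub> \<longrightarrow>
    kills (Suc i) I e \<longrightarrow> (\<exists>f\<in>carrier (E i). d i f = e \<and> kills i I f))" for i I
  have kills_d: "kills (Suc i) I (d i e)" if "kills i I e" "e \<in> carrier (E i)" "I \<subseteq> carrier B" for i I e
    using that dsm[of _ e i] dzero[of i] unfolding kills_def by (metis subsetD)
  have kills_minus: "kills i I (e \<ominus>\<^bsub>E i\<^esub> f)"
    if "kills i I e" "kills i I f" "e \<in> carrier (E i)" "f \<in> carrier (E i)" "I \<subseteq> carrier B" for i I e f
    unfolding kills_def
  proof
    fix a assume a: "a \<in> I"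
    then have "a \<in> carrier B" using that(5) by blast
    then show "a \<odot>\<^bsub>E i\<^esub> (e \<ominus>\<^bsub>E i\<^esub> f) = \<zero>\<^bsub>E i\<^esub>"
      using that a unfolding kills_def by (simp add: E.smult_minus E.minus_zero_right)
  qed
  have kills_smult: "kills i J (w \<odot>\<^bsub>E i\<^esub> e)"
    if "kills i I e" "e \<in> carrier (E i)" "w \<in> carrier B" "J \<subseteq> carrier B" "\<And>b. b \<in> J \<Longrightarrow> w \<otimes> b \<in> I" for i I J e w
    unfolding kills_def
  proof
    fix b assume b: "b \<in> J"
    then have bc: "b \<in> carrier B" using that(4) by blast
    have "b \<odot>\<^bsub>E i\<^esub> (w \<odot>\<^bsub>E i\<^esub> e) = (w \<otimes> b) \<odot>\<^bsub>E i\<^esub> e"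
      using that(2,3) bc by (simp add: E.smult_assoc1 E.smult_commute)
    then show "b \<odot>\<^bsub>E i\<^esub> (w \<odot>\<^bsub>E i\<^esub> e) = \<zero>\<^bsub>E i\<^esub>" using that(1) that(5)[OF b] unfolding kills_def by simp
  qed
  have divide: "\<exists>f\<in>carrier (E i). w \<odot>\<^bsub>E i\<^esub> f = e \<and> kills i I f"
    if "ideal I B" "w \<in> carrier B" "e \<in> carrier (E i)" "kills i m e" "\<And>b. b \<in> carrier B \<Longrightarrow> w \<otimes> b \<in> I \<Longrightarrow> b \<in> m" for i w e I
    unfolding kills_def
    by (rule injective_divide[OF B inj that(1-3)]) (use that(4,5) in \<open>simp add: kills_def\<close>)
  have divide_x: "\<exists>f\<in>carrier (E i). x \<odot>\<^bsub>E i\<^esub> f = e" if "e \<in> carrier (E i)" for i e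
  proof -
    have "b \<odot>\<^bsub>E i\<^esub> e = \<zero>\<^bsub>E i\<^esub>" if "b \<in> carrier B" "x \<otimes> b \<in> {\<zero>}" for b
      using reg[OF that(1)] that(2) \<open>e \<in> carrier (E i)\<close> by simp
    from injective_divide[OF B inj B.zeroideal xyz(1) that this] show ?thesis by blast
  qed
  have subc: "I1 \<subseteq> carrier B" "Ix \<subseteq> carrier B" "I2 \<subseteq> carrier B" "m \<subseteq> carrier B"
    using carr iI1 iIx iI2 im by blast+

  \<comment> \<open>Multiplication by \<open>x\<close> is a free resolution of \<open>B/(x)\<close>
    of length 1, so Ext vanishes from degree 2 on. On elements: a primitive \<open>e1\<close> of
    \<open>e\<close> is changed by a boundary until \<open>x\<close> kills it, which is possible as
    \<open>E i\<close> is divisible by \<open>x\<close>.\<close>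
  have vanish_x: "ext_vanishes (Suc i) Ix" for i
    unfolding ext_vanishes_def
  proof (intro ballI impI)
    fix e assume e: "e \<in> carrier (E (Suc (Suc i)))" "d (Suc (Suc i)) e = \<zero>\<^bsub>E (Suc (Suc (Suc i)))\<^esub>" "kills (Suc (Suc i)) Ix e"
    then obtain e1 where e1: "e1 \<in> carrier (E (Suc i))" "d (Suc i) e1 = e" using ex' by blast
    have "x \<odot>\<^bsub>E (Suc (Suc i))\<^esub> e = \<zero>\<^bsub>E (Suc (Suc i))\<^esub>" using e(3) Ixm[of \<one>] xyz by (simp add: kills_def)
    then have "d (Suc i) (x \<odot>\<^bsub>E (Suc i)\<^esub> e1) = \<zero>\<^bsub>E (Suc (Suc i))\<^esub>" using dsm[OF xyz(1) e1(1)] e1 by simp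
    then obtain e2 where e2: "e2 \<in> carrier (E i)" "d i e2 = x \<odot>\<^bsub>E (Suc i)\<^esub> e1" using ex'[of "x \<odot>\<^bsub>E (Suc i)\<^esub> e1" i] e1 xyz by blast
    obtain e3 where e3: "e3 \<in> carrier (E i)" "x \<odot>\<^bsub>E i\<^esub> e3 = e2" using divide_x[OF e2(1)] by blast
    let ?f = "e1 \<ominus>\<^bsub>E (Suc i)\<^esub> d i e3"
    have fc: "?f \<in> carrier (E (Suc i))" using e1 dc[OF e3(1)] by simp
    have "x \<odot>\<^bsub>E (Suc i)\<^esub> ?f = x \<odot>\<^bsub>E (Suc i)\<^esub> e1 \<ominus>\<^bsub>E (Suc i)\<^esub> d i (x \<odot>\<^bsub>E i\<^esub> e3)"
      using e1 dc[OF e3(1)] xyz dsm[OF xyz(1) e3(1)] by (simp add: E.smult_minus)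
    also have "\<dots> = \<zero>\<^bsub>E (Suc i)\<^esub>" using e3 e2 e1 xyz by (simp add: E.minus_eq_zero)
    finally have xf: "x \<odot>\<^bsub>E (Suc i)\<^esub> ?f = \<zero>\<^bsub>E (Suc i)\<^esub>" .
    have "kills (Suc i) Ix ?f" unfolding kills_def
    proof
      fix a assume "a \<in> Ix"
      then obtain b where b: "b \<in> carrier B" "a = x \<otimes> b" using memIx by blast
      then have "a \<odot>\<^bsub>E (Suc i)\<^esub> ?f = b \<odot>\<^bsub>E (Suc i)\<^esub> (x \<odot>\<^bsub>E (Suc i)\<^esub> ?f)"
        using fc xyz by (simp only: E.smult_assoc1 E.smult_commute[of x b])
      then show "a \<odot>\<^bsub>E (Suc i)\<^esub> ?f = \<zero>\<^bsub>E (Suc i)\<^esub>" using xf b by simp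
    qed
    moreover have "d (Suc i) ?f = e"
      using e1 e dc[OF e3(1)] dd[OF e3(1)] by (simp add: dminus E.minus_zero_right)
    ultimately show "\<exists>f\<in>carrier (E (Suc i)). d (Suc i) f = e \<and> kills (Suc i) Ix f" using fc by blast
  qed

  \<comment> \<open>The exact sequence of Ext for
    \<open>B/m \<rightarrow> B/I \<rightarrow> B/J\<close>, the first map being multiplication by
    \<open>w\<close>. Vanishing for the outer modules gives vanishing for
    \<open>B/I\<close>.\<close>
  have lift: "ext_vanishes i I"
    if w: "w \<in> carrier B" and I: "ideal I B" and col: "\<And>b. b \<in> m \<Longrightarrow> w \<otimes> b \<in> I"
      and col': "\<And>b. b \<in> carrier B \<Longrightarrow> w \<otimes> b \<in> I \<Longrightarrow> b \<in> m"
      and J: "J = {a \<oplus> w \<otimes> b | a b. a \<in> I \<and> b \<in> carrier B}" and vm: "ext_vanishes i m" and vJ: "ext_vanishes i J"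
    for i I J w
    unfolding ext_vanishes_def
  proof (intro ballI impI)
    have Ic: "I \<subseteq> carrier B" using carr[OF _ I] by blast
    have IJ: "I \<subseteq> J" unfolding J using adj[OF _ I w] by blast
    fix e assume e: "e \<in> carrier (E (Suc i))" "d (Suc i) e = \<zero>\<^bsub>E (Suc (Suc i))\<^esub>" "kills (Suc i) I e"
    have "kills (Suc i) m (w \<odot>\<^bsub>E (Suc i)\<^esub> e)" by (rule kills_smult[OF e(3,1) w subc(4) col])
    moreover have "d (Suc i) (w \<odot>\<^bsub>E (Suc i)\<^esub> e) = \<zero>\<^bsub>E (Suc (Suc i))\<^esub>" using dsm[OF w e(1)] e w by simp
    ultimately obtain h where h: "h \<in> carrier (E i)" "d i h = w \<odot>\<^bsub>E (Suc i)\<^esub> e" "kills i m h"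
      using vm e(1) w unfolding ext_vanishes_def by (meson E.smult_closed)
    obtain f where f: "f \<in> carrier (E i)" "w \<odot>\<^bsub>E i\<^esub> f = h" "kills i I f"
      using divide[OF I w h(1,3) col'] by blast
    let ?e = "e \<ominus>\<^bsub>E (Suc i)\<^esub> d i f"
    note df = dc[OF f(1)]
    have ec: "?e \<in> carrier (E (Suc i))" using e df by simp
    have kI: "kills (Suc i) I ?e" by (rule kills_minus[OF e(3) kills_d[OF f(3,1) Ic] e(1) df Ic])
    have "w \<odot>\<^bsub>E (Suc i)\<^esub> ?e = w \<odot>\<^bsub>E (Suc i)\<^esub> e \<ominus>\<^bsub>E (Suc i)\<^esub> d i h"
      using e df w f dsm[OF w f(1)] by (simp add: E.smult_minus)
    also have "\<dots> = \<zero>\<^bsub>E (Suc i)\<^esub>" using h e w by (simp add: E.minus_eq_zero)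
    finally have wk: "w \<odot>\<^bsub>E (Suc i)\<^esub> ?e = \<zero>\<^bsub>E (Suc i)\<^esub>" .
    have "kills (Suc i) J ?e" unfolding kills_def
    proof
      fix j assume "j \<in> J"
      then obtain a b where ab: "a \<in> I" "b \<in> carrier B" "j = a \<oplus> w \<otimes> b" unfolding J by blast
      have "(w \<otimes> b) \<odot>\<^bsub>E (Suc i)\<^esub> ?e = b \<odot>\<^bsub>E (Suc i)\<^esub> (w \<odot>\<^bsub>E (Suc i)\<^esub> ?e)"
        using ec w ab by (simp only: E.smult_assoc1 E.smult_commute[of w b])
      then show "j \<odot>\<^bsub>E (Suc i)\<^esub> ?e = \<zero>\<^bsub>E (Suc i)\<^esub>"
        using kI ab ec w wk Ic unfolding kills_def by (auto simp: E.smult_l_distr subset_iff)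
    qed
    moreover have "d (Suc i) ?e = \<zero>\<^bsub>E (Suc (Suc i))\<^esub>"
      using e df dd[OF f(1)] by (simp add: dminus E.minus_zero_right)
    ultimately obtain f' where f': "f' \<in> carrier (E i)" "d i f' = ?e" "kills i J f'"
      using vJ ec unfolding ext_vanishes_def by blast
    have "d i (f \<oplus>\<^bsub>E i\<^esub> f') = d i f \<oplus>\<^bsub>E (Suc i)\<^esub> (e \<ominus>\<^bsub>E (Suc i)\<^esub> d i f)" using f f' dadd by simp
    also have "\<dots> = e" using e df by (simp add: a_minus_def E.M.a_ac E.M.r_neg E.M.r_neg1 E.M.r_neg2)
    finally have "d i (f \<oplus>\<^bsub>E i\<^esub> f') = e" .
    moreover have "kills i I (f \<oplus>\<^bsub>E i\<^esub> f')"
      using f f' IJ Ic unfolding kills_def by (auto simp: E.smult_r_distr subset_iff)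
    ultimately show "\<exists>f\<in>carrier (E i). d i f = e \<and> kills i I f" using f f' by blast
  qed

  \<comment> \<open>Multiplication by \<open>z\<close> embeds \<open>B/m\<close> into
    \<open>B/(x)\<close> with quotient \<open>B/(x, z)\<close>. In the sequence of Ext the term of
    \<open>B/m\<close> stands between that of \<open>B/(x)\<close>, zero by \<open>vanish_x\<close>,
    and the term of \<open>B/(x, z)\<close> one degree higher.\<close>
  have vanish_m: "ext_vanishes (Suc i) m" if v: "ext_vanishes (Suc (Suc i)) I1" for i
    unfolding ext_vanishes_def
  proof (intro ballI impI)
    let ?i = "Suc (Suc i)"
    fix e assume e: "e \<in> carrier (E ?i)" "d ?i e = \<zero>\<^bsub>E (Suc ?i)\<^esub>" "kills ?i m e"
    obtain f where f: "f \<in> carrier (E ?i)" "z \<odot>\<^bsub>E ?i\<^esub> f = e" "kills ?i Ix f"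
      using divide[OF iIx xyz(3) e(1,3) zcol'] by blast
    note df = dc[OF f(1)]
    have zk: "z \<odot>\<^bsub>E (Suc ?i)\<^esub> d ?i f = \<zero>\<^bsub>E (Suc ?i)\<^esub>" using dsm[OF xyz(3) f(1)] f e by simp
    have kx: "kills (Suc ?i) Ix (d ?i f)" by (rule kills_d[OF f(3,1) subc(2)])
    have "kills (Suc ?i) I1 (d ?i f)" unfolding kills_def
    proof
      fix j assume "j \<in> I1"
      then obtain a b where ab: "a \<in> Ix" "b \<in> carrier B" "j = a \<oplus> z \<otimes> b" unfolding I1_def by blast
      have "(z \<otimes> b) \<odot>\<^bsub>E (Suc ?i)\<^esub> d ?i f = b \<odot>\<^bsub>E (Suc ?i)\<^esub> (z \<odot>\<^bsub>E (Suc ?i)\<^esub> d ?i f)"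
        using df xyz ab by (simp only: E.smult_assoc1 E.smult_commute[of z b])
      then show "j \<odot>\<^bsub>E (Suc ?i)\<^esub> d ?i f = \<zero>\<^bsub>E (Suc ?i)\<^esub>"
        using kx ab df xyz zk subc unfolding kills_def by (auto simp: E.smult_l_distr subset_iff)
    qed
    then obtain f' where f': "f' \<in> carrier (E ?i)" "d ?i f' = d ?i f" "kills ?i I1 f'"
      using v df dd[OF f(1)] unfolding ext_vanishes_def by blast
    let ?g = "f \<ominus>\<^bsub>E ?i\<^esub> f'"
    have gc: "?g \<in> carrier (E ?i)" using f f' by simp
    have dg: "d ?i ?g = \<zero>\<^bsub>E (Suc ?i)\<^esub>" using f f' df by (simp add: dminus E.minus_eq_zero)
    have "kills ?i Ix f'" using f' sub1 unfolding kills_def by blast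
    then have "kills ?i Ix ?g" by (rule kills_minus[OF f(3) _ f(1) f'(1) subc(2)])
    then obtain h where h: "h \<in> carrier (E (Suc i))" "d (Suc i) h = ?g" "kills (Suc i) Ix h"
      using vanish_x[of i] gc dg unfolding ext_vanishes_def by blast
    have "d (Suc i) (z \<odot>\<^bsub>E (Suc i)\<^esub> h) = z \<odot>\<^bsub>E ?i\<^esub> f \<ominus>\<^bsub>E ?i\<^esub> z \<odot>\<^bsub>E ?i\<^esub> f'"
      using dsm[OF xyz(3) h(1)] h f f' xyz by (simp add: E.smult_minus)
    also have "\<dots> = e" using f e f' z1 by (simp add: kills_def E.minus_zero_right)
    finally have "d (Suc i) (z \<odot>\<^bsub>E (Suc i)\<^esub> h) = e" .
    moreover have "kills (Suc i) m (z \<odot>\<^bsub>E (Suc i)\<^esub> h)" by (rule kills_smult[OF h(3,1) xyz(3) subc(4) zcol])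
    ultimately show "\<exists>f\<in>carrier (E (Suc i)). d (Suc i) f = e \<and> kills (Suc i) m f"
      using E.smult_closed[OF xyz(3) h(1)] by blast
  qed

  \<comment> \<open>Along the composition series: first \<open>m\<close>, then \<open>I2\<close>
    with the factor \<open>y\<close>, then \<open>I1\<close> with the factor \<open>y^2\<close>. The
    degree has dropped by one.\<close>
  have step: "ext_vanishes (Suc i) I1" if v: "ext_vanishes (Suc (Suc i)) I1" for i
  proof -
    have vm: "ext_vanishes (Suc i) m" by (rule vanish_m[OF v])
    have v2: "ext_vanishes (Suc i) I2" by (rule lift[OF xyz(2) iI2 ycol ycol' m_def vm vm])
    show ?thesis by (rule lift[OF _ iI1 yycol yycol' I2_def vm v2]) (use xyz in simp)
  qed
  have top: "ext_vanishes (Suc (n + k)) I1" for k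
    unfolding ext_vanishes_def
  proof (intro ballI impI)
    fix e assume "e \<in> carrier (E (Suc (Suc (n + k))))"
    then have "e = \<zero>\<^bsub>E (Suc (Suc (n + k)))\<^esub>" using fin[of "Suc (Suc (n + k))"] by auto
    then have "d (Suc (n + k)) \<zero>\<^bsub>E (Suc (n + k))\<^esub> = e" using dzero by simp
    moreover have "kills (Suc (n + k)) I1 \<zero>\<^bsub>E (Suc (n + k))\<^esub>" using subc unfolding kills_def by (auto simp: subset_iff)
    ultimately show "\<exists>f\<in>carrier (E (Suc (n + k))). d (Suc (n + k)) f = e \<and> kills (Suc (n + k)) I1 f" by blast
  qed
  \<comment> \<open>Descending induction; truncated subtraction stops the index at 0 once
    \<open>k\<close> reaches \<open>n\<close>.\<close>
  have "ext_vanishes (Suc (n - k)) I1" for k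
  proof (induction k)
    case 0
    then show ?case using top[of 0] by simp
  next
    case (Suc k)
    show ?case
    proof (cases "k < n")
      case True
      then have "n - k = Suc (n - Suc k)" by simp
      then show ?thesis using Suc.IH step by simp
    next
      case False
      then have "n - Suc k = n - k" by simp
      then show ?thesis using Suc.IH by simp
    qed
  qed
  from this[of n] have v1: "ext_vanishes (Suc 0) I1" by simp

  have \<epsilon>c: "\<epsilon> a \<in> carrier (E 0)" and \<epsilon>sm: "a \<odot>\<^bsub>E 0\<^esub> \<epsilon> b = \<epsilon> (a \<otimes> b)" if "a \<in> carrier B" "b \<in> carrier B" for a b
    using module_homsD(1)[OF \<epsilon>(1), of a] module_homsD(3)[OF \<epsilon>(1), of a b] that by simp_all
  have d\<epsilon>: "d 0 (\<epsilon> a) = \<zero>\<^bsub>E 1\<^esub>" if "a \<in> carrier B" for a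
    using \<epsilon>(3) that by (auto simp: module_kernel_def)
  have \<epsilon>ex: "\<exists>a\<in>carrier B. e = \<epsilon> a" if "e \<in> carrier (E 0)" "d 0 e = \<zero>\<^bsub>E 1\<^esub>" for e
  proof -
    have "e \<in> \<epsilon> ` carrier ?N" unfolding \<epsilon>(3) using that by (simp add: module_kernel_def)
    then show ?thesis by auto
  qed
  \<comment> \<open>\<open>e1\<close> plays the role of \<open>1/x\<close>. Its boundary
    \<open>v\<close> represents a generator of Ext of \<open>B/(x)\<close> in degree 1, which is
    \<open>B/(x)\<close> again.\<close>
  obtain e1 where e1: "e1 \<in> carrier (E 0)" "x \<odot>\<^bsub>E 0\<^esub> e1 = \<epsilon> \<one>" using divide_x[OF \<epsilon>c[of \<one>]] by blast
  define v where "v = d 0 e1"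
  have vc: "v \<in> carrier (E 1)" using dc[OF e1(1)] by (simp add: v_def)
  have xv: "x \<odot>\<^bsub>E 1\<^esub> v = \<zero>\<^bsub>E 1\<^esub>" using dsm[OF xyz(1) e1(1)] d\<epsilon>[of \<one>] e1 by (simp add: v_def)
  have kv: "kills 1 Ix v" unfolding kills_def
  proof
    fix a assume "a \<in> Ix"
    then obtain b where b: "b \<in> carrier B" "a = x \<otimes> b" using memIx by blast
    then have "a \<odot>\<^bsub>E 1\<^esub> v = b \<odot>\<^bsub>E 1\<^esub> (x \<odot>\<^bsub>E 1\<^esub> v)"
      using vc xyz by (simp only: E.smult_assoc1 E.smult_commute[of x b])
    then show "a \<odot>\<^bsub>E 1\<^esub> v = \<zero>\<^bsub>E 1\<^esub>" using xv b by simp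
  qed
  have yyIx: "(y \<otimes> y) \<otimes> b \<in> Ix" if "b \<in> m" for b
  proof (rule gens[OF that _ iIx])
    show "(y \<otimes> y) \<otimes> x \<in> Ix" using Ixm[of "y \<otimes> y"] xyz B.m_comm[of x "y \<otimes> y"] by simp
    have "(y \<otimes> y) \<otimes> z = x \<otimes> (y \<otimes> \<alpha>)"
    proof -
      have "(y \<otimes> y) \<otimes> z = y \<otimes> (z \<otimes> y)" using xyz by (simp add: B.m_ac)
      then show ?thesis using xyz rel B.m_lcomm by simp
    qed
    then show "(y \<otimes> y) \<otimes> z \<in> Ix" using Ixm xyz rel by simp
    show "(y \<otimes> y) \<otimes> y \<in> Ix" using Ixm xyz rel by (simp add: B.m_assoc)
  qed (use xyz in simp)
  have yyc: "y \<otimes> y \<in> carrier B" using xyz by simp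
  \<comment> \<open>\<open>y^2 v\<close> is killed by \<open>m\<close>, hence a map on
    \<open>B/m\<close>. Along the embedding by \<open>z\<close> it extends to \<open>f\<close> on
    \<open>B/(x)\<close>, and the vanishing for \<open>B/(x, z)\<close> allows \<open>f\<close> to
    be corrected to the cocycle \<open>f - f'\<close>. So \<open>y^2 v\<close> is \<open>z\<close>
    times a class of degree 1.\<close>
  let ?u = "(y \<otimes> y) \<odot>\<^bsub>E 1\<^esub> v"
  have "kills 1 m ?u" by (rule kills_smult[OF kv vc yyc subc(4) yyIx])
  then obtain f where f: "f \<in> carrier (E 1)" "z \<odot>\<^bsub>E 1\<^esub> f = ?u" "kills 1 Ix f"
    using divide[OF iIx xyz(3) _ _ zcol', of ?u 1] vc yyc by blast
  note df = dc[OF f(1)]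
  have zk: "z \<odot>\<^bsub>E (Suc 1)\<^esub> d 1 f = \<zero>\<^bsub>E (Suc 1)\<^esub>"
    using dsm[OF xyz(3) f(1)] f(2) dsm[OF yyc vc] dd[OF e1(1)] yyc by (simp add: v_def)
  have kx: "kills (Suc 1) Ix (d 1 f)" by (rule kills_d[OF f(3,1) subc(2)])
  have "kills (Suc 1) I1 (d 1 f)" unfolding kills_def
  proof
    fix j assume "j \<in> I1"
    then obtain a b where ab: "a \<in> Ix" "b \<in> carrier B" "j = a \<oplus> z \<otimes> b" unfolding I1_def by blast
    have "(z \<otimes> b) \<odot>\<^bsub>E (Suc 1)\<^esub> d 1 f = b \<odot>\<^bsub>E (Suc 1)\<^esub> (z \<odot>\<^bsub>E (Suc 1)\<^esub> d 1 f)"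
      using df xyz ab by (simp only: E.smult_assoc1 E.smult_commute[of z b])
    then show "j \<odot>\<^bsub>E (Suc 1)\<^esub> d 1 f = \<zero>\<^bsub>E (Suc 1)\<^esub>"
      using kx ab df xyz zk subc unfolding kills_def by (auto simp: E.smult_l_distr subset_iff)
  qed
  then obtain f' where f': "f' \<in> carrier (E 1)" "d 1 f' = d 1 f" "kills 1 I1 f'"
    using v1 df dd[OF f(1)] unfolding ext_vanishes_def One_nat_def by blast
  let ?g = "f \<ominus>\<^bsub>E 1\<^esub> f'"
  have gc: "?g \<in> carrier (E 1)" using f f' by simp
  have dg: "d 1 ?g = \<zero>\<^bsub>E (Suc 1)\<^esub>" using f f' df by (simp add: dminus E.minus_eq_zero)
  have xIx: "x \<in> Ix" using Ixm[of \<one>] xyz by simp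
  have xg: "x \<odot>\<^bsub>E 1\<^esub> ?g = \<zero>\<^bsub>E 1\<^esub>"
    using f f' xIx sub1 xyz by (auto simp: kills_def E.smult_minus E.minus_zero_right)
  have zg: "z \<odot>\<^bsub>E 1\<^esub> ?g = ?u"
    using f f' z1 xyz vc by (simp add: kills_def E.smult_minus E.minus_zero_right)
  \<comment> \<open>The class of \<open>?g\<close> is that of \<open>b v\<close>, where
    \<open>x h = \<epsilon> b\<close>. Then \<open>?k\<close> comes from some \<open>c\<close> in
    the ring, and multiplying by \<open>x\<close> gives the forbidden relation
    \<open>y^2 = x c + z b\<close>.\<close>
  obtain h where h: "h \<in> carrier (E 0)" "d 0 h = ?g" using ex'[of ?g 0] gc dg by auto
  have "d 0 (x \<odot>\<^bsub>E 0\<^esub> h) = \<zero>\<^bsub>E 1\<^esub>" using dsm[OF xyz(1) h(1)] h xg by simp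
  then obtain b where b: "b \<in> carrier B" "x \<odot>\<^bsub>E 0\<^esub> h = \<epsilon> b" using \<epsilon>ex[of "x \<odot>\<^bsub>E 0\<^esub> h"] h xyz by auto
  let ?k = "(y \<otimes> y) \<odot>\<^bsub>E 0\<^esub> e1 \<ominus>\<^bsub>E 0\<^esub> z \<odot>\<^bsub>E 0\<^esub> h"
  have kc: "?k \<in> carrier (E 0)" using yyc e1 xyz h by simp
  have "d 0 ?k = ?u \<ominus>\<^bsub>E 1\<^esub> z \<odot>\<^bsub>E 1\<^esub> ?g"
    using dminus[of "(y \<otimes> y) \<odot>\<^bsub>E 0\<^esub> e1" 0 "z \<odot>\<^bsub>E 0\<^esub> h"] dsm[OF yyc e1(1)] dsm[OF xyz(3) h(1)] e1 h yyc xyz by (simp add: v_def)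
  also have "\<dots> = \<zero>\<^bsub>E 1\<^esub>" unfolding zg using vc yyc by (simp add: E.minus_eq_zero)
  finally obtain c where c: "c \<in> carrier B" "?k = \<epsilon> c" using \<epsilon>ex[OF kc] by blast
  have "\<epsilon> (x \<otimes> c) = x \<odot>\<^bsub>E 0\<^esub> ?k" using \<epsilon>sm[OF xyz(1) c(1)] c by simp
  also have "\<dots> = (y \<otimes> y) \<odot>\<^bsub>E 0\<^esub> (x \<odot>\<^bsub>E 0\<^esub> e1) \<ominus>\<^bsub>E 0\<^esub> z \<odot>\<^bsub>E 0\<^esub> (x \<odot>\<^bsub>E 0\<^esub> h)"
    using xyz yyc e1 h by (simp only: E.smult_minus E.smult_closed E.smult_commute[of x])
  also have "\<dots> = \<epsilon> (y \<otimes> y) \<ominus>\<^bsub>E 0\<^esub> \<epsilon> (z \<otimes> b)"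
    using e1 b \<epsilon>sm[OF yyc, of \<one>] \<epsilon>sm[OF xyz(3) b(1)] yyc by simp
  also have "\<dots> = \<epsilon> (y \<otimes> y \<ominus>\<^bsub>?N\<^esub> z \<otimes> b)"
    using module_hom_minus[OF N.module_axioms E.module_axioms \<epsilon>(1), of "y \<otimes> y" "z \<otimes> b"] yyc xyz b by simp
  finally have "x \<otimes> c = y \<otimes> y \<ominus>\<^bsub>?N\<^esub> z \<otimes> b"
    using inj_onD[OF \<epsilon>(2)] xyz c yyc b N.minus_closed[of "y \<otimes> y" "z \<otimes> b"] by simp
  then have "x \<otimes> c \<oplus>\<^bsub>?N\<^esub> z \<otimes> b = (y \<otimes> y \<oplus>\<^bsub>?N\<^esub> (\<ominus>\<^bsub>?N\<^esub> (z \<otimes> b))) \<oplus>\<^bsub>?N\<^esub> z \<otimes> b"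
    by (simp only: a_minus_def)
  also have "\<dots> = y \<otimes> y"
  proof -
    have p: "y \<otimes> y \<in> carrier ?N" and r: "z \<otimes> b \<in> carrier ?N" using yyc xyz b by simp_all
    show ?thesis
      unfolding N.M.a_assoc[OF p N.M.a_inv_closed[OF r] r] N.M.l_neg[OF r] by (rule N.M.r_zero[OF p])
  qed
  finally have "y \<otimes> y = x \<otimes> c \<oplus> z \<otimes> b" by simp
  then show False using yy[OF c(1) b(1)] by simp
qed

subsection \<open>Divisible modules over principal ideal rings are injective\<close>

text \<open>Partial homomorphisms are represented by their graphs, so that an upper bound of a chain
  is simply the union. The last clause makes them extend \<open>g\<close> along
  \<open>f\<close>.\<close>

definition partial_extension ::
  "('a, 'r) ring_scheme \<Rightarrow> ('a, 'b) module \<Rightarrow> ('a, 'c) module \<Rightarrow> ('a, 'e) module \<Rightarrow> ('b \<Rightarrow> 'c) \<Rightarrow> ('b \<Rightarrow> 'e) \<Rightarrow>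
    ('c \<times> 'e) set \<Rightarrow> bool" where
  "partial_extension R M N E f g G \<longleftrightarrow> G \<subseteq> carrier N \<times> carrier E \<and>
    (\<forall>n v n' v'. (n, v) \<in> G \<longrightarrow> (n', v') \<in> G \<longrightarrow> (n \<oplus>\<^bsub>N\<^esub> n', v \<oplus>\<^bsub>E\<^esub> v') \<in> G) \<and>
    (\<forall>a n v. a \<in> carrier R \<longrightarrow> (n, v) \<in> G \<longrightarrow> (a \<odot>\<^bsub>N\<^esub> n, a \<odot>\<^bsub>E\<^esub> v) \<in> G) \<and>
    (\<forall>n v v'. (n, v) \<in> G \<longrightarrow> (n, v') \<in> G \<longrightarrow> v = v') \<and>
    (\<forall>m\<in>carrier M. (f m, g m) \<in> G)"

lemma partial_extension_maximal:
  assumes M: "module R M"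
    and f: "f \<in> module_homs R M N" "inj_on f (carrier M)" and g: "g \<in> module_homs R M E"
  shows "\<exists>G. partial_extension R M N E f g G \<and>
    (\<forall>H. partial_extension R M N E f g H \<longrightarrow> G \<subseteq> H \<longrightarrow> H = G)"
proof -
  interpret M: module R M by fact
  let ?P = "partial_extension R M N E f g"
  define F where "F = {G. ?P G}"
  have "?P {(f m, g m) | m. m \<in> carrier M}"
    unfolding partial_extension_def
  proof (intro conjI allI impI ballI)
    let ?G = "{(f m, g m) | m. m \<in> carrier M}"
    show "?G \<subseteq> carrier N \<times> carrier E" using module_homsD(1)[OF f(1)] module_homsD(1)[OF g] by auto
    show "(n \<oplus>\<^bsub>N\<^esub> n', v \<oplus>\<^bsub>E\<^esub> v') \<in> ?G" if nv: "(n, v) \<in> ?G" "(n', v') \<in> ?G" for n v n' v'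
    proof -
      obtain m m' where "m \<in> carrier M" "m' \<in> carrier M" "n = f m" "v = g m" "n' = f m'" "v' = g m'"
        using nv by auto
      then show ?thesis using module_homsD(2)[OF f(1), of m m'] module_homsD(2)[OF g, of m m']
        by (auto intro!: exI[of _ "m \<oplus>\<^bsub>M\<^esub> m'"])
    qed
    show "(a \<odot>\<^bsub>N\<^esub> n, a \<odot>\<^bsub>E\<^esub> v) \<in> ?G" if nv: "a \<in> carrier R" "(n, v) \<in> ?G" for a n v
    proof -
      obtain m where "m \<in> carrier M" "n = f m" "v = g m" using nv by auto
      then show ?thesis using nv(1) module_homsD(3)[OF f(1), of a m] module_homsD(3)[OF g, of a m]
        by (auto intro!: exI[of _ "a \<odot>\<^bsub>M\<^esub> m"])
    qed
    show "v = v'" if "(n, v) \<in> ?G" "(n, v') \<in> ?G" for n v v'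
      using that f(2) by (auto dest: inj_onD)
    show "(f m, g m) \<in> ?G" if "m \<in> carrier M" for m using that by auto
  qed
  then have "F \<noteq> {}" by (auto simp: F_def)
  then have "\<exists>G\<in>F. \<forall>H\<in>F. G \<subseteq> H \<longrightarrow> H = G"
  proof (rule subset_Zorn_nonempty)
    fix C assume C: "C \<noteq> {}" "subset.chain F C"
    have P: "?P G" if "G \<in> C" for G using C(2) that by (auto simp: subset.chain_def F_def)
    have two: "\<exists>G\<in>C. p \<in> G \<and> q \<in> G" if "p \<in> \<Union>C" "q \<in> \<Union>C" for p q
      using that C(2) unfolding subset.chain_def by blast
    have "?P (\<Union>C)"
      unfolding partial_extension_def
    proof (intro conjI allI impI ballI)
      show "\<Union>C \<subseteq> carrier N \<times> carrier E"
      proof (rule Union_least)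
        show "G \<subseteq> carrier N \<times> carrier E" if "G \<in> C" for G
          using P[OF that] unfolding partial_extension_def by (rule conjunct1)
      qed
      show "(n \<oplus>\<^bsub>N\<^esub> n', v \<oplus>\<^bsub>E\<^esub> v') \<in> \<Union>C" if nv: "(n, v) \<in> \<Union>C" "(n', v') \<in> \<Union>C" for n v n' v'
      proof -
        obtain G where "G \<in> C" "(n, v) \<in> G" "(n', v') \<in> G" using two[OF nv] by blast
        then have "(n \<oplus>\<^bsub>N\<^esub> n', v \<oplus>\<^bsub>E\<^esub> v') \<in> G" using P[of G] by (simp add: partial_extension_def)
        then show ?thesis using \<open>G \<in> C\<close> by blast
      qed
      show "(a \<odot>\<^bsub>N\<^esub> n, a \<odot>\<^bsub>E\<^esub> v) \<in> \<Union>C" if a: "a \<in> carrier R" and nv: "(n, v) \<in> \<Union>C" for a n v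
      proof -
        obtain G where "G \<in> C" "(n, v) \<in> G" using nv by blast
        then have "(a \<odot>\<^bsub>N\<^esub> n, a \<odot>\<^bsub>E\<^esub> v) \<in> G" using P[of G] a by (simp add: partial_extension_def)
        then show ?thesis using \<open>G \<in> C\<close> by blast
      qed
      show "v = v'" if nv: "(n, v) \<in> \<Union>C" "(n, v') \<in> \<Union>C" for n v v'
      proof -
        obtain G where "G \<in> C" "(n, v) \<in> G" "(n, v') \<in> G" using two[OF nv] by blast
        then show ?thesis using P[of G] by (simp add: partial_extension_def)
      qed
      show "(f m, g m) \<in> \<Union>C" if m: "m \<in> carrier M" for m
      proof -
        obtain G where "G \<in> C" using C(1) by blast
        then have "(f m, g m) \<in> G" using P[of G] m by (simp add: partial_extension_def)
        then show ?thesis using \<open>G \<in> C\<close> by blast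
      qed
    qed
    then show "\<Union>C \<in> F" by (simp add: F_def)
  qed
  then show ?thesis by (auto simp: F_def)
qed

text \<open>In a maximal partial extension, the multipliers \<open>a\<close> with \<open>a n\<close>
  in the domain form an ideal \<open>(c)\<close>. Divisibility provides a value \<open>e\<close> for
  \<open>n\<close> with \<open>c e\<close> equal to the value at \<open>c n\<close>, and sending
  \<open>n\<close> to \<open>e\<close> extends the graph, so \<open>n\<close> was in the
  domain.\<close>

theorem divisible_injective:
  fixes R :: "'a ring" and E :: "('a, 'e) module"
  assumes R: "cring R" and E: "module R E"
    and pid: "\<And>I. ideal I R \<Longrightarrow> \<exists>c\<in>I. \<forall>a\<in>I. \<exists>b\<in>carrier R. a = b \<otimes>\<^bsub>R\<^esub> c"
    and div: "\<And>c v. c \<in> carrier R \<Longrightarrow> c \<noteq> \<zero>\<^bsub>R\<^esub> \<Longrightarrow> v \<in> carrier E \<Longrightarrow> \<exists>e\<in>carrier E. c \<odot>\<^bsub>E\<^esub> e = v"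
  shows "injective_module R E"
  unfolding injective_module_def
proof (intro conjI E allI impI, elim conjE)
  fix M N :: "('a, 'a) module" and f g
  assume MM: "module R M" and NN: "module R N" and f: "f \<in> module_homs R M N" "inj_on f (carrier M)"
    and g: "g \<in> module_homs R M E"
  interpret R: cring R by fact
  interpret E: module R E by fact
  interpret M: module R M by fact
  interpret N: module R N by fact
  obtain G where G: "partial_extension R M N E f g G"
    and maxG: "\<And>H. partial_extension R M N E f g H \<Longrightarrow> G \<subseteq> H \<Longrightarrow> H = G"
    using partial_extension_maximal[OF MM f g] by metis
  have Gc: "n \<in> carrier N" "v \<in> carrier E" if "(n, v) \<in> G" for n v
    using G that by (auto simp: partial_extension_def)
  have Gadd: "(n \<oplus>\<^bsub>N\<^esub> n', v \<oplus>\<^bsub>E\<^esub> v') \<in> G" if "(n, v) \<in> G" "(n', v') \<in> G" for n v n' v'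
    using G that by (simp add: partial_extension_def)
  have Gsm: "(a \<odot>\<^bsub>N\<^esub> n, a \<odot>\<^bsub>E\<^esub> v) \<in> G" if "a \<in> carrier R" "(n, v) \<in> G" for a n v
    using G that by (simp add: partial_extension_def)
  have Guniq: "v = v'" if "(n, v) \<in> G" "(n, v') \<in> G" for n v v'
    using G that unfolding partial_extension_def by metis
  have Gfg: "(f m, g m) \<in> G" if "m \<in> carrier M" for m
    using G that by (simp add: partial_extension_def)
  have G0: "(\<zero>\<^bsub>N\<^esub>, \<zero>\<^bsub>E\<^esub>) \<in> G"
    using Gfg[OF M.zero_closed] module_hom_zero[OF MM NN f(1)] module_hom_zero[OF MM E g] by simp
  have Gminus: "(n \<ominus>\<^bsub>N\<^esub> n', v \<ominus>\<^bsub>E\<^esub> v') \<in> G" if "(n, v) \<in> G" "(n', v') \<in> G" for n v n' v'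
  proof -
    have "\<ominus>\<^bsub>N\<^esub> n' = (\<ominus>\<^bsub>R\<^esub> \<one>\<^bsub>R\<^esub>) \<odot>\<^bsub>N\<^esub> n'" "\<ominus>\<^bsub>E\<^esub> v' = (\<ominus>\<^bsub>R\<^esub> \<one>\<^bsub>R\<^esub>) \<odot>\<^bsub>E\<^esub> v'"
      using N.smult_l_minus[of "\<one>\<^bsub>R\<^esub>" n'] E.smult_l_minus[of "\<one>\<^bsub>R\<^esub>" v'] Gc[OF that(2)] by simp_all
    then show ?thesis using Gadd[OF that(1) Gsm[OF _ that(2), of "\<ominus>\<^bsub>R\<^esub> \<one>\<^bsub>R\<^esub>"]] by (simp add: a_minus_def)
  qed
  have total: "\<exists>v. (n, v) \<in> G" if n: "n \<in> carrier N" for n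
  proof -
    define I where "I = {a \<in> carrier R. \<exists>v. (a \<odot>\<^bsub>N\<^esub> n, v) \<in> G}"
    have Iadd: "a \<oplus>\<^bsub>R\<^esub> b \<in> I" if ab: "a \<in> I" "b \<in> I" for a b
    proof -
      obtain v w where "(a \<odot>\<^bsub>N\<^esub> n, v) \<in> G" "(b \<odot>\<^bsub>N\<^esub> n, w) \<in> G" "a \<in> carrier R" "b \<in> carrier R"
        using ab by (auto simp: I_def)
      then show ?thesis using Gadd[of "a \<odot>\<^bsub>N\<^esub> n" v "b \<odot>\<^bsub>N\<^esub> n" w] n by (auto simp: I_def N.smult_l_distr)
    qed
    have Imult: "r \<otimes>\<^bsub>R\<^esub> a \<in> I" if ab: "a \<in> I" "r \<in> carrier R" for a r
    proof -
      obtain v where "(a \<odot>\<^bsub>N\<^esub> n, v) \<in> G" "a \<in> carrier R" using ab by (auto simp: I_def)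
      then show ?thesis using Gsm[of r "a \<odot>\<^bsub>N\<^esub> n" v] n ab by (auto simp: I_def N.smult_assoc1)
    qed
    have Ic: "I \<subseteq> carrier R" by (auto simp: I_def)
    have "ideal I R"
    proof (rule idealI)
      show "ring R" ..
      show "subgroup I (add_monoid R)"
      proof
        show "I \<subseteq> carrier (add_monoid R)" using Ic by simp
        show "a \<otimes>\<^bsub>add_monoid R\<^esub> b \<in> I" if "a \<in> I" "b \<in> I" for a b using Iadd[OF that] by simp
        show "\<one>\<^bsub>add_monoid R\<^esub> \<in> I" using G0 n by (auto simp: I_def)
        show "inv\<^bsub>add_monoid R\<^esub> a \<in> I" if "a \<in> I" for a
        proof -
          have "a \<in> carrier R" using that Ic by blast
          then have "\<ominus>\<^bsub>R\<^esub> a = (\<ominus>\<^bsub>R\<^esub> \<one>\<^bsub>R\<^esub>) \<otimes>\<^bsub>R\<^esub> a" by (simp add: R.l_minus)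
          then have "\<ominus>\<^bsub>R\<^esub> a \<in> I" using Imult[OF that, of "\<ominus>\<^bsub>R\<^esub> \<one>\<^bsub>R\<^esub>"] by simp
          then show ?thesis by (simp add: a_inv_def)
        qed
      qed
      fix a x assume a: "a \<in> I" and x: "x \<in> carrier R"
      show "x \<otimes>\<^bsub>R\<^esub> a \<in> I" by (rule Imult[OF a x])
      moreover have "a \<otimes>\<^bsub>R\<^esub> x = x \<otimes>\<^bsub>R\<^esub> a" using subsetD[OF Ic a] x by (rule R.m_comm)
      ultimately show "a \<otimes>\<^bsub>R\<^esub> x \<in> I" by (simp only:)
    qed
    from pid[OF this] obtain c where c: "c \<in> I" "\<And>a. a \<in> I \<Longrightarrow> \<exists>b\<in>carrier R. a = b \<otimes>\<^bsub>R\<^esub> c" by blast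
    then obtain v where cc: "c \<in> carrier R" and v: "(c \<odot>\<^bsub>N\<^esub> n, v) \<in> G" by (auto simp: I_def)
    \<comment> \<open>If \<open>c = 0\<close>, only the multiplier 0 takes \<open>n\<close> into the
      domain and every value is admissible; 0 is taken.\<close>
    obtain e where e: "e \<in> carrier E" "c \<odot>\<^bsub>E\<^esub> e = v"
    proof (cases "c = \<zero>\<^bsub>R\<^esub>")
      case True
      then have "(\<zero>\<^bsub>N\<^esub>, v) \<in> G" using v n by simp
      then have "v = \<zero>\<^bsub>E\<^esub>" using Guniq G0 by blast
      then show ?thesis using that[of "\<zero>\<^bsub>E\<^esub>"] True by simp
    next
      case False
      then show ?thesis using div[OF cc False Gc(2)[OF v]] that by blast
    qed
    define H where "H = {(d \<oplus>\<^bsub>N\<^esub> a \<odot>\<^bsub>N\<^esub> n, w \<oplus>\<^bsub>E\<^esub> a \<odot>\<^bsub>E\<^esub> e) | d w a. (d, w) \<in> G \<and> a \<in> carrier R}"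
    have HI: "(d \<oplus>\<^bsub>N\<^esub> a \<odot>\<^bsub>N\<^esub> n, w \<oplus>\<^bsub>E\<^esub> a \<odot>\<^bsub>E\<^esub> e) \<in> H" if "(d, w) \<in> G" "a \<in> carrier R" for d w a
      using that by (auto simp: H_def)
    have GH: "G \<subseteq> H"
    proof
      fix p assume p: "p \<in> G"
      obtain d w where dw: "p = (d, w)" by (cases p)
      show "p \<in> H" using HI[of d w "\<zero>\<^bsub>R\<^esub>"] p Gc[of d w] n e unfolding dw by simp
    qed
    have "partial_extension R M N E f g H"
      unfolding partial_extension_def
    proof (intro conjI allI impI ballI)
      show "H \<subseteq> carrier N \<times> carrier E" using Gc n e by (auto simp: H_def)
      show "(p \<oplus>\<^bsub>N\<^esub> p', q \<oplus>\<^bsub>E\<^esub> q') \<in> H" if pq: "(p, q) \<in> H" "(p', q') \<in> H" for p q p' q'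
      proof -
        obtain d w a where 1: "(d, w) \<in> G" "a \<in> carrier R" "p = d \<oplus>\<^bsub>N\<^esub> a \<odot>\<^bsub>N\<^esub> n" "q = w \<oplus>\<^bsub>E\<^esub> a \<odot>\<^bsub>E\<^esub> e"
          using pq(1) by (auto simp: H_def)
        obtain d' w' a' where 2: "(d', w') \<in> G" "a' \<in> carrier R" "p' = d' \<oplus>\<^bsub>N\<^esub> a' \<odot>\<^bsub>N\<^esub> n" "q' = w' \<oplus>\<^bsub>E\<^esub> a' \<odot>\<^bsub>E\<^esub> e"
          using pq(2) by (auto simp: H_def)
        have "p \<oplus>\<^bsub>N\<^esub> p' = (d \<oplus>\<^bsub>N\<^esub> d') \<oplus>\<^bsub>N\<^esub> (a \<oplus>\<^bsub>R\<^esub> a') \<odot>\<^bsub>N\<^esub> n"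
          using 1 2 Gc n by (simp add: N.smult_l_distr N.M.a_ac)
        moreover have "q \<oplus>\<^bsub>E\<^esub> q' = (w \<oplus>\<^bsub>E\<^esub> w') \<oplus>\<^bsub>E\<^esub> (a \<oplus>\<^bsub>R\<^esub> a') \<odot>\<^bsub>E\<^esub> e"
          using 1 2 Gc e by (simp add: E.smult_l_distr E.M.a_ac)
        ultimately show ?thesis using HI[OF Gadd[OF 1(1) 2(1)], of "a \<oplus>\<^bsub>R\<^esub> a'"] 1 2 by simp
      qed
      show "(r \<odot>\<^bsub>N\<^esub> p, r \<odot>\<^bsub>E\<^esub> q) \<in> H" if r: "r \<in> carrier R" and pq: "(p, q) \<in> H" for r p q
      proof -
        obtain d w a where 1: "(d, w) \<in> G" "a \<in> carrier R" "p = d \<oplus>\<^bsub>N\<^esub> a \<odot>\<^bsub>N\<^esub> n" "q = w \<oplus>\<^bsub>E\<^esub> a \<odot>\<^bsub>E\<^esub> e"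
          using pq by (auto simp: H_def)
        have "r \<odot>\<^bsub>N\<^esub> p = r \<odot>\<^bsub>N\<^esub> d \<oplus>\<^bsub>N\<^esub> (r \<otimes>\<^bsub>R\<^esub> a) \<odot>\<^bsub>N\<^esub> n"
          using 1 r Gc n by (simp add: N.smult_r_distr N.smult_assoc1)
        moreover have "r \<odot>\<^bsub>E\<^esub> q = r \<odot>\<^bsub>E\<^esub> w \<oplus>\<^bsub>E\<^esub> (r \<otimes>\<^bsub>R\<^esub> a) \<odot>\<^bsub>E\<^esub> e"
          using 1 r Gc e by (simp add: E.smult_r_distr E.smult_assoc1)
        ultimately show ?thesis using HI[OF Gsm[OF r 1(1)], of "r \<otimes>\<^bsub>R\<^esub> a"] 1 r by simp
      qed
      \<comment> \<open>Two representations of \<open>p\<close> differ by \<open>?b n\<close> in the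
        domain; then \<open>?b\<close> is a multiple of \<open>c\<close>, and for those
        \<open>e\<close> was chosen to agree with \<open>G\<close>.\<close>
      show "q = q'" if pq: "(p, q) \<in> H" "(p, q') \<in> H" for p q q'
      proof -
        obtain d w a where 1: "(d, w) \<in> G" "a \<in> carrier R" "p = d \<oplus>\<^bsub>N\<^esub> a \<odot>\<^bsub>N\<^esub> n" "q = w \<oplus>\<^bsub>E\<^esub> a \<odot>\<^bsub>E\<^esub> e"
          using pq(1) by (auto simp: H_def)
        obtain d' w' a' where 2: "(d', w') \<in> G" "a' \<in> carrier R" "p = d' \<oplus>\<^bsub>N\<^esub> a' \<odot>\<^bsub>N\<^esub> n" "q' = w' \<oplus>\<^bsub>E\<^esub> a' \<odot>\<^bsub>E\<^esub> e"
          using pq(2) by (auto simp: H_def)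
        note car = Gc[OF 1(1)] Gc[OF 2(1)]
        have cross: "x' \<ominus>\<^bsub>K\<^esub> x = y \<ominus>\<^bsub>K\<^esub> y' \<longleftrightarrow> x \<oplus>\<^bsub>K\<^esub> y = x' \<oplus>\<^bsub>K\<^esub> y'"
          if K: "abelian_group K" "x \<in> carrier K" "x' \<in> carrier K" "y \<in> carrier K" "y' \<in> carrier K"
          for K :: "('a, 'k) module" and x x' y y'
        proof -
          interpret K: abelian_group K by (rule K(1))
          have "x' \<ominus>\<^bsub>K\<^esub> x = y \<ominus>\<^bsub>K\<^esub> y' \<longleftrightarrow> (x' \<ominus>\<^bsub>K\<^esub> x) \<oplus>\<^bsub>K\<^esub> (x \<oplus>\<^bsub>K\<^esub> y') = (y \<ominus>\<^bsub>K\<^esub> y') \<oplus>\<^bsub>K\<^esub> (x \<oplus>\<^bsub>K\<^esub> y')"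
            using K by simp
          also have "(x' \<ominus>\<^bsub>K\<^esub> x) \<oplus>\<^bsub>K\<^esub> (x \<oplus>\<^bsub>K\<^esub> y') = x' \<oplus>\<^bsub>K\<^esub> y'"
            using K by (simp add: a_minus_def K.a_assoc K.r_neg1)
          also have "(y \<ominus>\<^bsub>K\<^esub> y') \<oplus>\<^bsub>K\<^esub> (x \<oplus>\<^bsub>K\<^esub> y') = x \<oplus>\<^bsub>K\<^esub> y"
            using K K.a_lcomm[of y' y "\<ominus>\<^bsub>K\<^esub> y'"] K.r_neg[of y'] by (simp add: a_minus_def K.a_ac)
          finally show ?thesis by (metis)
        qed
        let ?b = "a \<ominus>\<^bsub>R\<^esub> a'"
        have "d' \<ominus>\<^bsub>N\<^esub> d = a \<odot>\<^bsub>N\<^esub> n \<ominus>\<^bsub>N\<^esub> a' \<odot>\<^bsub>N\<^esub> n"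
          using cross[OF N.M.abelian_group_axioms, of d d' "a \<odot>\<^bsub>N\<^esub> n" "a' \<odot>\<^bsub>N\<^esub> n"] 1 2 car n by simp
        also have "\<dots> = ?b \<odot>\<^bsub>N\<^esub> n" using 1 2 n by (simp add: a_minus_def N.smult_l_distr N.smult_l_minus)
        finally have dn: "(?b \<odot>\<^bsub>N\<^esub> n, w' \<ominus>\<^bsub>E\<^esub> w) \<in> G" using Gminus[OF 2(1) 1(1)] by simp
        then have "?b \<in> I" using 1 2 by (auto simp: I_def)
        then obtain b where b: "b \<in> carrier R" "?b = b \<otimes>\<^bsub>R\<^esub> c" using c(2) by blast
        have "(b \<odot>\<^bsub>N\<^esub> (c \<odot>\<^bsub>N\<^esub> n), b \<odot>\<^bsub>E\<^esub> v) \<in> G" by (rule Gsm[OF b(1) v])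
        then have "w' \<ominus>\<^bsub>E\<^esub> w = b \<odot>\<^bsub>E\<^esub> v" using dn Guniq b cc n by (simp add: N.smult_assoc1)
        also have "\<dots> = ?b \<odot>\<^bsub>E\<^esub> e" using b cc e by (simp add: E.smult_assoc1)
        also have "\<dots> = a \<odot>\<^bsub>E\<^esub> e \<ominus>\<^bsub>E\<^esub> a' \<odot>\<^bsub>E\<^esub> e" using 1 2 e by (simp add: a_minus_def E.smult_l_distr E.smult_l_minus)
        finally show "q = q'"
          using cross[OF E.M.abelian_group_axioms, of w w' "a \<odot>\<^bsub>E\<^esub> e" "a' \<odot>\<^bsub>E\<^esub> e"] 1 2 car e by simp
      qed
      show "(f m, g m) \<in> H" if "m \<in> carrier M" for m using Gfg[OF that] GH by blast
    qed
    from maxG[OF this GH] have "H = G" .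
    have n1: "\<zero>\<^bsub>N\<^esub> \<oplus>\<^bsub>N\<^esub> \<one>\<^bsub>R\<^esub> \<odot>\<^bsub>N\<^esub> n = n" using n by simp
    from HI[OF G0 R.one_closed] show ?thesis unfolding \<open>H = G\<close> n1 by (rule exI)
  qed
  define h where "h n = (SOME v. (n, v) \<in> G)" for n
  have h: "(n, h n) \<in> G" if "n \<in> carrier N" for n
    unfolding h_def by (rule someI_ex[OF total[OF that]])
  have "h n \<in> carrier E" if "n \<in> carrier N" for n by (rule Gc(2)[OF h[OF that]])
  moreover have "h (n \<oplus>\<^bsub>N\<^esub> n') = h n \<oplus>\<^bsub>E\<^esub> h n'" if "n \<in> carrier N" "n' \<in> carrier N" for n n'
    by (rule Guniq[OF h[OF N.M.a_closed[OF that]] Gadd[OF h[OF that(1)] h[OF that(2)]]])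
  moreover have "h (a \<odot>\<^bsub>N\<^esub> n) = a \<odot>\<^bsub>E\<^esub> h n" if "a \<in> carrier R" "n \<in> carrier N" for a n
    by (rule Guniq[OF h[OF N.smult_closed[OF that]] Gsm[OF that(1) h[OF that(2)]]])
  ultimately have "h \<in> module_homs R N E" unfolding module_homs_def by simp
  moreover have "h (f m) = g m" if "m \<in> carrier M" for m
    by (rule Guniq[OF h[OF module_homsD(1)[OF f(1) that]] Gfg[OF that]])
  ultimately show "\<exists>h\<in>module_homs R N E. \<forall>x\<in>carrier M. h (f x) = g x" by blast
qed

subsection \<open>The injective resolution of a discrete valuation ring\<close>

text \<open>For an isomorphism \<open>\<theta>\<close> onto \<open>k[[t]]\<close> this is the module \<open>k((t))/ker \<pi>\<close>, where \<open>\<pi>\<close> is an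
  additive projection whose kernel is a \<open>k[[t]]\<close>-submodule; the classes are represented by
  the image of \<open>\<pi>\<close> and transported to the type \<open>'e\<close> along an injection \<open>\<iota>\<close>.\<close>

definition laurent_module ::
  "('q \<Rightarrow> bit fps) \<Rightarrow> (bit fls \<Rightarrow> 'e) \<Rightarrow> (bit fls \<Rightarrow> bit fls) \<Rightarrow> ('q, 'e) module" where
  "laurent_module \<theta> \<iota> \<pi> = \<lparr>carrier = range (\<lambda>k. \<iota> (\<pi> k)), monoid.mult = (\<lambda>x y. x), one = \<iota> 0,
     ring.zero = \<iota> 0, ring.add = (\<lambda>x y. \<iota> (inv_into UNIV \<iota> x + inv_into UNIV \<iota> y)),
     module.smult = (\<lambda>q x. \<iota> (\<pi> (fps_to_fls (\<theta> q) * inv_into UNIV \<iota> x)))\<rparr>"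

text \<open>Since \<open>x - \<pi> x\<close> runs through the kernel, the last clause says that the
  kernel is closed under multiplication by power series.\<close>

definition submodule_projection :: "(bit fls \<Rightarrow> bit fls) \<Rightarrow> bool" where
  "submodule_projection \<pi> \<longleftrightarrow> (\<forall>x y. \<pi> (x + y) = \<pi> x + \<pi> y) \<and> (\<forall>x. \<pi> (\<pi> x) = \<pi> x) \<and>
    (\<forall>a x. \<pi> (fps_to_fls a * \<pi> x) = \<pi> (fps_to_fls a * x))"

lemma submodule_projectionD:
  assumes "submodule_projection \<pi>"
  shows "\<pi> (x + y) = \<pi> x + \<pi> y" "\<pi> (\<pi> x) = \<pi> x" "\<pi> (fps_to_fls a * \<pi> x) = \<pi> (fps_to_fls a * x)"
    "\<pi> 0 = 0"
proof -
  note p = assms[unfolded submodule_projection_def]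
  note add = p[THEN conjunct1, THEN spec, THEN spec]
  show "\<pi> (x + y) = \<pi> x + \<pi> y" by (rule add)
  show "\<pi> (\<pi> x) = \<pi> x" by (rule p[THEN conjunct2, THEN conjunct1, THEN spec])
  show "\<pi> (fps_to_fls a * \<pi> x) = \<pi> (fps_to_fls a * x)"
    by (rule p[THEN conjunct2, THEN conjunct2, THEN spec, THEN spec])
  have "\<pi> 0 = \<pi> 0 + \<pi> 0" using add[of 0 0] by (simp only: add_0)
  then show "\<pi> 0 = 0" by (simp only: add_cancel_right_right)
qed

lemma laurent_module_simps:
  assumes "inj \<iota>"
  shows "carrier (laurent_module \<theta> \<iota> \<pi>) = range (\<lambda>k. \<iota> (\<pi> k))"
    "\<zero>\<^bsub>laurent_module \<theta> \<iota> \<pi>\<^esub> = \<iota> 0"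
    "\<iota> x \<oplus>\<^bsub>laurent_module \<theta> \<iota> \<pi>\<^esub> \<iota> y = \<iota> (x + y)"
    "q \<odot>\<^bsub>laurent_module \<theta> \<iota> \<pi>\<^esub> \<iota> x = \<iota> (\<pi> (fps_to_fls (\<theta> q) * x))"
proof -
  have i: "inv_into UNIV \<iota> (\<iota> x) = x" for x using assms by (rule inv_f_f)
  show "carrier (laurent_module \<theta> \<iota> \<pi>) = range (\<lambda>k. \<iota> (\<pi> k))" "\<zero>\<^bsub>laurent_module \<theta> \<iota> \<pi>\<^esub> = \<iota> 0"
    unfolding laurent_module_def by simp_all
  show "\<iota> x \<oplus>\<^bsub>laurent_module \<theta> \<iota> \<pi>\<^esub> \<iota> y = \<iota> (x + y)"
    "q \<odot>\<^bsub>laurent_module \<theta> \<iota> \<pi>\<^esub> \<iota> x = \<iota> (\<pi> (fps_to_fls (\<theta> q) * x))"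
    unfolding laurent_module_def by (simp_all add: i)
qed

lemma module_laurent_module:
  fixes Q :: "'q ring"
  assumes Q: "cring Q" and \<theta>: "\<theta> \<in> ring_hom Q (ring_of_type_algebra :: bit fps ring)"
    and \<iota>: "inj \<iota>" and \<pi>: "submodule_projection \<pi>"
  shows "module Q (laurent_module \<theta> \<iota> \<pi>)"
proof -
  let ?L = "laurent_module \<theta> \<iota> \<pi>"
  note s = laurent_module_simps[OF \<iota>, of \<theta> \<pi>] and p = submodule_projectionD[OF \<pi>]
  have elem: "\<exists>k. x = \<iota> (\<pi> k)" if "x \<in> carrier ?L" for x using that s(1) by auto
  have \<iota>\<pi>: "\<iota> (\<pi> k) \<in> carrier ?L" for k using s(1) by auto
  have t: "\<theta> (a \<oplus>\<^bsub>Q\<^esub> b) = \<theta> a + \<theta> b" "\<theta> (a \<otimes>\<^bsub>Q\<^esub> b) = \<theta> a * \<theta> b" "\<theta> \<one>\<^bsub>Q\<^esub> = 1"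
    if "a \<in> carrier Q" "b \<in> carrier Q" for a b
    using ring_hom_add[OF \<theta> that] ring_hom_mult[OF \<theta> that] ring_hom_one[OF \<theta>]
    by (simp_all add: ring_of_type_algebra_def)
  have t1: "\<theta> \<one>\<^bsub>Q\<^esub> = 1" using ring_hom_one[OF \<theta>] by (simp add: ring_of_type_algebra_def)
  have add_in: "x \<oplus>\<^bsub>?L\<^esub> y \<in> carrier ?L" if "x \<in> carrier ?L" "y \<in> carrier ?L" for x y
  proof -
    obtain k l where "x = \<iota> (\<pi> k)" "y = \<iota> (\<pi> l)" using elem \<open>x \<in> carrier ?L\<close> \<open>y \<in> carrier ?L\<close> by metis
    then have "x \<oplus>\<^bsub>?L\<^esub> y = \<iota> (\<pi> (k + l))" by (simp only: s(3) p(1))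
    then show ?thesis using \<iota>\<pi> by simp
  qed
  have repr: "\<exists>k. x = \<iota> k" if "x \<in> carrier ?L" for x using elem[OF that] by blast
  have "abelian_group ?L"
  proof (rule abelian_groupI)
    show "x \<oplus>\<^bsub>?L\<^esub> y \<oplus>\<^bsub>?L\<^esub> z = x \<oplus>\<^bsub>?L\<^esub> (y \<oplus>\<^bsub>?L\<^esub> z)"
      if xyz: "x \<in> carrier ?L" "y \<in> carrier ?L" "z \<in> carrier ?L" for x y z
    proof -
      obtain k l m where "x = \<iota> k" "y = \<iota> l" "z = \<iota> m" using repr xyz by metis
      then show ?thesis by (simp only: s(3) add.assoc)
    qed
    show "x \<oplus>\<^bsub>?L\<^esub> y = y \<oplus>\<^bsub>?L\<^esub> x" if xy: "x \<in> carrier ?L" "y \<in> carrier ?L" for x y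
    proof -
      obtain k l where "x = \<iota> k" "y = \<iota> l" using repr xy by metis
      then show ?thesis by (simp only: s(3) add.commute)
    qed
    show "\<zero>\<^bsub>?L\<^esub> \<in> carrier ?L" using \<iota>\<pi>[of 0] unfolding s(2) p(4) .
    show "\<zero>\<^bsub>?L\<^esub> \<oplus>\<^bsub>?L\<^esub> x = x" if xc: "x \<in> carrier ?L" for x
    proof -
      obtain k where "x = \<iota> k" using repr[OF xc] by blast
      then show ?thesis by (simp only: s(2,3) add_0)
    qed
    show "\<exists>y\<in>carrier ?L. y \<oplus>\<^bsub>?L\<^esub> x = \<zero>\<^bsub>?L\<^esub>" if xc: "x \<in> carrier ?L" for x
    proof -
      obtain k where k: "x = \<iota> (\<pi> k)" using elem[OF xc] by blast
      have "\<pi> (- k) + \<pi> k = 0" unfolding p(1)[symmetric] by (simp add: p(4))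
      then have "\<iota> (\<pi> (- k)) \<oplus>\<^bsub>?L\<^esub> x = \<zero>\<^bsub>?L\<^esub>" unfolding k by (simp only: s(2,3))
      then show ?thesis using \<iota>\<pi> by blast
    qed
  qed (rule add_in)
  then show ?thesis
  proof (rule moduleI[OF Q])
    show "a \<odot>\<^bsub>?L\<^esub> x \<in> carrier ?L" if xc: "x \<in> carrier ?L" for a x
    proof -
      obtain k where k: "x = \<iota> k" using repr[OF xc] by blast
      show ?thesis unfolding k s(4) by (rule \<iota>\<pi>)
    qed
    show "(a \<oplus>\<^bsub>Q\<^esub> b) \<odot>\<^bsub>?L\<^esub> x = a \<odot>\<^bsub>?L\<^esub> x \<oplus>\<^bsub>?L\<^esub> b \<odot>\<^bsub>?L\<^esub> x"
      if ab: "a \<in> carrier Q" "b \<in> carrier Q" and xc: "x \<in> carrier ?L" for a b x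
    proof -
      obtain k where k: "x = \<iota> k" using repr[OF xc] by blast
      show ?thesis unfolding k s(3,4) t(1)[OF ab] by (simp only: fps_to_fls_plus distrib_right p(1))
    qed
    show "a \<odot>\<^bsub>?L\<^esub> (x \<oplus>\<^bsub>?L\<^esub> y) = a \<odot>\<^bsub>?L\<^esub> x \<oplus>\<^bsub>?L\<^esub> a \<odot>\<^bsub>?L\<^esub> y"
      if xy: "x \<in> carrier ?L" "y \<in> carrier ?L" for a x y
    proof -
      obtain k l where k: "x = \<iota> k" "y = \<iota> l" using repr xy by metis
      show ?thesis unfolding k s(3,4) by (simp only: distrib_left p(1))
    qed
    show "(a \<otimes>\<^bsub>Q\<^esub> b) \<odot>\<^bsub>?L\<^esub> x = a \<odot>\<^bsub>?L\<^esub> (b \<odot>\<^bsub>?L\<^esub> x)"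
      if ab: "a \<in> carrier Q" "b \<in> carrier Q" and xc: "x \<in> carrier ?L" for a b x
    proof -
      obtain k where k: "x = \<iota> k" using repr[OF xc] by blast
      show ?thesis unfolding k s(4) t(2)[OF ab] p(3) by (simp only: fls_times_fps_to_fls mult.assoc)
    qed
    show "\<one>\<^bsub>Q\<^esub> \<odot>\<^bsub>?L\<^esub> x = x" if xc: "x \<in> carrier ?L" for x
    proof -
      obtain k where k: "x = \<iota> (\<pi> k)" using elem[OF xc] by blast
      show ?thesis unfolding k s(4) t1 by (simp add: p(2))
    qed
  qed
qed

text \<open>A nonzero element of least \<open>subdegree\<close> divides all the others.\<close>

lemma fps_ideal_principal:
  fixes I :: "bit fps set"
  assumes "0 \<in> I" "\<And>a r. a \<in> I \<Longrightarrow> r * a \<in> I"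
  shows "\<exists>c\<in>I. \<forall>a\<in>I. \<exists>b. a = b * c"
proof (cases "I = {0}")
  case False
  then obtain f where f: "f \<in> I" "f \<noteq> 0" using assms(1) by blast
  have ne: "\<exists>f. f \<in> I \<and> f \<noteq> 0" using f by blast
  define n where "n = (LEAST n. \<exists>f. f \<in> I \<and> f \<noteq> 0 \<and> subdegree f = n)"
  have "\<exists>n. \<exists>f. f \<in> I \<and> f \<noteq> 0 \<and> subdegree f = n" using f by blast
  then have "\<exists>f. f \<in> I \<and> f \<noteq> 0 \<and> subdegree f = n" unfolding n_def by (rule LeastI_ex)
  then obtain c where c: "c \<in> I" "c \<noteq> 0" "subdegree c = n" by blast
  have "\<exists>b. a = b * c" if a: "a \<in> I" for a
  proof (cases "a = 0")
    case False
    have "n \<le> subdegree a" unfolding n_def by (rule Least_le) (use a False in blast)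
    then have "c dvd a" using c False by (simp add: fps_dvd_iff)
    then show ?thesis by (metis dvdE mult.commute)
  qed (auto intro: exI[of _ 0])
  then show ?thesis using c(1) by blast
qed auto

lemma ring_iso_bit_fpsD:
  fixes Q :: "'q ring"
  assumes Q: "cring Q" and \<theta>: "\<theta> \<in> ring_iso Q (ring_of_type_algebra :: bit fps ring)"
  shows "\<theta> \<in> ring_hom Q (ring_of_type_algebra :: bit fps ring)"
    and "bij_betw \<theta> (carrier Q) UNIV"
    and "a \<in> carrier Q \<Longrightarrow> b \<in> carrier Q \<Longrightarrow> \<theta> (a \<oplus>\<^bsub>Q\<^esub> b) = \<theta> a + \<theta> b"
    and "a \<in> carrier Q \<Longrightarrow> b \<in> carrier Q \<Longrightarrow> \<theta> (a \<otimes>\<^bsub>Q\<^esub> b) = \<theta> a * \<theta> b"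
    and "\<theta> \<one>\<^bsub>Q\<^esub> = 1"
    and "\<theta> \<zero>\<^bsub>Q\<^esub> = 0"
proof -
  show hom: "\<theta> \<in> ring_hom Q (ring_of_type_algebra :: bit fps ring)"
    and "bij_betw \<theta> (carrier Q) UNIV"
    using \<theta> by (auto simp: ring_iso_def ring_of_type_algebra_def)
  show "\<theta> (a \<oplus>\<^bsub>Q\<^esub> b) = \<theta> a + \<theta> b" "\<theta> (a \<otimes>\<^bsub>Q\<^esub> b) = \<theta> a * \<theta> b" if "a \<in> carrier Q" "b \<in> carrier Q"
    using ring_hom_add[OF hom that] ring_hom_mult[OF hom that] by (simp_all add: ring_of_type_algebra_def)
  show "\<theta> \<one>\<^bsub>Q\<^esub> = 1" using ring_hom_one[OF hom] by (simp add: ring_of_type_algebra_def)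
  show "\<theta> \<zero>\<^bsub>Q\<^esub> = 0"
    using ring_hom_zero[OF hom] Q cring_from_type_algebra[where 'a = "bit fps"] 
    by (simp add: cring_def ring_of_type_algebra_def)
qed

lemma pid_of_iso:
  fixes Q :: "'q ring"
  assumes Q: "cring Q" and \<theta>: "\<theta> \<in> ring_iso Q (ring_of_type_algebra :: bit fps ring)"
    and I: "ideal I Q"
  shows "\<exists>c\<in>I. \<forall>a\<in>I. \<exists>b\<in>carrier Q. a = b \<otimes>\<^bsub>Q\<^esub> c"
proof -
  interpret ideal I Q by fact
  note hom = ring_iso_bit_fpsD(1)[OF Q \<theta>] and bij = ring_iso_bit_fpsD(2)[OF Q \<theta>] and zero = ring_iso_bit_fpsD(6)[OF Q \<theta>]
  note m = ring_iso_bit_fpsD(4)[OF Q \<theta>]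
  have surj: "\<exists>q\<in>carrier Q. \<theta> q = f" for f using bij by (metis UNIV_I bij_betw_imp_surj_on imageE)
  have "\<exists>c\<in>\<theta> ` I. \<forall>a\<in>\<theta> ` I. \<exists>b. a = b * c"
  proof (rule fps_ideal_principal)
    show "0 \<in> \<theta> ` I" using zero zero_closed additive_subgroup.zero_closed[OF is_additive_subgroup] by (metis imageI)
    fix a r assume "a \<in> \<theta> ` I"
    then obtain i where i: "i \<in> I" "a = \<theta> i" by blast
    obtain q where q: "q \<in> carrier Q" "\<theta> q = r" using surj by blast
    have "r * a = \<theta> (q \<otimes>\<^bsub>Q\<^esub> i)" using i q m Icarr by simp
    then show "r * a \<in> \<theta> ` I" using I_l_closed[OF i(1) q(1)] by blast
  qed
  then obtain c where c: "c \<in> I" "\<And>a. a \<in> I \<Longrightarrow> \<exists>b. \<theta> a = b * \<theta> c" by auto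
  have "\<exists>b\<in>carrier Q. a = b \<otimes>\<^bsub>Q\<^esub> c" if a: "a \<in> I" for a
  proof -
    obtain b where b: "\<theta> a = b * \<theta> c" using c(2)[OF a] by blast
    obtain q where q: "q \<in> carrier Q" "\<theta> q = b" using surj by blast
    have "\<theta> a = \<theta> (q \<otimes>\<^bsub>Q\<^esub> c)" using b q m Icarr[OF c(1)] by simp
    then have "a = q \<otimes>\<^bsub>Q\<^esub> c"
      using bij_betw_imp_inj_on[OF bij] Icarr[OF a] Icarr[OF c(1)] q(1) m_closed by (auto dest: inj_onD)
    then show ?thesis using q(1) by blast
  qed
  then show ?thesis using c(1) by blast
qed

text \<open>Laurent series form a field, so a representative can be divided there and then
  projected: a quotient of a divisible module is divisible.\<close>

lemma injective_laurent_module: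
  fixes Q :: "'q ring"
  assumes Q: "cring Q" and \<theta>: "\<theta> \<in> ring_iso Q (ring_of_type_algebra :: bit fps ring)"
    and \<iota>: "inj \<iota>" and \<pi>: "submodule_projection \<pi>"
  shows "injective_module Q (laurent_module \<theta> \<iota> \<pi>)"
proof (rule divisible_injective[OF Q])
  note hom = ring_iso_bit_fpsD(1)[OF Q \<theta>] and bij = ring_iso_bit_fpsD(2)[OF Q \<theta>] and zero = ring_iso_bit_fpsD(6)[OF Q \<theta>]
  let ?L = "laurent_module \<theta> \<iota> \<pi>"
  note s = laurent_module_simps[OF \<iota>, of \<theta> \<pi>] and p = submodule_projectionD[OF \<pi>]
  show "module Q ?L" by (rule module_laurent_module[OF Q hom \<iota> \<pi>])
  show "\<exists>c\<in>I. \<forall>a\<in>I. \<exists>b\<in>carrier Q. a = b \<otimes>\<^bsub>Q\<^esub> c" if "ideal I Q" for I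
    by (rule pid_of_iso[OF Q \<theta> that])
  show "\<exists>e\<in>carrier ?L. c \<odot>\<^bsub>?L\<^esub> e = v"
    if c: "c \<in> carrier Q" "c \<noteq> \<zero>\<^bsub>Q\<^esub>" and v: "v \<in> carrier ?L" for c v
  proof -
    obtain k where k: "v = \<iota> (\<pi> k)" using v s(1) by auto
    have "\<zero>\<^bsub>Q\<^esub> \<in> carrier Q" using Q by (simp add: cring_def ring.ring_simprules(2))
    then have "\<theta> c \<noteq> 0" using zero bij_betw_imp_inj_on[OF bij] c by (metis inj_onD)
    then have "fps_to_fls (\<theta> c) * (k / fps_to_fls (\<theta> c)) = k" by simp
    then have "c \<odot>\<^bsub>?L\<^esub> \<iota> (\<pi> (k / fps_to_fls (\<theta> c))) = v" unfolding s(4) p(3) k by simp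
    then show ?thesis using s(1) by blast
  qed
qed

definition polar_part :: "bit fls \<Rightarrow> bit fls" where
  "polar_part f = f - fps_to_fls (fls_regpart f)"

lemma submodule_projection_polar_part: "submodule_projection polar_part"
proof -
  have add: "polar_part (x + y) = polar_part x + polar_part y" for x y
    unfolding polar_part_def fls_regpart_plus fps_to_fls_plus by (rule add_diff_add)
  have idem: "polar_part (polar_part x) = polar_part x" for x
    by (simp add: polar_part_def)
  have ker: "polar_part (fps_to_fls a) = 0" for a by (simp add: polar_part_def)
  have "polar_part (fps_to_fls a * x) = polar_part (fps_to_fls a * polar_part x)" for a x
  proof -
    have "fps_to_fls a * x = fps_to_fls a * polar_part x + fps_to_fls (a * fls_regpart x)"
      unfolding polar_part_def fls_times_fps_to_fls by (simp only: right_diff_distrib diff_add_cancel)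
    then show ?thesis by (simp only: add ker add_0_right)
  qed
  then show ?thesis unfolding submodule_projection_def using add idem by simp
qed

lemma polar_part_eq_0: "polar_part f = 0 \<longleftrightarrow> f \<in> range fps_to_fls"
  by (auto simp: polar_part_def)

text \<open>A Laurent series over two elements is a set of integers. Two distinct elements of
  \<open>'q\<close> code it as a sequence, which places the resolution on the type prescribed by
  \<open>finite_self_injective_dim\<close>.\<close>

lemma laurent_injection:
  assumes "(a :: 'q) \<noteq> b"
  shows "\<exists>\<iota> :: bit fls \<Rightarrow> nat \<Rightarrow> 'q. inj \<iota>"
proof -
  have "inj (\<lambda>(f :: bit fls) n. if fls_nth f (int_decode n) = 0 then a else b)"
  proof (rule injI)
    fix f g :: "bit fls"
    assume eq: "(\<lambda>n. if fls_nth f (int_decode n) = 0 then a else b) = (\<lambda>n. if fls_nth g (int_decode n) = 0 then a else b)"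
    have "fls_nth f i = 0 \<longleftrightarrow> fls_nth g i = 0" for i
      using fun_cong[OF eq, of "int_encode i"] assms by (simp split: if_splits)
    then have "fls_nth f i = fls_nth g i" for i by (metis bit_not_one_iff)
    then show "f = g" by (intro fls_eqI)
  qed
  then show ?thesis by blast
qed

theorem finite_self_injective_dim_of_iso:
  fixes Q :: "'q ring"
  assumes Q: "cring Q" and \<theta>: "\<theta> \<in> ring_iso Q (ring_of_type_algebra :: bit fps ring)"
  shows "finite_self_injective_dim Q"
proof -
  interpret cring Q by fact
  note hom = ring_iso_bit_fpsD(1)[OF Q \<theta>] and bij = ring_iso_bit_fpsD(2)[OF Q \<theta>] and zero = ring_iso_bit_fpsD(6)[OF Q \<theta>]
  note t = ring_iso_bit_fpsD(3,4)[OF Q \<theta>] and t1 = ring_iso_bit_fpsD(5)[OF Q \<theta>]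
  have "\<one>\<^bsub>Q\<^esub> \<noteq> \<zero>\<^bsub>Q\<^esub>" using t1 zero by (metis one_neq_zero)
  from laurent_injection[OF this] obtain \<iota> :: "bit fls \<Rightarrow> nat \<Rightarrow> 'q" where \<iota>: "inj \<iota>" by blast
  \<comment> \<open>\<open>E 0\<close> becomes the field of Laurent series, \<open>E 1\<close> its
    quotient by the power series, represented by polar parts, and all further modules are 0.\<close>
  define \<pi> where "\<pi> i = (if i = 0 then (\<lambda>x. x) else if i = 1 then polar_part else (\<lambda>_. 0))" for i :: nat
  have \<pi>: "submodule_projection (\<pi> i)" for i
    using submodule_projection_polar_part unfolding \<pi>_def
    by (cases "i = 0"; cases "i = 1") (auto simp: submodule_projection_def)
  define E where "E i = laurent_module \<theta> \<iota> (\<pi> i)" for i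
  define \<epsilon> where "\<epsilon> q = \<iota> (fps_to_fls (\<theta> q))" for q
  \<comment> \<open>So \<open>d 0\<close> is the quotient map and every later \<open>d i\<close> is
    0.\<close>
  define d where "d i x = \<iota> (\<pi> (Suc i) (inv_into UNIV \<iota> x))" for i x
  have s: "carrier (E i) = range (\<lambda>k. \<iota> (\<pi> i k))" "\<zero>\<^bsub>E i\<^esub> = \<iota> 0" "\<iota> x \<oplus>\<^bsub>E i\<^esub> \<iota> y = \<iota> (x + y)"
    "q \<odot>\<^bsub>E i\<^esub> \<iota> x = \<iota> (\<pi> i (fps_to_fls (\<theta> q) * x))" for i x y q
    unfolding E_def by (simp_all add: laurent_module_simps[OF \<iota>])
  note p = submodule_projectionD[OF \<pi>]
  have d_\<iota>: "d i (\<iota> x) = \<iota> (\<pi> (Suc i) x)" for i x using \<iota> by (simp add: d_def)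
  have comp: "\<pi> (Suc i) (\<pi> i x) = \<pi> (Suc i) x" if "i \<noteq> 1" for i x
    using that by (auto simp: \<pi>_def)
  have comp0: "\<pi> (Suc i) x = 0" if "i \<noteq> 0" for i x using that by (simp add: \<pi>_def)
  have \<iota>eq: "\<iota> x = \<iota> y \<longleftrightarrow> x = y" for x y using \<iota> by (simp add: inj_eq)
  let ?N = "module_via (\<lambda>a. a) Q"
  have "injective_resolution Q ?N E \<epsilon> d"
    unfolding injective_resolution_def
  proof (intro conjI allI)
    show "module Q ?N" by (rule module_self)
    show "injective_module Q (E i)" for i unfolding E_def by (rule injective_laurent_module[OF Q \<theta> \<iota> \<pi>])
    show "\<epsilon> \<in> module_homs Q ?N (E 0)"
      unfolding module_homs_def
    proof (intro CollectI conjI ballI Pi_I)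
      show "\<epsilon> x \<in> carrier (E 0)" for x by (simp add: s \<epsilon>_def \<pi>_def)
      show "\<epsilon> (x \<oplus>\<^bsub>?N\<^esub> y) = \<epsilon> x \<oplus>\<^bsub>E 0\<^esub> \<epsilon> y" if "x \<in> carrier ?N" "y \<in> carrier ?N" for x y
        using that t(1)[of x y] by (simp add: \<epsilon>_def s)
      show "\<epsilon> (a \<odot>\<^bsub>?N\<^esub> x) = a \<odot>\<^bsub>E 0\<^esub> \<epsilon> x" if "a \<in> carrier Q" "x \<in> carrier ?N" for a x
        using that t(2)[of a x] by (simp add: \<epsilon>_def s \<pi>_def fls_times_fps_to_fls)
    qed
    show "inj_on \<epsilon> (carrier ?N)"
      using bij_betw_imp_inj_on[OF bij] by (auto simp: inj_on_def \<epsilon>_def \<iota>eq)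
    show "d i \<in> module_homs Q (E i) (E (Suc i))" for i
      unfolding module_homs_def
    proof (intro CollectI conjI ballI Pi_I)
      fix x assume "x \<in> carrier (E i)"
      then obtain k where k: "x = \<iota> (\<pi> i k)" using s(1) by auto
      show "d i x \<in> carrier (E (Suc i))" unfolding k d_\<iota> s(1) by blast
      show "d i (x \<oplus>\<^bsub>E i\<^esub> y) = d i x \<oplus>\<^bsub>E (Suc i)\<^esub> d i y" if yc: "y \<in> carrier (E i)" for y
      proof -
        obtain l where "y = \<iota> (\<pi> i l)" using yc s(1) by auto
        then show ?thesis by (simp only: k s(3) d_\<iota> p(1))
      qed
    next
      fix a x assume "a \<in> carrier Q" "x \<in> carrier (E i)"
      then obtain k where k: "x = \<iota> (\<pi> i k)" using s(1) by auto
      show "d i (a \<odot>\<^bsub>E i\<^esub> x) = a \<odot>\<^bsub>E (Suc i)\<^esub> d i x"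
      proof (cases "i = 0")
        case True
        then show ?thesis unfolding k s(4) d_\<iota> p(3) by (simp add: \<pi>_def)
      next
        case False
        then show ?thesis unfolding k s(4) d_\<iota> comp0[OF False] p(3) by (simp add: comp0 \<iota>eq)
      qed
    qed
    show "\<epsilon> ` carrier ?N = module_kernel (E 0) (E 1) (d 0)"
    proof -
      have im: "\<theta> ` carrier Q = UNIV" using bij by (rule bij_betw_imp_surj_on)
      have "module_kernel (E 0) (E 1) (d 0) = {\<iota> k | k. polar_part k = 0}"
        unfolding module_kernel_def s(1,2) by (auto simp: d_\<iota> \<pi>_def \<iota>eq)
      also have "\<dots> = (\<lambda>f. \<iota> (fps_to_fls f)) ` (\<theta> ` carrier Q)"
        unfolding polar_part_eq_0 im by auto
      finally show ?thesis by (auto simp: \<epsilon>_def)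
    qed
    show "d i ` carrier (E i) = module_kernel (E (Suc i)) (E (Suc (Suc i))) (d (Suc i))" for i
    proof -
      have "module_kernel (E (Suc i)) (E (Suc (Suc i))) (d (Suc i)) = carrier (E (Suc i))"
        unfolding module_kernel_def s(1,2) by (auto simp: d_\<iota> comp0)
      also have "\<dots> = d i ` carrier (E i)"
      proof (cases "i = 1")
        case False
        have "d i ` carrier (E i) = range (\<lambda>k. d i (\<iota> (\<pi> i k)))" unfolding s(1) by auto
        then show ?thesis unfolding d_\<iota> comp[OF False] s(1) by simp
      next
        case True
        have "d i ` carrier (E i) = range (\<lambda>k. d i (\<iota> (\<pi> i k)))" unfolding s(1) by auto
        also have "\<dots> = range (\<lambda>k. \<iota> (\<pi> (Suc i) k))" unfolding d_\<iota> using True by (simp add: comp0)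
        finally show ?thesis unfolding s(1) ..
      qed
      finally show ?thesis ..
    qed
  qed
  moreover have "carrier (E i) = {\<zero>\<^bsub>E i\<^esub>}" if "i > 1" for i
    using that unfolding s(1,2) by (auto simp: \<pi>_def)
  ultimately show ?thesis unfolding finite_self_injective_dim_def by blast
qed

subsection \<open>Transport of regularity along isomorphisms\<close>

context
  fixes Q :: "'q ring" and T :: "'t ring" and h
  assumes Q: "cring Q" and T: "cring T" and h: "h \<in> ring_iso Q T"
begin

interpretation Q: cring Q by (rule Q)
interpretation T: cring T by (rule T)

lemma iso_bij: "bij_betw h (carrier Q) (carrier T)"
  using h by (simp add: ring_iso_def)

lemma iso_inverse: "inv_into (carrier Q) h \<in> ring_iso T Q"
  by (rule ring_iso_set_sym[OF Q.ring_axioms h])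

lemma iso_inverse_image: "I \<subseteq> carrier Q \<Longrightarrow> inv_into (carrier Q) h ` h ` I = I"
  using bij_betw_imp_inj_on[OF iso_bij] by (rule inv_into_image_cancel)

lemma iso_image_inverse: "I \<subseteq> carrier T \<Longrightarrow> h ` inv_into (carrier Q) h ` I = I"
  using bij_betw_imp_surj_on[OF iso_bij] image_inv_into_cancel[of h "carrier Q"] by metis

lemma iso_image_mem: "I \<subseteq> carrier Q \<Longrightarrow> a \<in> carrier Q \<Longrightarrow> h a \<in> h ` I \<longleftrightarrow> a \<in> I"
  using bij_betw_imp_inj_on[OF iso_bij] by (simp add: inj_on_image_mem_iff)

lemma iso_image_carrier: "h ` carrier Q = carrier T"
  using iso_bij by (rule bij_betw_imp_surj_on)

lemma iso_ideal: 
  assumes I: "ideal I Q" shows "ideal (h ` I) T"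
proof -
  let ?k = "inv_into (carrier Q) h"
  interpret k: ring_hom_ring T Q ?k
    using iso_inverse Q.ring_axioms T.ring_axioms by (intro ring_hom_ringI2) (auto simp: ring_iso_def)
  have "I \<subseteq> carrier Q" using ideal.Icarr[OF I] by blast
  have "h ` I = {t \<in> carrier T. ?k t \<in> I}"
  proof (intro equalityI subsetI)
    fix t assume "t \<in> h ` I"
    then obtain i where "i \<in> I" "t = h i" by blast
    then show "t \<in> {t \<in> carrier T. ?k t \<in> I}"
      using \<open>I \<subseteq> carrier Q\<close> bij_betw_inv_into_left[OF iso_bij, of i] bij_betw_apply[OF iso_bij, of i] by auto
  next
    fix t assume "t \<in> {t \<in> carrier T. ?k t \<in> I}"
    then have "?k t \<in> I" "h (?k t) = t" using bij_betw_inv_into_right[OF iso_bij, of t] by auto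
    then show "t \<in> h ` I" by (metis imageI)
  qed
  then show ?thesis using k.ideal_vimage[OF I] by simp
qed

lemma iso_primeideal:
  assumes P: "primeideal P Q" shows "primeideal (h ` P) T"
proof -
  interpret P: primeideal P Q by fact
  have PQ: "P \<subseteq> carrier Q" using P.Icarr by blast
  show ?thesis
  proof (rule primeidealI[OF iso_ideal[OF P.is_ideal] T])
    show "carrier T \<noteq> h ` P"
      using iso_inverse_image[OF PQ] iso_inverse_image[OF order_refl] P.I_notcarr iso_image_carrier by metis
    fix a b assume ab: "a \<in> carrier T" "b \<in> carrier T" "a \<otimes>\<^bsub>T\<^esub> b \<in> h ` P"
    then obtain c d where cd: "c \<in> carrier Q" "d \<in> carrier Q" "a = h c" "b = h d"
      unfolding iso_image_carrier[symmetric] by blast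
    then have "h (c \<otimes>\<^bsub>Q\<^esub> d) \<in> h ` P" using ab(3) ring_iso_memE(2)[OF h] by simp
    then have "c \<otimes>\<^bsub>Q\<^esub> d \<in> P" using iso_image_mem[OF PQ] cd by simp
    then show "a \<in> h ` P \<or> b \<in> h ` P" using P.I_prime[OF cd(1,2)] cd(3,4) by blast
  qed
qed

lemma iso_genideal_subset:
  assumes B: "B \<subseteq> carrier Q" shows "Idl\<^bsub>T\<^esub> (h ` B) \<subseteq> h ` (Idl\<^bsub>Q\<^esub> B)"
proof (rule T.genideal_minimal)
  show "ideal (h ` (Idl\<^bsub>Q\<^esub> B)) T" by (rule iso_ideal[OF Q.genideal_ideal[OF B]])
  show "h ` B \<subseteq> h ` (Idl\<^bsub>Q\<^esub> B)" using Q.genideal_self[OF B] by (rule image_mono)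
qed

end

context
  fixes Q :: "'q ring" and T :: "'t ring" and h
  assumes Q: "cring Q" and T: "cring T" and h: "h \<in> ring_iso Q T"
begin

interpretation Q: cring Q by (rule Q)
interpretation T: cring T by (rule T)

abbreviation (input) "k \<equiv> inv_into (carrier Q) h"

lemma iso_ideal_inverse: "ideal I T \<Longrightarrow> ideal (k ` I) Q"
  by (rule iso_ideal[OF T Q iso_inverse[OF Q T h]])

text \<open>\<open>iso_genideal_subset\<close> is applied to \<open>h\<close> and to its inverse,
  for which the context fixing its isomorphism had to be closed first.\<close>

lemma iso_genideal:
  assumes B: "B \<subseteq> carrier Q" shows "h ` (Idl\<^bsub>Q\<^esub> B) = Idl\<^bsub>T\<^esub> (h ` B)"
proof
  have hB: "h ` B \<subseteq> carrier T" using B iso_image_carrier[OF Q T h] by blast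
  have "Idl\<^bsub>Q\<^esub> (k ` h ` B) \<subseteq> k ` (Idl\<^bsub>T\<^esub> (h ` B))"
    by (rule iso_genideal_subset[OF T Q iso_inverse[OF Q T h] hB])
  then have "h ` (Idl\<^bsub>Q\<^esub> B) \<subseteq> h ` k ` (Idl\<^bsub>T\<^esub> (h ` B))"
    unfolding iso_inverse_image[OF Q T h B] by (rule image_mono)
  also have "\<dots> = Idl\<^bsub>T\<^esub> (h ` B)"
    using ideal.Icarr[OF T.genideal_ideal[OF hB]] by (intro iso_image_inverse[OF Q T h]) blast
  finally show "h ` (Idl\<^bsub>Q\<^esub> B) \<subseteq> Idl\<^bsub>T\<^esub> (h ` B)" .
qed (rule iso_genideal_subset[OF Q T h B])

lemma iso_maximalideal:
  assumes M: "maximalideal M Q" shows "maximalideal (h ` M) T"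
proof -
  interpret M: maximalideal M Q by fact
  have MQ: "M \<subseteq> carrier Q" using M.Icarr by blast
  show ?thesis
  proof (rule maximalidealI[OF iso_ideal[OF Q T h M.is_ideal]])
    show "carrier T \<noteq> h ` M"
      using iso_inverse_image[OF Q T h MQ] iso_inverse_image[OF Q T h order_refl] M.I_notcarr iso_image_carrier[OF Q T h] by metis
    fix J assume J: "ideal J T" "h ` M \<subseteq> J" "J \<subseteq> carrier T"
    have kJ: "ideal (k ` J) Q" by (rule iso_ideal_inverse[OF J(1)])
    have "M \<subseteq> k ` J" using image_mono[OF J(2), of k] unfolding iso_inverse_image[OF Q T h MQ] .
    moreover have "k ` J \<subseteq> carrier Q" using ideal.Icarr[OF kJ] by blast
    ultimately have "k ` J = M \<or> k ` J = carrier Q" using M.I_maximal[OF kJ] by blast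
    then have "h ` k ` J = h ` M \<or> h ` k ` J = h ` carrier Q" by auto
    then show "J = h ` M \<or> J = carrier T" unfolding iso_image_inverse[OF Q T h J(3)] iso_image_carrier[OF Q T h] .
  qed
qed

lemma iso_krull_dim_le: "krull_dim Q \<le> krull_dim T"
  unfolding krull_dim_def
proof (rule Sup_subset_mono, clarify)
  fix n p assume p: "\<forall>i\<le>n. primeideal (p i) Q" "\<forall>i<n. p i \<subset> p (Suc i)"
  have "primeideal (h ` p i) T" if "i \<le> n" for i by (rule iso_primeideal[OF Q T h]) (use p(1) that in simp)
  moreover have "h ` p i \<subset> h ` p (Suc i)" if i: "i < n" for i
  proof -
    have c: "p j \<subseteq> carrier Q" if "j \<le> n" for j
    proof -
      have "primeideal (p j) Q" using p(1) that by simp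
      then have "ideal (p j) Q" by (rule primeideal.axioms(1))
      then show ?thesis using ideal.Icarr by (intro subsetI)
    qed
    have "p i \<noteq> p (Suc i)" "p i \<subseteq> p (Suc i)" using p(2) i by auto
    have "p i \<subseteq> carrier Q" "p (Suc i) \<subseteq> carrier Q" using c[of i] c[of "Suc i"] i by simp_all
    then have "h ` p i \<noteq> h ` p (Suc i)"
      using iso_inverse_image[OF Q T h, of "p i"] iso_inverse_image[OF Q T h, of "p (Suc i)"]
        \<open>p i \<noteq> p (Suc i)\<close> by metis
    then show ?thesis using image_mono[OF \<open>p i \<subseteq> p (Suc i)\<close>, of h] by blast
  qed
  ultimately show "\<exists>m. enat n = enat m \<and> (\<exists>p. (\<forall>i\<le>m. primeideal (p i) T) \<and> (\<forall>i<m. p i \<subset> p (Suc i)))"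
    by (intro exI[of _ n] conjI refl exI[of _ "\<lambda>i. h ` p i"]) auto
qed

end

lemma regular_local_ring_iso:
  fixes Q :: "'q ring" and T :: "'t ring"
  assumes Q: "cring Q" and T: "cring T" and h: "h \<in> ring_iso Q T" and reg: "regular_local_ring T"
  shows "regular_local_ring Q"
proof -
  interpret Q: cring Q by (rule Q)
  interpret T: cring T by (rule T)
  define k where "k = inv_into (carrier Q) h"
  have k: "k \<in> ring_iso T Q" unfolding k_def by (rule iso_inverse[OF Q T h])
  have kh: "k ` h ` I = I" if "I \<subseteq> carrier Q" for I unfolding k_def by (rule iso_inverse_image[OF Q T h that])
  have hk: "h ` k ` I = I" if "I \<subseteq> carrier T" for I unfolding k_def by (rule iso_image_inverse[OF Q T h that])
  have noeth: "noetherian_ring Q"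
  proof (intro noetherian_ring.intro noetherian_ring_axioms.intro Q.ring_axioms)
    fix I assume I: "ideal I Q"
    have IQ: "I \<subseteq> carrier Q" using ideal.Icarr[OF I] by blast
    have "noetherian_ring T" using reg by (simp add: regular_local_ring_def)
    then obtain A where A: "A \<subseteq> carrier T" "finite A" "h ` I = Idl\<^bsub>T\<^esub> A"
      using noetherian_ring.finetely_gen[OF _ iso_ideal[OF Q T h I]] by blast
    have "I = k ` (Idl\<^bsub>T\<^esub> A)" using kh[OF IQ] A(3) by simp
    also have "\<dots> = Idl\<^bsub>Q\<^esub> (k ` A)" by (rule iso_genideal[OF T Q k A(1)])
    finally have "I = Idl\<^bsub>Q\<^esub> (k ` A)" .
    moreover have "k ` A \<subseteq> carrier Q" using A(1) ring_iso_memE(1)[OF k] by blast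
    ultimately show "\<exists>A\<subseteq>carrier Q. finite A \<and> I = Idl\<^bsub>Q\<^esub> A" using A(2) by blast
  qed
  have "\<exists>!M. maximalideal M T" using reg by (simp add: regular_local_ring_def local_ring_def)
  then obtain M where M: "maximalideal M T" "\<And>M'. maximalideal M' T \<Longrightarrow> M' = M" by (rule ex1E) blast
  have MT: "M \<subseteq> carrier T" using ideal.Icarr[OF maximalideal.axioms(1)[OF M(1)]] by blast
  have uniq: "M' = k ` M" if M': "maximalideal M' Q" for M'
  proof -
    have "h ` M' = M" by (rule M(2)[OF iso_maximalideal[OF Q T h M']])
    then show ?thesis using kh[of M'] ideal.Icarr[OF maximalideal.axioms(1)[OF M']] by blast
  qed
  have kM: "maximalideal (k ` M) Q" by (rule iso_maximalideal[OF T Q k M(1)])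
  have local: "local_ring Q" unfolding local_ring_def using Q kM uniq by blast
  have maxT: "max_ideal T = M" unfolding max_ideal_def using M by (rule the_equality)
  have maxQ: "max_ideal Q = k ` M" unfolding max_ideal_def using kM uniq by (rule the_equality)
  have dim: "krull_dim Q = krull_dim T"
    using iso_krull_dim_le[OF Q T h] iso_krull_dim_le[OF T Q k] by (rule antisym)
  have "(\<exists>B. B \<subseteq> carrier Q \<and> finite B \<and> card B = n \<and> Idl\<^bsub>Q\<^esub> B = k ` M) \<longleftrightarrow>
    (\<exists>B. B \<subseteq> carrier T \<and> finite B \<and> card B = n \<and> Idl\<^bsub>T\<^esub> B = M)" for n
  proof
    assume "\<exists>B. B \<subseteq> carrier Q \<and> finite B \<and> card B = n \<and> Idl\<^bsub>Q\<^esub> B = k ` M"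
    then obtain B where B: "B \<subseteq> carrier Q" "finite B" "card B = n" "Idl\<^bsub>Q\<^esub> B = k ` M" by blast
    have "inj_on h B" using inj_on_subset[OF bij_betw_imp_inj_on[OF iso_bij[OF Q T h]] B(1)] .
    then have "card (h ` B) = n" using B(3) by (simp add: card_image)
    moreover have "Idl\<^bsub>T\<^esub> (h ` B) = M" using iso_genideal[OF Q T h B(1)] B(4) hk[OF MT] by simp
    moreover have "h ` B \<subseteq> carrier T" using B(1) ring_iso_memE(1)[OF h] by blast
    ultimately show "\<exists>B. B \<subseteq> carrier T \<and> finite B \<and> card B = n \<and> Idl\<^bsub>T\<^esub> B = M" using B(2) by blast
  next
    assume "\<exists>B. B \<subseteq> carrier T \<and> finite B \<and> card B = n \<and> Idl\<^bsub>T\<^esub> B = M"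
    then obtain B where B: "B \<subseteq> carrier T" "finite B" "card B = n" "Idl\<^bsub>T\<^esub> B = M" by blast
    have "inj_on k B" using inj_on_subset[OF bij_betw_imp_inj_on[OF iso_bij[OF T Q k]] B(1)] .
    then have "card (k ` B) = n" using B(3) by (simp add: card_image)
    moreover have "Idl\<^bsub>Q\<^esub> (k ` B) = k ` M" using iso_genideal[OF T Q k B(1)] B(4) by simp
    moreover have "k ` B \<subseteq> carrier Q" using B(1) ring_iso_memE(1)[OF k] by blast
    ultimately show "\<exists>B. B \<subseteq> carrier Q \<and> finite B \<and> card B = n \<and> Idl\<^bsub>Q\<^esub> B = k ` M" using B(2) by blast
  qed
  then have "embedding_dim Q = embedding_dim T" unfolding embedding_dim_def maxQ maxT by simp
  then show ?thesis using reg noeth local dim by (simp add: regular_local_ring_def)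
qed

subsection \<open>The monomial curve\<close>

text \<open>\<open>theta\<close> will substitute 2 = 0, \<open>t = u\<close>,
  \<open>y = u^5\<close>, \<open>z = u^7\<close>, one variable at a time from the inside.\<close>

definition theta1 :: "z2 fps \<Rightarrow> bit fps" where "theta1 = fps_map parity"
definition theta2 :: "z2 fps fps \<Rightarrow> bit fps" where "theta2 f = fps_eval (fps_X ^ 5) (fps_map theta1 f)"

definition theta :: "z2_series3 \<Rightarrow> bit fps" where "theta F = fps_eval (fps_X ^ 7) (fps_map theta2 F)"

lemma is_ring_hom_theta1: "is_ring_hom theta1"
  unfolding theta1_def by (intro is_ring_hom_fps_map is_ring_hom_parity)

lemma is_ring_hom_theta2: "is_ring_hom theta2"
proof -
  have "(fps_X ^ 5 :: bit fps) $ 0 = 0" by simp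
  from is_ring_hom_comp[OF is_ring_hom_fps_map[OF is_ring_hom_theta1] is_ring_hom_fps_eval[OF this]]
  show ?thesis unfolding theta2_def[abs_def] .
qed

lemma is_ring_hom_theta: "is_ring_hom theta"
proof -
  have "(fps_X ^ 7 :: bit fps) $ 0 = 0" by simp
  from is_ring_hom_comp[OF is_ring_hom_fps_map[OF is_ring_hom_theta2] is_ring_hom_fps_eval[OF this]]
  show ?thesis unfolding theta_def[abs_def] .
qed

lemma theta2_const: "theta2 (fps_const f) = theta1 f"
  unfolding theta2_def fps_map_const[OF is_ring_hom_theta1] by (rule fps_eval_hom(3)) simp

lemma theta_const: "theta (fps_const f) = theta2 f"
  unfolding theta_def fps_map_const[OF is_ring_hom_theta2] by (rule fps_eval_hom(3)) simp

lemma theta_vars: "theta var_t = fps_X" "theta var_y = fps_X ^ 5" "theta var_z = fps_X ^ 7"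
proof -
  show "theta var_t = fps_X"
    unfolding var_t_def theta_const theta2_const theta1_def by (rule fps_map_X[OF is_ring_hom_parity])
  show "theta var_y = fps_X ^ 5"
    unfolding var_y_def theta_const theta2_def fps_map_X[OF is_ring_hom_theta1] by (rule fps_eval_hom(4)) simp
  show "theta var_z = fps_X ^ 7"
    unfolding var_z_def theta_def fps_map_X[OF is_ring_hom_theta2] by (rule fps_eval_hom(4)) simp
qed

lemma bit_fps_two: "(1 :: bit fps) + 1 = 0"
proof (rule fps_ext)
  have "a + a = 0" for a :: bit by (cases "a = 0") simp_all
  then show "(1 + 1 :: bit fps) $ n = 0 $ n" for n unfolding fps_add_nth fps_zero_nth .
qed

lemma is_ring_hom_two: "is_ring_hom (h :: 'a::comm_ring_1 \<Rightarrow> bit fps) \<Longrightarrow> h 2 = 0"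
  using is_ring_hom_add[of h 1 1] by (simp add: is_ring_hom_1 bit_fps_two)

lemma is_ring_hom_phi: "is_ring_hom phi"
  using ring_hom_add[OF phi_hom] ring_hom_one[OF phi_hom]
  unfolding is_ring_hom_def ring_xyz_def ring_tyz_def by (simp add: phi_mult)

definition psi :: "z2_series3 \<Rightarrow> bit fps" where "psi F = theta (phi F)"

lemma is_ring_hom_psi: "is_ring_hom psi"
  unfolding psi_def[abs_def] by (rule is_ring_hom_comp[OF is_ring_hom_phi is_ring_hom_theta])

lemma psi_vars: "psi var_x = fps_X ^ 4" "psi var_y = fps_X ^ 5" "psi var_z = fps_X ^ 7"
  by (simp_all add: psi_def phi_simps is_ring_hom_power[OF is_ring_hom_theta] theta_vars)

lemma var_t_power: "var_t ^ n = fps_const (fps_const (fps_X ^ n))"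
  by (simp add: var_t_def fps_const_power)

lemma var_x_power: "var_x ^ n = fps_const (fps_const (fps_X ^ n))"
  by (simp add: var_x_def fps_const_power)

lemma fps_const_two: "fps_const 2 = (2 :: 'a::comm_ring_1 fps)"
  by (simp add: numeral_fps_const)

lemma theta1_kernel:
  assumes "theta1 s = 0" "is_ideal J" "(2 :: z2_series3) \<in> J"
  shows "fps_const (fps_const s) \<in> J"
proof -
  obtain s' where "s = 2 * s'" using fps_map_parity_eq_0[of s] assms(1) unfolding theta1_def by blast
  then have "fps_const (fps_const s) = fps_const (fps_const s') + fps_const (fps_const s')"
    by (simp only: mult_2 fps_const_add)
  also have "\<dots> = fps_const (fps_const s') * 2" by (rule mult_2_right[symmetric])
  finally have "fps_const (fps_const s) = fps_const (fps_const s') * 2" .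
  then show ?thesis using ideal_mult[OF assms(2,3), of "fps_const (fps_const s')"] by (simp only:)
qed

text \<open>Dividing by \<open>z - t^2 y\<close> and then by \<open>y - t^5\<close> leaves a series
  in \<open>t\<close> alone, whose image under \<open>theta\<close> is its reduction modulo
  2.\<close>

lemma theta_kernel:
  assumes J: "is_ideal J" "(2 :: z2_series3) \<in> J" "var_z - var_t ^ 2 * var_y \<in> J" "var_y - var_t ^ 5 \<in> J"
    and F: "theta F = 0"
  shows "F \<in> J"
proof -
  \<comment> \<open>This is \<open>t^2 y\<close> in the coefficient ring of
    \<open>z\<close>.\<close>
  define a :: "z2 fps fps" where "a = fps_const (fps_X ^ 2) * fps_X"
  have "a $ 0 = 0" by (simp add: a_def)
  then obtain q where q: "F = q * (fps_X - fps_const a) + fps_const (fps_eval a F)"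
    using fps_eval_division by blast
  define r where "r = fps_eval a F"
  have "(fps_X ^ 5 :: z2 fps) $ 0 = 0" by simp
  then obtain p where p: "r = p * (fps_X - fps_const (fps_X ^ 5)) + fps_const (fps_eval (fps_X ^ 5) r)"
    using fps_eval_division by blast
  define s where "s = fps_eval (fps_X ^ 5) r"
  have 1: "fps_X - fps_const a = var_z - var_t ^ 2 * var_y"
    by (simp add: a_def var_t_power var_y_def var_z_def flip: fps_const_mult)
  have 2: "fps_const (fps_X - fps_const (fps_X ^ 5)) = var_y - var_t ^ 5"
    by (simp add: var_t_power var_y_def flip: fps_const_sub)
  have "fps_const r = fps_const p * (var_y - var_t ^ 5) + fps_const (fps_const s)"
    unfolding s_def 2[symmetric] fps_const_mult fps_const_add p[symmetric] ..
  then have Fe: "F = q * (var_z - var_t ^ 2 * var_y) + (fps_const p * (var_y - var_t ^ 5) + fps_const (fps_const s))"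
    using q 1 unfolding r_def by simp
  note h = is_ring_hom_add[OF is_ring_hom_theta] is_ring_hom_mult[OF is_ring_hom_theta]
    is_ring_hom_diff[OF is_ring_hom_theta] is_ring_hom_power[OF is_ring_hom_theta]
  have "theta (var_z - var_t ^ 2 * var_y) = 0" "theta (var_y - var_t ^ 5) = 0"
    by (simp_all add: h theta_vars flip: power_add)
  then have "theta F = theta1 s" unfolding Fe by (simp only: h theta_const theta2_const mult_zero_right add_0)
  then have "fps_const (fps_const s) \<in> J" using F J by (intro theta1_kernel) simp_all
  then show ?thesis unfolding Fe using J by (intro ideal_add ideal_mult J) 
qed

lemma ideal_P_ideal: "is_ideal ideal_P"
  unfolding ideal_P_def ring_xyz_def by (rule is_ideal_genideal_rta)

lemma ideal_P_gens: "2 \<in> ideal_P" "var_y * var_z - var_x ^ 3 \<in> ideal_P"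
  "var_z ^ 2 - var_x * var_y ^ 2 \<in> ideal_P" "var_x ^ 2 * var_z - var_y ^ 3 \<in> ideal_P"
  using genideal_rta_subset[of "{2, var_y * var_z - var_x ^ 3,
      var_z ^ 2 - var_x * var_y ^ 2, var_x ^ 2 * var_z - var_y ^ 3}"]
  unfolding ideal_P_def ring_xyz_def by auto

lemma ideal_P_least:
  assumes "is_ideal J" "2 \<in> J" "var_y * var_z - var_x ^ 3 \<in> J"
    "var_z ^ 2 - var_x * var_y ^ 2 \<in> J" "var_x ^ 2 * var_z - var_y ^ 3 \<in> J"
  shows "ideal_P \<subseteq> J"
  unfolding ideal_P_def ring_xyz_def using assms by (intro genideal_rta_least) auto

lemma ideal_P_subset_kernel: "ideal_P \<subseteq> {F. psi F = 0}"
proof (rule ideal_P_least)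
  note h = is_ring_hom_diff[OF is_ring_hom_psi] is_ring_hom_mult[OF is_ring_hom_psi] 
    is_ring_hom_power[OF is_ring_hom_psi] psi_vars
  show "is_ideal {F. psi F = 0}" using is_prime_kernel[OF is_ring_hom_psi] by (rule is_prime_ideal)
  show "2 \<in> {F. psi F = 0}" using is_ring_hom_two[OF is_ring_hom_psi] by simp
  show "var_y * var_z - var_x ^ 3 \<in> {F. psi F = 0}" "var_z ^ 2 - var_x * var_y ^ 2 \<in> {F. psi F = 0}"
    "var_x ^ 2 * var_z - var_y ^ 3 \<in> {F. psi F = 0}"
    by (simp_all add: h flip: power_mult power_add)
qed

lemma psi_const: "psi (fps_const (fps_const s)) $ n = (if 4 dvd n then parity (s $ (n div 4)) else 0)"
proof -
  have "phi (fps_const (fps_const s)) = fps_const (fps_const (fps_compose s (fps_X ^ 4)))"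
    by (intro fps_ext[where 'a = "z2 fps fps"] fps_ext[where 'a = "z2 fps"] fps_ext[where 'a = z2])
      (simp add: phi_nth compose_X4_nth)
  then show ?thesis
    by (simp add: psi_def theta_const theta2_const theta1_def compose_X4_nth is_ring_hom_0[OF is_ring_hom_parity])
qed

text \<open>Modulo the relations every power series has the form \<open>a(x) + b(x) y + c(x) y\<^sup>2 + d(x) z\<close>.
  Its image under \<open>psi\<close> is \<open>a(u\<^sup>4) + b(u\<^sup>4) u\<^sup>5 + c(u\<^sup>4) u\<^sup>1\<^sup>0 + d(u\<^sup>4) u\<^sup>7\<close>, and the exponents
  of the four summands lie in different classes modulo 4.\<close>

lemma normal_form:
  "\<exists>a b c d. F - (fps_const (fps_const a) + fps_const (fps_const b) * var_y +
     fps_const (fps_const c) * var_y ^ 2 + fps_const (fps_const d) * var_z) \<in> ideal_P"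
proof -
  note P = ideal_P_ideal ideal_P_gens
  let ?c = "\<lambda>s. fps_const (fps_const s) :: z2_series3"
  define a :: "z2 fps fps" where "a = fps_const fps_X * fps_X ^ 2"
  have a0: "a $ 0 = 0" by (simp add: a_def)
  obtain q r where q: "F = q * (fps_X ^ 2 - fps_const a) + (\<Sum>k<2. fps_const (r k) * fps_X ^ k)"
    using fps_division[OF a0, of 2 F] by auto
  have 1: "fps_X ^ 2 - fps_const a = var_z ^ 2 - var_x * var_y ^ 2"
    by (simp add: a_def var_x_def var_y_def var_z_def fps_const_power flip: fps_const_mult)
  have F: "F = q * (var_z ^ 2 - var_x * var_y ^ 2) + fps_const (r 0) + fps_const (r 1) * var_z"
    using q unfolding 1 by (simp add: numeral_2_eq_2 var_z_def add.assoc)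
  \<comment> \<open>Only the part of the \<open>z\<close>-coefficient that is free of
    \<open>y\<close> stays with \<open>z\<close>. The rest has the form \<open>y r'\<close> and
    becomes \<open>x^3 r'\<close> by the relation \<open>y z = x^3\<close>; \<open>A\<close>
    collects it.\<close>
  obtain r' where r': "r 1 - fps_const (r 1 $ 0) = fps_X * r'"
    using fps_X_multiple[of "r 1 - fps_const (r 1 $ 0)"] by auto
  have r1: "fps_const (r 1) = ?c (r 1 $ 0) + var_y * fps_const r'"
    unfolding var_y_def fps_const_mult r'[symmetric] fps_const_add by simp
  define A where "A = r 0 + r' * fps_const (fps_X ^ 3)"
  have A: "fps_const A = fps_const (r 0) + fps_const r' * var_x ^ 3"
    by (simp add: A_def var_x_power flip: fps_const_add fps_const_mult)
  \<comment> \<open>The divisor is in the ideal: \<open>y^4 - x^5\<close> is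
    \<open>x^2 (y z - x^3) - y (x^2 z - y^3)\<close>.\<close>
  obtain p s where p: "A = p * (fps_X ^ 4 - fps_const (fps_X ^ 5)) + (\<Sum>k<4. fps_const (s k) * fps_X ^ k)"
    using fps_division[of "fps_X ^ 5 :: z2 fps" 4 A] by auto
  have "A = p * (fps_X ^ 4 - fps_const (fps_X ^ 5)) +
      (fps_const (s 0) + fps_const (s 1) * fps_X + fps_const (s 2) * fps_X ^ 2 + fps_const (s 3) * fps_X ^ 3)"
    using p by (simp add: eval_nat_numeral add.assoc)
  then have A2: "fps_const A = fps_const p * (var_y ^ 4 - var_x ^ 5) +
      (?c (s 0) + ?c (s 1) * var_y + ?c (s 2) * var_y ^ 2 + ?c (s 3) * var_y ^ 3)"
    by (simp add: var_y_def var_x_power fps_const_power flip: fps_const_add fps_const_mult fps_const_sub)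
  \<comment> \<open>The \<open>y^3\<close> term is traded for \<open>x^2 z\<close>.\<close>
  have c: "?c (s 3 * fps_X ^ 2 + r 1 $ 0) = ?c (s 3) * var_x ^ 2 + ?c (r 1 $ 0)"
    by (simp add: var_x_power flip: fps_const_add fps_const_mult)
  have "F - (?c (s 0) + ?c (s 1) * var_y + ?c (s 2) * var_y ^ 2 + ?c (s 3 * fps_X ^ 2 + r 1 $ 0) * var_z)
    = q * (var_z ^ 2 - var_x * var_y ^ 2) + fps_const r' * (var_y * var_z - var_x ^ 3)
      + fps_const p * (var_x ^ 2 * (var_y * var_z - var_x ^ 3) - var_y * (var_x ^ 2 * var_z - var_y ^ 3))
      - ?c (s 3) * (var_x ^ 2 * var_z - var_y ^ 3)"
  proof -
    have r0: "fps_const (r 0) = fps_const A - fps_const r' * var_x ^ 3" using A by simp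
    show ?thesis unfolding F r1 r0 A2 c by (simp add: algebra_simps eval_nat_numeral)
  qed
  also have "\<dots> \<in> ideal_P" by (intro ideal_add ideal_diff ideal_mult P)
  finally show ?thesis by blast
qed

lemma ideal_P_kernel: "ideal_P = {F. psi F = 0}"
proof
  show "{F. psi F = 0} \<subseteq> ideal_P"
  proof
    fix F assume "F \<in> {F. psi F = 0}"
    then have F: "psi F = 0" by simp
    let ?c = "\<lambda>s. fps_const (fps_const s) :: z2_series3"
    obtain a b c d where nf: "F - (?c a + ?c b * var_y + ?c c * var_y ^ 2 + ?c d * var_z) \<in> ideal_P"
      using normal_form by blast
    note h = is_ring_hom_add[OF is_ring_hom_psi] is_ring_hom_mult[OF is_ring_hom_psi]
      is_ring_hom_diff[OF is_ring_hom_psi] is_ring_hom_power[OF is_ring_hom_psi]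
    have "psi F - psi (?c a + ?c b * var_y + ?c c * var_y ^ 2 + ?c d * var_z) = 0"
      using nf ideal_P_subset_kernel unfolding h(3)[symmetric] by blast
    then have "psi (?c a + ?c b * var_y + ?c c * var_y ^ 2 + ?c d * var_z) = 0" using F by simp
    then have eq: "psi (?c a) + psi (?c b) * fps_X ^ 5 + psi (?c c) * fps_X ^ 10 + psi (?c d) * fps_X ^ 7 = 0"
      by (simp add: h psi_vars flip: power_mult)
    define g where "g s j n = (if n < j then 0 else psi (?c s) $ (n - j))" for s and j n :: nat
    have co: "g a 0 n + g b 5 n + g c 10 n + g d 7 n = 0" for n
      using arg_cong[OF eq, of "\<lambda>f. f $ n"]
      by (simp add: g_def fps_X_power_mult_right_nth del: add_bit_eq_xor)
    \<comment> \<open>\<open>i + 3 * j\<close> is \<open>i - j\<close> modulo 4, written without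
      subtraction.\<close>
    have g0: "g s j (4 * m + i) = 0" if "(i + 3 * j) mod 4 \<noteq> 0" for s m i j
    proof -
      have "4 * m + i < j \<or> \<not> 4 dvd (4 * m + i - j)" using that by presburger
      then show ?thesis by (auto simp: g_def psi_const)
    qed
    have g1: "g s j (4 * m + j) = parity (s $ m)" for s j m by (simp add: g_def psi_const)
    have par: "theta1 s = 0" if "\<And>m. parity (s $ m) = 0" for s
      unfolding theta1_def by (rule fps_ext) (simp add: that)
    have "parity (a $ m) = 0" for m
      using co[of "4 * m + 0"] unfolding g1 by (simp add: g0[of 0 _ _ m, simplified] del: add_bit_eq_xor)
    then have "theta1 a = 0" by (rule par)
    moreover have "parity (b $ m) = 0" for m
      using co[of "4 * m + 5"] unfolding g1 by (simp add: g0 del: add_bit_eq_xor)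
    then have "theta1 b = 0" by (rule par)
    moreover have "parity (c $ m) = 0" for m
      using co[of "4 * m + 10"] unfolding g1 by (simp add: g0 del: add_bit_eq_xor)
    then have "theta1 c = 0" by (rule par)
    moreover have "parity (d $ m) = 0" for m
      using co[of "4 * m + 7"] unfolding g1 by (simp add: g0 del: add_bit_eq_xor)
    then have "theta1 d = 0" by (rule par)
    ultimately have "?c a + ?c b * var_y + ?c c * var_y ^ 2 + ?c d * var_z \<in> ideal_P"
      using theta1_kernel[OF _ ideal_P_ideal ideal_P_gens(1)]
      by (intro ideal_add ideal_mult2 ideal_P_ideal) blast+
    then show "F \<in> ideal_P" using ideal_diff_cancel[OF ideal_P_ideal nf] by blast
  qed
qed (rule ideal_P_subset_kernel)

lemma ideal_P_prime: "is_prime ideal_P"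
  unfolding ideal_P_kernel by (rule is_prime_kernel[OF is_ring_hom_psi])

section \<open>The radical of the extended ideal\<close>

lemma is_ideal_radical:
  fixes I :: "'a::comm_ring_1 set"
  assumes I: "is_ideal I" shows "is_ideal {a. \<exists>n. a ^ n \<in> I}"
  unfolding is_ideal_def
proof (intro conjI ballI allI)
  show "0 \<in> {a. \<exists>n. a ^ n \<in> I}" using ideal_zero[OF I] by (auto intro!: exI[of _ 1])
next
  fix a b assume "a \<in> {a. \<exists>n. a ^ n \<in> I}" "b \<in> {a. \<exists>n. a ^ n \<in> I}"
  then obtain m n where mn: "a ^ m \<in> I" "b ^ n \<in> I" by auto
  have "(a + b) ^ (m + n) = (\<Sum>k\<le>m + n. of_nat (m + n choose k) * a ^ k * b ^ (m + n - k))" by (rule binomial_ring)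
  also have "\<dots> \<in> I"
  proof (rule ideal_sum_closed[OF I])
    fix k
    show "of_nat (m + n choose k) * a ^ k * b ^ (m + n - k) \<in> I"
    proof (cases "m \<le> k")
      case True
      then have "a ^ k = a ^ (k - m) * a ^ m" by (simp flip: power_add)
      then have "of_nat (m + n choose k) * a ^ k * b ^ (m + n - k) =
          (of_nat (m + n choose k) * a ^ (k - m) * b ^ (m + n - k)) * a ^ m" by (simp only: mult_ac)
      then show ?thesis using ideal_mult[OF I mn(1)] by (simp only:)
    next
      case False
      then have "b ^ (m + n - k) = b ^ (m - k) * b ^ n" by (simp flip: power_add)
      then have "of_nat (m + n choose k) * a ^ k * b ^ (m + n - k) =
          (of_nat (m + n choose k) * a ^ k * b ^ (m - k)) * b ^ n" by (simp only: mult_ac)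
      then show ?thesis using ideal_mult[OF I mn(2)] by (simp only:)
    qed
  qed
  finally show "a + b \<in> {a. \<exists>n. a ^ n \<in> I}" by blast
next
  fix a r assume "a \<in> {a. \<exists>n. a ^ n \<in> I}"
  then obtain n where "a ^ n \<in> I" by auto
  then have "(r * a) ^ n \<in> I" unfolding power_mult_distrib by (rule ideal_mult[OF I])
  then show "r * a \<in> {a. \<exists>n. a ^ n \<in> I}" by blast
qed

lemma radical_extended_ideal: "radical_ideal ring_tyz (extended_ideal ring_tyz phi ideal_P) = {F. theta F = 0}"
proof -
  define PS where "PS = extended_ideal ring_tyz phi ideal_P"
  have iPS: "is_ideal PS" unfolding PS_def extended_ideal_def ring_tyz_def by (rule is_ideal_genideal_rta)
  have phiP: "phi F \<in> PS" if "F \<in> ideal_P" for F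
    using genideal_rta_subset[of "phi ` ideal_P"] that unfolding PS_def extended_ideal_def ring_tyz_def by blast
  have prime: "is_prime {F. theta F = 0}" by (rule is_prime_kernel[OF is_ring_hom_theta])
  have "PS \<subseteq> {F. theta F = 0}"
    unfolding PS_def extended_ideal_def ring_tyz_def
  proof (rule genideal_rta_least[OF is_prime_ideal[OF prime]])
    show "phi ` ideal_P \<subseteq> {F. theta F = 0}" unfolding ideal_P_kernel by (auto simp: psi_def)
  qed
  define rad where "rad = {a. \<exists>n. a ^ n \<in> PS}"
  have rad: "radical_ideal ring_tyz PS = rad" by (simp add: radical_ideal_def rad_def ring_tyz_def)
  have irad: "is_ideal rad" unfolding rad_def by (rule is_ideal_radical[OF iPS])
  have PSrad: "a \<in> rad" if "a \<in> PS" for a using that unfolding rad_def by (auto intro!: exI[of _ 1])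
  have sq: "a \<in> rad" if "a ^ n \<in> rad" for a n
    using that unfolding rad_def by (auto simp flip: power_mult)
  have "rad \<subseteq> {F. theta F = 0}"
    unfolding rad_def using \<open>PS \<subseteq> {F. theta F = 0}\<close> prime_power[OF prime] by blast
  moreover have "{F. theta F = 0} \<subseteq> rad"
  proof
    fix F assume "F \<in> {F. theta F = 0}"
    note h = is_ring_hom_diff[OF is_ring_hom_phi] is_ring_hom_mult[OF is_ring_hom_phi] is_ring_hom_power[OF is_ring_hom_phi]
      is_ring_hom_add[OF is_ring_hom_phi, of 1 1] is_ring_hom_1[OF is_ring_hom_phi] phi_simps
    have two: "2 \<in> rad" using PSrad[OF phiP[OF ideal_P_gens(1)]] h(4,5) by simp
    have g: "var_y * var_z - var_t ^ 12 \<in> rad" "var_z ^ 2 - var_t ^ 4 * var_y ^ 2 \<in> rad"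
      "var_t ^ 8 * var_z - var_y ^ 3 \<in> rad"
      using PSrad[OF phiP[OF ideal_P_gens(2)]] PSrad[OF phiP[OF ideal_P_gens(3)]] PSrad[OF phiP[OF ideal_P_gens(4)]]
      by (simp_all add: h flip: power_mult)
    let ?d = "var_z - var_t ^ 2 * var_y" and ?w = "var_y - var_t ^ 5"
    \<comment> \<open>Both terms of \<open>z^2 - t^4 y^2\<close> are squares, so modulo 2 it is the
      square of \<open>?d\<close>.\<close>
    have "?d ^ 2 = (var_z ^ 2 - var_t ^ 4 * var_y ^ 2) + (var_t ^ 4 * var_y ^ 2 - var_t ^ 2 * var_y * var_z) * 2"
      by (simp add: algebra_simps eval_nat_numeral)
    also have "\<dots> \<in> rad" by (intro ideal_add ideal_mult irad g two)
    finally have d: "?d \<in> rad" by (rule sq)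
    \<comment> \<open>With \<open>z = t^2 y\<close>, and modulo 2, the relations
      \<open>y z - t^12\<close> and \<open>t^8 z - y^3\<close> become \<open>t^2 ?w^2\<close> and,
      up to sign, \<open>y ?w^2\<close>. As \<open>?w = y - t^5\<close>, these two combine to
      \<open>?w^3\<close>.\<close>
    have "var_t ^ 2 * ?w ^ 2 = (var_y * var_z - var_t ^ 12) - var_y * ?d + (var_t ^ 12 - var_t ^ 7 * var_y) * 2"
      by (simp add: algebra_simps eval_nat_numeral)
    also have "\<dots> \<in> rad" by (intro ideal_add ideal_diff ideal_mult irad g two d)
    finally have w1: "var_t ^ 2 * ?w ^ 2 \<in> rad" .
    have "var_y * ?w ^ 2 = var_t ^ 8 * ?d - (var_t ^ 8 * var_z - var_y ^ 3) + (var_t ^ 10 * var_y - var_t ^ 5 * var_y ^ 2) * 2"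
      by (simp add: algebra_simps eval_nat_numeral)
    also have "\<dots> \<in> rad" by (intro ideal_add ideal_diff ideal_mult irad g two d)
    finally have w2: "var_y * ?w ^ 2 \<in> rad" .
    have "?w ^ 3 = var_y * ?w ^ 2 - var_t ^ 3 * (var_t ^ 2 * ?w ^ 2)"
      by (simp add: algebra_simps eval_nat_numeral)
    also have "\<dots> \<in> rad" by (intro ideal_diff ideal_mult irad w1 w2)
    finally have w: "?w \<in> rad" by (rule sq)
    show "F \<in> rad" using theta_kernel[OF irad two d w] \<open>F \<in> {F. theta F = 0}\<close> by simp
  qed
  ultimately show ?thesis using rad unfolding PS_def by blast
qed

text \<open>Lifting the coefficients to 0 and 1 gives a preimage that is a series in
  \<open>t\<close> alone.\<close>

lemma theta_surj: "range theta = UNIV"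
proof (rule surjI)
  fix f :: "bit fps"
  have "parity (if b = 0 then 0 else 1) = b" for b :: bit
    by (cases "b = 0") (simp_all add: is_ring_hom_0[OF is_ring_hom_parity] is_ring_hom_1[OF is_ring_hom_parity])
  then show "theta (fps_const (fps_const (fps_map (\<lambda>b. if b = 0 then 0 else 1) f))) = f"
    unfolding theta_const theta2_const theta1_def by (intro fps_ext) (simp only: fps_map_nth)
qed

lemma quotient_iso:
  "\<exists>h. h \<in> ring_iso (ring_tyz Quot {F. theta F = 0}) (rta :: bit fps ring)"
proof -
  note h = is_ring_hom_theta
  have hom: "theta \<in> ring_hom ring_tyz rta"
    unfolding ring_tyz_def
    by (rule ring_hom_memI) (simp_all add: is_ring_hom_mult[OF h] is_ring_hom_add[OF h] is_ring_hom_1[OF h])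
  have "ring ring_tyz" unfolding ring_tyz_def by (rule ring_from_type_algebra)
  then interpret ring_hom_ring ring_tyz "rta :: bit fps ring" theta
    by (rule ring_hom_ringI2[OF _ ring_from_type_algebra hom])
  have "a_kernel ring_tyz rta theta = {F. theta F = 0}"
    unfolding a_kernel_def' ring_tyz_def rta_simps by (simp only: UNIV_I simp_thms)
  moreover have "theta ` carrier ring_tyz = carrier rta" unfolding ring_tyz_def rta_simps by (rule theta_surj)
  ultimately show ?thesis using FactRing_iso_set by metis
qed

subsection \<open>The quotient by the prime is not Gorenstein\<close>

text \<open>These substitutions detect that \<open>y\<^sup>2\<close> is not in \<open>(x, z) + P\<close> and \<open>z\<close> is not in \<open>(x) + P\<close>.\<close>

definition chi_y :: "z2_series3 \<Rightarrow> bit fps" where "chi_y F = fps_map (\<lambda>f. parity (f $ 0)) (F $ 0)"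
definition chi_z :: "z2_series3 \<Rightarrow> bit fps" where "chi_z F = fps_map (\<lambda>f. parity (f $ 0 $ 0)) F"

lemma is_ring_hom_chi: "is_ring_hom chi_y" "is_ring_hom chi_z"
proof -
  have 1: "is_ring_hom (\<lambda>f :: z2 fps. parity (f $ 0))"
    by (rule is_ring_hom_comp[OF is_ring_hom_fps_nth_0 is_ring_hom_parity])
  have 2: "is_ring_hom (\<lambda>f :: z2 fps fps. parity (f $ 0 $ 0))"
    by (rule is_ring_hom_comp[OF is_ring_hom_fps_nth_0 1])
  show "is_ring_hom chi_y"
    unfolding chi_y_def[abs_def] by (rule is_ring_hom_comp[OF is_ring_hom_fps_nth_0 is_ring_hom_fps_map[OF 1]])
  show "is_ring_hom chi_z"
    unfolding chi_z_def[abs_def] by (rule is_ring_hom_fps_map[OF 2])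
qed

lemma chi_vars: "chi_y var_x = 0" "chi_y var_y = fps_X" "chi_y var_z = 0"
  "chi_z var_x = 0" "chi_z var_y = 0" "chi_z var_z = fps_X"
  by (auto simp: fps_eq_iff chi_y_def chi_z_def var_x_def var_y_def var_z_def
      is_ring_hom_0[OF is_ring_hom_parity] is_ring_hom_1[OF is_ring_hom_parity])

lemma is_ideal_multiples: "is_ideal {g. d dvd g}" for d :: "'a::comm_ring_1"
  by (auto simp: is_ideal_def)

lemma fps_X_power_not_dvd: "m < n \<Longrightarrow> \<not> fps_X ^ n dvd (fps_X ^ m :: bit fps)"
proof
  assume "m < n" "fps_X ^ n dvd (fps_X ^ m :: bit fps)"
  then obtain g where "fps_X ^ m = fps_X ^ n * (g :: bit fps)" by (auto elim: dvdE)
  then have "(fps_X ^ m :: bit fps) $ m = (fps_X ^ n * g) $ m" by simp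
  then show False using \<open>m < n\<close> by (simp add: fps_X_power_mult_nth)
qed

text \<open>Setting 2, \<open>x\<close> and \<open>z\<close> to 0 takes the ideal into the multiples
  of \<open>fps_X ^ 3\<close>, but \<open>y^2\<close> to \<open>fps_X ^ 2\<close>.\<close>

lemma yy_notin: "var_y * var_y - (var_x * F + var_z * G) \<notin> ideal_P"
proof
  assume a: "var_y * var_y - (var_x * F + var_z * G) \<in> ideal_P"
  note h = is_ring_hom_diff[OF is_ring_hom_chi(1)] is_ring_hom_mult[OF is_ring_hom_chi(1)]
    is_ring_hom_add[OF is_ring_hom_chi(1)] is_ring_hom_power[OF is_ring_hom_chi(1)] chi_vars
  have "ideal_P \<subseteq> {F. chi_y F \<in> {g. fps_X ^ 3 dvd g}}"
    by (rule ideal_P_least[OF is_ideal_vimage[OF is_ring_hom_chi(1) is_ideal_multiples]])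
      (simp_all add: h is_ring_hom_two[OF is_ring_hom_chi(1)])
  then have "fps_X ^ 3 dvd chi_y (var_y * var_y - (var_x * F + var_z * G))" using a by blast
  then have "fps_X ^ 3 dvd (fps_X ^ 2 :: bit fps)" by (simp add: h power2_eq_square)
  then show False using fps_X_power_not_dvd[of 2 3] by simp
qed

text \<open>After setting 2, \<open>x\<close> and \<open>y\<close> to 0, only the generator with
  \<open>z^2\<close> survives, while \<open>z\<close> becomes \<open>fps_X\<close>.\<close>

lemma z_notin: "var_z - var_x * F \<notin> ideal_P"
proof
  assume a: "var_z - var_x * F \<in> ideal_P"
  note h = is_ring_hom_diff[OF is_ring_hom_chi(2)] is_ring_hom_mult[OF is_ring_hom_chi(2)]
    is_ring_hom_add[OF is_ring_hom_chi(2)] is_ring_hom_power[OF is_ring_hom_chi(2)] chi_vars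
  have "ideal_P \<subseteq> {F. chi_z F \<in> {g. fps_X ^ 2 dvd g}}"
    by (rule ideal_P_least[OF is_ideal_vimage[OF is_ring_hom_chi(2) is_ideal_multiples]])
      (simp_all add: h is_ring_hom_two[OF is_ring_hom_chi(2)])
  then have "fps_X ^ 2 dvd chi_z (var_z - var_x * F)" using a by blast
  then have "fps_X ^ 2 dvd (fps_X ^ 1 :: bit fps)" by (simp add: h)
  then show False using fps_X_power_not_dvd[of 1 2] by simp
qed

lemma maximal_ideal_gens:
  assumes "F \<in> (filt 1 :: z2_series3 set)"
  shows "\<exists>p q r s. F = var_x * p + var_z * q + var_y * r + 2 * s"
proof -
  let ?J = "{F :: z2_series3. \<exists>p q r s. F = var_x * p + var_z * q + var_y * r + 2 * s}"
  have "is_ideal ?J"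
    unfolding is_ideal_def
  proof (intro conjI ballI allI)
    show "0 \<in> ?J" by (intro CollectI exI[of _ 0]) simp
  next
    fix a b assume "a \<in> ?J" "b \<in> ?J"
    then obtain p q r s p' q' r' s' where "a = var_x * p + var_z * q + var_y * r + 2 * s"
      "b = var_x * p' + var_z * q' + var_y * r' + 2 * s'" by blast
    then have "a + b = var_x * (p + p') + var_z * (q + q') + var_y * (r + r') + 2 * (s + s')"
      by (simp add: algebra_simps)
    then show "a + b \<in> ?J" by blast
  next
    fix a c assume "a \<in> ?J"
    then obtain p q r s where "a = var_x * p + var_z * q + var_y * r + 2 * s" by blast
    then have "c * a = var_x * (c * p) + var_z * (c * q) + var_y * (c * r) + 2 * (c * s)"
      by (simp add: algebra_simps)
    then show "c * a \<in> ?J" by blast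
  qed
  moreover have "filt_gens \<subseteq> ?J"
  proof
    fix g :: z2_series3 assume "g \<in> filt_gens"
    then have "g = var_z \<or> g = var_y \<or> g = var_x \<or> g = 2"
      by (auto simp: filt_gens_fps_def filt_gens_z2_def var_x_def var_y_def var_z_def fps_const_two)
    moreover have "var_z = var_x * 0 + var_z * 1 + var_y * 0 + 2 * 0" "var_y = var_x * 0 + var_z * 0 + var_y * 1 + 2 * 0"
      "var_x = var_x * 1 + var_z * 0 + var_y * 0 + 2 * 0" "(2 :: z2_series3) = var_x * 0 + var_z * 0 + var_y * 0 + 2 * 1"
      by simp_all
    ultimately show "g \<in> ?J" unfolding mem_Collect_eq by metis
  qed
  ultimately show ?thesis using filt_1_generated[of ?J] assms by blast
qed

lemma not_gorenstein: "\<not> gorenstein_local_ring (ring_xyz Quot ideal_P)"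
proof -
  interpret P: primeideal ideal_P ring_xyz using ideal_P_prime by (simp add: ring_xyz_def)
  let ?B = "ring_xyz Quot ideal_P"
  define \<pi> where "\<pi> F = ideal_P +>\<^bsub>ring_xyz\<^esub> F" for F
  have B: "cring ?B" by (rule P.quotient_is_cring[OF P.is_cring])
  interpret B: cring ?B by (rule B)
  have hom: "\<pi> \<in> ring_hom ring_xyz ?B" unfolding \<pi>_def[abs_def] by (rule P.rcos_ring_hom)
  have c [simp]: "\<pi> F \<in> carrier ?B" for F using ring_hom_closed[OF hom] by (simp add: ring_xyz_def)
  have m: "\<pi> F \<otimes>\<^bsub>?B\<^esub> \<pi> G = \<pi> (F * G)" for F G using ring_hom_mult[OF hom, of F G] by (simp add: ring_xyz_def)
  have a: "\<pi> F \<oplus>\<^bsub>?B\<^esub> \<pi> G = \<pi> (F + G)" for F G using ring_hom_add[OF hom, of F G] by (simp add: ring_xyz_def)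
  have one: "\<one>\<^bsub>?B\<^esub> = \<pi> 1" using ring_hom_one[OF hom] by (simp add: ring_xyz_def)
  have zero: "\<zero>\<^bsub>?B\<^esub> = \<pi> 0" using ring_hom_zero[OF hom P.ring_axioms B.ring_axioms] by (simp add: ring_xyz_def)
  have eq: "\<pi> F = \<pi> G \<longleftrightarrow> F - G \<in> ideal_P" for F G
    using P.quotient_eq_iff_same_a_r_cos[OF P.is_ideal, of F G] by (simp add: \<pi>_def ring_xyz_def)
  have surj: "\<exists>F. b = \<pi> F" if "b \<in> carrier ?B" for b
    using that by (auto simp: FactRing_def A_RCOSETS_def' \<pi>_def ring_xyz_def)
  have x: "var_x \<notin> ideal_P" by (simp add: ideal_P_kernel psi_vars)
  \<comment> \<open>The witnesses read the relations as divisions by \<open>x\<close>: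
    \<open>z y = x x^2\<close>, \<open>z z = x y^2\<close> and \<open>y^3 = x (x z)\<close>.\<close>
  have "\<not> finite_self_injective_dim ?B"
  proof (rule infinite_self_injective_dim[OF B,
        where x = "\<pi> var_x" and y = "\<pi> var_y" and z = "\<pi> var_z"
        and \<alpha> = "\<pi> (var_x ^ 2)" and \<beta> = "\<pi> (var_y ^ 2)" and \<gamma> = "\<pi> (var_x * var_z)"])
    fix b assume b: "b \<in> carrier ?B" "\<pi> var_x \<otimes>\<^bsub>?B\<^esub> b = \<zero>\<^bsub>?B\<^esub>"
    obtain F where F: "b = \<pi> F" using surj[OF b(1)] by blast
    have "var_x * F \<in> ideal_P" using b(2) unfolding F m zero eq by simp
    then have "F \<in> ideal_P" using prime_mult[OF ideal_P_prime] x by blast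
    then show "b = \<zero>\<^bsub>?B\<^esub>" unfolding F zero eq by simp
  next
    have "var_z * var_y - var_x * var_x ^ 2 \<in> ideal_P"
      using ideal_P_gens(2) by (simp add: mult.commute eval_nat_numeral)
    then show "\<pi> var_z \<otimes>\<^bsub>?B\<^esub> \<pi> var_y = \<pi> var_x \<otimes>\<^bsub>?B\<^esub> \<pi> (var_x ^ 2)" unfolding m eq .
    show "\<pi> var_z \<otimes>\<^bsub>?B\<^esub> \<pi> var_z = \<pi> var_x \<otimes>\<^bsub>?B\<^esub> \<pi> (var_y ^ 2)"
      unfolding m eq using ideal_P_gens(3) by (simp add: power2_eq_square)
    have "var_y * (var_y * var_y) - var_x * (var_x * var_z) = - (var_x ^ 2 * var_z - var_y ^ 3)"
      by (simp add: algebra_simps eval_nat_numeral)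
    then have "var_y * (var_y * var_y) - var_x * (var_x * var_z) \<in> ideal_P"
      using ideal_uminus[OF ideal_P_ideal ideal_P_gens(4)] by simp
    then show "\<pi> var_y \<otimes>\<^bsub>?B\<^esub> (\<pi> var_y \<otimes>\<^bsub>?B\<^esub> \<pi> var_y) = \<pi> var_x \<otimes>\<^bsub>?B\<^esub> \<pi> (var_x * var_z)" unfolding m eq .
  next
    fix b assume "b \<in> carrier ?B"
    then obtain F where F: "b = \<pi> F" using surj by blast
    show "b \<in> Units ?B \<or> (\<exists>p\<in>carrier ?B. \<exists>q\<in>carrier ?B. \<exists>r\<in>carrier ?B.
      b = \<pi> var_x \<otimes>\<^bsub>?B\<^esub> p \<oplus>\<^bsub>?B\<^esub> \<pi> var_z \<otimes>\<^bsub>?B\<^esub> q \<oplus>\<^bsub>?B\<^esub> \<pi> var_y \<otimes>\<^bsub>?B\<^esub> r)"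
    proof (cases "F \<in> filt 1")
      case True
      then obtain p q r s where "F = var_x * p + var_z * q + var_y * r + 2 * s" using maximal_ideal_gens by blast
      \<comment> \<open>Of the four generators of the maximal ideal, 2 becomes 0 in the
        quotient.\<close>
      then have "F - (var_x * p + var_z * q + var_y * r) = s * 2" by (simp add: mult.commute)
      then have "F - (var_x * p + var_z * q + var_y * r) \<in> ideal_P"
        using ideal_mult[OF ideal_P_ideal ideal_P_gens(1)] by simp
      then have "b = \<pi> var_x \<otimes>\<^bsub>?B\<^esub> \<pi> p \<oplus>\<^bsub>?B\<^esub> \<pi> var_z \<otimes>\<^bsub>?B\<^esub> \<pi> q \<oplus>\<^bsub>?B\<^esub> \<pi> var_y \<otimes>\<^bsub>?B\<^esub> \<pi> r"
        unfolding F m a eq .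
      then show ?thesis using c by blast
    next
      case False
      then obtain G where G: "1 = F * G" using filt_unit by (blast elim: dvdE)
      have "\<pi> G \<otimes>\<^bsub>?B\<^esub> b = \<one>\<^bsub>?B\<^esub>" "b \<otimes>\<^bsub>?B\<^esub> \<pi> G = \<one>\<^bsub>?B\<^esub>"
        unfolding F m one by (simp_all add: G mult.commute)
      then show ?thesis unfolding Units_def using c F by blast
    qed
  next
    fix p assume "p \<in> carrier ?B"
    then obtain F where F: "p = \<pi> F" using surj by blast
    show "\<pi> var_z \<noteq> \<pi> var_x \<otimes>\<^bsub>?B\<^esub> p" unfolding F m eq by (rule z_notin)
  next
    fix p q assume "p \<in> carrier ?B" "q \<in> carrier ?B"
    then obtain F G where F: "p = \<pi> F" "q = \<pi> G" using surj by metis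
    show "\<pi> var_y \<otimes>\<^bsub>?B\<^esub> \<pi> var_y \<noteq> \<pi> var_x \<otimes>\<^bsub>?B\<^esub> p \<oplus>\<^bsub>?B\<^esub> \<pi> var_z \<otimes>\<^bsub>?B\<^esub> q"
      unfolding F m a eq by (rule yy_notin)
  qed (rule c)+
  then show ?thesis by (simp add: gorenstein_local_ring_def)
qed

subsection \<open>The extension of power series rings\<close>

lemma regular_series3: "regular_local_ring (rta :: z2_series3 ring)"
proof -
  obtain P where P: "prime_chain 1 (P :: nat \<Rightarrow> z2 set)" using prime_chain_z2 by blast
  obtain P1 where P1: "prime_chain (Suc 1) (P1 :: nat \<Rightarrow> z2 fps set)" using prime_chain_fps[OF P] by blast
  obtain P2 where P2: "prime_chain (Suc (Suc 1)) (P2 :: nat \<Rightarrow> z2 fps fps set)" using prime_chain_fps[OF P1] by blast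
  obtain P3 where P3: "prime_chain (Suc (Suc (Suc 1))) (P3 :: nat \<Rightarrow> z2_series3 set)" using prime_chain_fps[OF P2] by blast
  have "card (filt_gens :: z2 set) = 1" by (simp add: filt_gens_z2_def)
  then have "card (filt_gens :: z2_series3 set) \<le> Suc (Suc (Suc 1))"
    using card_filt_gens_fps[where 'a = z2] card_filt_gens_fps[where 'a = "z2 fps"]
      card_filt_gens_fps[where 'a = "z2 fps fps"] by linarith
  then show ?thesis by (rule regular_rta[OF P3])
qed

lemma regular_bit_fps: "regular_local_ring (rta :: bit fps ring)"
proof -
  obtain P where P: "prime_chain 0 (P :: nat \<Rightarrow> bit set)" using prime_chain_bit by blast
  obtain P1 where P1: "prime_chain (Suc 0) (P1 :: nat \<Rightarrow> bit fps set)" using prime_chain_fps[OF P] by blast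
  have "card (filt_gens :: bit fps set) \<le> Suc 0"
    using card_filt_gens_fps[where 'a = bit] by (simp add: filt_gens_bit_def)
  then show ?thesis by (rule regular_rta[OF P1])
qed

lemma finsum_module_via:
  fixes h :: "'a \<Rightarrow> 's::comm_ring_1"
  assumes M: "module R (module_via h (rta :: 's ring))" and A: "finite A"
  shows "(\<Oplus>\<^bsub>module_via h rta\<^esub>i\<in>A. f i) = (\<Sum>i\<in>A. f i)"
proof -
  interpret module R "module_via h (rta :: 's ring)" by fact
  show ?thesis using A by (induction A rule: finite_induct) simp_all
qed

text \<open>Division of \<open>n\<close> by 4 has a unique remainder, so exactly one of the four
  summands meets the exponent \<open>n\<close>. This gives existence and uniqueness of coordinates
  for the basis 1, \<open>t\<close>, \<open>t^2\<close>, \<open>t^3\<close>.\<close>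

lemma phi_combination_nth:
  fixes c :: "nat \<Rightarrow> z2_series3" and k j n :: nat
  shows "(\<Sum>i<4. phi (c i) * var_t ^ i) $ k $ j $ n = c (n mod 4) $ k $ j $ (n div 4)"
proof -
  have 1: "(G * fps_const (fps_const g)) $ k $ j = G $ k $ j * g" for G :: z2_series3 and g by simp
  have "(phi (c i) * var_t ^ i) $ k $ j $ n = (if i = n mod 4 then c (n mod 4) $ k $ j $ (n div 4) else 0)"
    if i: "i < 4" for i
  proof -
    have "(phi (c i) * var_t ^ i) $ k $ j $ n = (if n < i then 0 else phi (c i) $ k $ j $ (n - i))"
      unfolding var_t_power 1 by (simp add: fps_X_power_mult_right_nth)
    moreover have "n \<ge> i \<and> 4 dvd (n - i) \<longleftrightarrow> i = n mod 4" using i by presburger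
    moreover have "(n - i) div 4 = n div 4" if "i = n mod 4" using that by presburger
    ultimately show ?thesis by (auto simp: phi_nth)
  qed
  then have "(\<Sum>i<4. phi (c i) * var_t ^ i) $ k $ j $ n = (\<Sum>i<4. if i = n mod 4 then c (n mod 4) $ k $ j $ (n div 4) else 0)"
    unfolding fps_sum_nth by (intro sum.cong refl) simp
  also have "\<dots> = c (n mod 4) $ k $ j $ (n div 4)" by (subst sum.delta) simp_all
  finally show ?thesis .
qed

lemma free_of_rank_4: "free_of_rank ring_xyz (module_via phi ring_tyz) 4"
proof -
  let ?M = "module_via phi ring_tyz"
  have M: "module ring_xyz ?M"
    using module_module_via[OF _ _ phi_hom] by (simp add: ring_xyz_def ring_tyz_def cring_from_type_algebra)
  have sum: "(\<Oplus>\<^bsub>?M\<^esub>i\<in>{..<4}. c i \<odot>\<^bsub>?M\<^esub> var_t ^ i) = (\<Sum>i<4. phi (c i) * var_t ^ i)" for c :: "nat \<Rightarrow> z2_series3"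
    using finsum_module_via[of ring_xyz phi "{..<4}" "\<lambda>i. phi (c i) * var_t ^ i"] M
    by (simp add: ring_tyz_def)
  have "\<exists>!c. c \<in> {..<4::nat} \<rightarrow>\<^sub>E carrier ring_xyz \<and> s = (\<Oplus>\<^bsub>?M\<^esub>i\<in>{..<4}. c i \<odot>\<^bsub>?M\<^esub> var_t ^ i)" for s
  proof (rule ex1I)
    let ?c = "\<lambda>i\<in>{..<4::nat}. Abs_fps (\<lambda>k. Abs_fps (\<lambda>j. Abs_fps (\<lambda>q. s $ k $ j $ (4 * q + i))))"
    have "s $ k $ j $ n = (\<Sum>i<4. phi (?c i) * var_t ^ i) $ k $ j $ n" for k j n
      unfolding phi_combination_nth by simp
    then have "s = (\<Sum>i<4. phi (?c i) * var_t ^ i)"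
      by (intro fps_ext[where 'a = "z2 fps fps"] fps_ext[where 'a = "z2 fps"] fps_ext[where 'a = z2])
    then show "?c \<in> {..<4} \<rightarrow>\<^sub>E carrier ring_xyz \<and> s = (\<Oplus>\<^bsub>?M\<^esub>i\<in>{..<4}. ?c i \<odot>\<^bsub>?M\<^esub> var_t ^ i)"
      unfolding sum by (simp add: ring_xyz_def)
    fix c assume c: "c \<in> {..<4} \<rightarrow>\<^sub>E carrier ring_xyz \<and> s = (\<Oplus>\<^bsub>?M\<^esub>i\<in>{..<4}. c i \<odot>\<^bsub>?M\<^esub> var_t ^ i)"
    show "c = ?c"
    proof (rule extensionalityI)
      show "c \<in> extensional {..<4}" using c by (simp add: PiE_def)
      show "?c \<in> extensional {..<4}" by simp
      fix i :: nat assume i: "i \<in> {..<4}"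
      have "s = (\<Sum>i<4. phi (c i) * var_t ^ i)" using c unfolding sum by blast
      then have "s $ k $ j $ (4 * q + i) = c i $ k $ j $ q" for k j q
        using phi_combination_nth[of c k j "4 * q + i"] i by simp
      then show "c i = ?c i" using i
        by (intro fps_ext[where 'a = "z2 fps fps"] fps_ext[where 'a = "z2 fps"] fps_ext[where 'a = z2]) simp
    qed
  qed
  then have "\<forall>s\<in>carrier ?M. \<exists>!c. c \<in> {..<4::nat} \<rightarrow>\<^sub>E carrier ring_xyz \<and>
      s = (\<Oplus>\<^bsub>?M\<^esub>i\<in>{..<4}. c i \<odot>\<^bsub>?M\<^esub> var_t ^ i)"
    by (rule ballI)
  moreover have "(\<lambda>i. var_t ^ i) \<in> {..<4::nat} \<rightarrow> carrier ?M" by (simp add: ring_tyz_def)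
  ultimately show ?thesis unfolding free_of_rank_def by (rule conjI[OF M bexI])
qed

instance fps :: (ring_char_0) ring_char_0 ..

lemma phi_inj: "inj phi"
proof (rule injI)
  fix F G assume "phi F = phi G"
  then have "phi F $ k $ j $ (4 * i) = phi G $ k $ j $ (4 * i)" for k j i by simp
  then show "F = G"
    by (intro fps_ext[where 'a = "z2 fps fps"] fps_ext[where 'a = "z2 fps"] fps_ext[where 'a = z2]) (simp add: phi_nth)
qed

theorem proposition4p3:
  shows
    "(regular_local_ring ring_xyz \<and> complete_local_ring ring_xyz \<and> characteristic_zero ring_xyz \<and>
      regular_local_ring ring_tyz \<and> complete_local_ring ring_tyz \<and> characteristic_zero ring_tyz) \<and>
     free_of_rank ring_xyz (module_via phi ring_tyz) 4 \<and>
     primeideal ideal_P ring_xyz \<and>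
     (regular_local_ring (ring_tyz Quot radical_ideal ring_tyz (extended_ideal ring_tyz phi ideal_P)) \<and>
      gorenstein_local_ring (ring_tyz Quot radical_ideal ring_tyz (extended_ideal ring_tyz phi ideal_P))) \<and>
     \<not> gorenstein_local_ring (ring_xyz Quot ideal_P) \<and>
     \<not> (\<forall>(R :: z2_series3 ring) (S :: z2_series3 ring) \<phi> P.
          regular_local_ring R \<and> characteristic_zero R \<and>
          regular_local_ring S \<and> characteristic_zero S \<and>
          \<phi> \<in> ring_hom R S \<and> inj_on \<phi> (carrier R) \<and> finite_free R (module_via \<phi> S) \<and>
          primeideal P R \<longrightarrow>
          gorenstein_local_ring (S Quot radical_ideal S (extended_ideal S \<phi> P)) \<longrightarrow>
          gorenstein_local_ring (R Quot P))"
proof -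
  have series3: "regular_local_ring ring_xyz" "complete_local_ring ring_xyz" "characteristic_zero ring_xyz"
    "regular_local_ring ring_tyz" "complete_local_ring ring_tyz" "characteristic_zero ring_tyz"
    unfolding ring_xyz_def ring_tyz_def
    using regular_series3 complete_rta[where 'a = z2_series3] characteristic_zero_rta[where 'a = z2_series3] by blast+
  have prime: "primeideal ideal_P ring_xyz" using ideal_P_prime by (simp add: ring_xyz_def)
  let ?I = "radical_ideal ring_tyz (extended_ideal ring_tyz phi ideal_P)"
  have "is_ideal ?I"
    unfolding radical_extended_ideal using is_prime_kernel[OF is_ring_hom_theta] by (rule is_prime_ideal)
  then have Q: "cring (ring_tyz Quot ?I)"
    by (intro ideal.quotient_is_cring) (simp_all add: ring_tyz_def cring_from_type_algebra)
  obtain h where h: "h \<in> ring_iso (ring_tyz Quot ?I) (rta :: bit fps ring)"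
    using quotient_iso unfolding radical_extended_ideal by blast
  have reg: "regular_local_ring (ring_tyz Quot ?I)"
    by (rule regular_local_ring_iso[OF Q cring_from_type_algebra h regular_bit_fps])
  then have gor: "gorenstein_local_ring (ring_tyz Quot ?I)"
    using finite_self_injective_dim_of_iso[OF Q h] by (simp add: gorenstein_local_ring_def regular_local_ring_def)
  have fin: "finite_free ring_xyz (module_via phi ring_tyz)"
    unfolding finite_free_def using free_of_rank_4 by blast
  have inj: "inj_on phi (carrier ring_xyz)" using phi_inj by (simp add: ring_xyz_def)
  \<comment> \<open>The general implication is refuted by these very rings, map and prime.\<close>
  show ?thesis
    using series3 free_of_rank_4 prime reg gor not_gorenstein phi_hom inj fin by blast
qed

end
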